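(* Let $K$ be an algebraically closed field of characteristic $0$, let $n\ge1$ be an integer and let $\ell_1,\dots,\ell_n\in\mathbb{Z}$. Then the scheme $\mathcal{V}_{\ell_1,\dots,\ell_n}\subset\mathbb{P}^{n^2}_K$ defined in the context is irreducible of dimension $n^2-n$.
   Context: Let $A=(A_{ij})_{1\le i,j\le n}$ be an $n\times n$ matrix of independent variables, and write $\det(XI_n-A)=X^n+a_1(A)X^{n-1}+\cdots+a_n(A)$, where $a_k\in\mathbb{Z}[(A_{ij})_{1\le i,j\le n}]$ is homogeneous of degree $k$. Let $Z$ be a further variable, and regard the $A_{ij}$ together with $Z$ as projective coordinates on $\mathbb{P}^{n^2}_K$. For $\ell_1,\dots,\ell_n\in K$, $\mathcal{V}_{\ell_1,\dots,\ell_n}\subset\mathbb{P}^{n^2}_K$ is the closed subscheme (over $\mathrm{Spec}(K)$) cut out by the $n$ homogeneous polynomials $a_1(A)-\ell_1Z,\ a_2(A)-\ell_2Z^2,\ \dots,\ a_n(A)-\ell_nZ^n$. Integers are viewed as elements of $K$. *)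

theory Defs
  imports
    "HOL-Analysis.Analysis"
    "HOL-Algebra.Algebraic_Closure_Type"
    "HOL-Library.Poly_Mapping"
begin

section \<open>Polynomial rings in several variables\<close>

type_synonym ('v, 'k) mpoly = "('v \<Rightarrow>\<^sub>0 nat) \<Rightarrow>\<^sub>0 'k"

definition Const :: "'k::comm_ring_1 \<Rightarrow> ('v, 'k) mpoly" where
  "Const c = Poly_Mapping.single 0 c"

definition Var :: "'v \<Rightarrow> ('v, 'k::comm_ring_1) mpoly" where
  "Var v = Poly_Mapping.single (Poly_Mapping.single v 1) 1"

definition monomial_degree :: "('v \<Rightarrow>\<^sub>0 nat) \<Rightarrow> nat" where
  "monomial_degree m = (\<Sum>v\<in>Poly_Mapping.keys m. Poly_Mapping.lookup m v)"

definition homogeneous_component :: "nat \<Rightarrow> ('v, 'k::comm_ring_1) mpoly \<Rightarrow> ('v, 'k) mpoly" where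
  "homogeneous_component d f =
     (\<Sum>m\<in>{m \<in> Poly_Mapping.keys f. monomial_degree m = d}.
        Poly_Mapping.single m (Poly_Mapping.lookup f m))"

section \<open>The projective spectrum\<close>

text \<open>
  The points of \<open>Proj K[v. v \<in> UNIV]\<close>, i.e. of the projective space over \<open>K\<close> with one
  homogeneous coordinate for each element of the type \<open>'v\<close>: homogeneous prime ideals that do
  not contain the irrelevant ideal of polynomials with zero constant term.
\<close>

definition homogeneous_prime :: "('v, 'k::comm_ring_1) mpoly set \<Rightarrow> bool" where
  "homogeneous_prime P \<longleftrightarrow>
     primeideal P ring_of_type_algebra \<and> (\<forall>f\<in>P. \<forall>d. homogeneous_component d f \<in> P)"

definition irrelevant_ideal :: "('v, 'k::comm_ring_1) mpoly set" where
  "irrelevant_ideal = {f. homogeneous_component 0 f = 0}"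

definition Proj_points :: "('v, 'k::comm_ring_1) mpoly set set" where
  "Proj_points = {P. homogeneous_prime P \<and> \<not> irrelevant_ideal \<subseteq> P}"

text \<open>
  The elements of \<open>E\<close> need not be homogeneous here; as the points are homogeneous ideals,
  \<open>E\<close> may always be replaced by the set of homogeneous components of its elements.
\<close>

definition Proj_zeros :: "('v, 'k::comm_ring_1) mpoly set \<Rightarrow> ('v, 'k) mpoly set set" where
  "Proj_zeros E = {P \<in> Proj_points. E \<subseteq> P}"

definition Proj_space :: "('v, 'k::comm_ring_1) mpoly set topology" where
  "Proj_space = topology (\<lambda>U. \<exists>E. U = Proj_points - Proj_zeros E)"

lemma istopology_Proj:
  "istopology (\<lambda>U. \<exists>E :: ('v, 'k::comm_ring_1) mpoly set. U = Proj_points - Proj_zeros E)"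
  unfolding istopology_def
proof (intro conjI allI impI)
  fix S T :: "('v, 'k) mpoly set set"
  assume "\<exists>E. S = Proj_points - Proj_zeros E" and "\<exists>E. T = Proj_points - Proj_zeros E"
  then obtain E F where S: "S = Proj_points - Proj_zeros E" and T: "T = Proj_points - Proj_zeros F"
    by blast
  have "E \<subseteq> P \<or> F \<subseteq> P \<longleftrightarrow> {e * f | e f. e \<in> E \<and> f \<in> F} \<subseteq> P"
    if "P \<in> Proj_points" for P :: "('v, 'k) mpoly set"
  proof -
    from that have P: "primeideal P ring_of_type_algebra"
      by (simp add: Proj_points_def homogeneous_prime_def)
    interpret primeideal P "ring_of_type_algebra :: ('v, 'k) mpoly ring" by (rule P)
    have pr: "a * b \<in> P \<Longrightarrow> a \<in> P \<or> b \<in> P" for a b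
      using I_prime[of a b] by (simp add: ring_of_type_algebra_def)
    have ml: "a \<in> P \<Longrightarrow> x * a \<in> P" for a x
      using I_l_closed[of a x] by (simp add: ring_of_type_algebra_def)
    have mr: "a \<in> P \<Longrightarrow> a * x \<in> P" for a x
      using I_r_closed[of a x] by (simp add: ring_of_type_algebra_def)
    show ?thesis
      using pr ml mr by blast
  qed
  then have "S \<inter> T = Proj_points - Proj_zeros {e * f | e f. e \<in> E \<and> f \<in> F}"
    unfolding S T Proj_zeros_def by blast
  then show "\<exists>G. S \<inter> T = Proj_points - Proj_zeros G" by blast
next
  fix \<K> :: "('v, 'k) mpoly set set set"
  assume "\<forall>K\<in>\<K>. \<exists>E. K = Proj_points - Proj_zeros E"
  then obtain e where e: "\<And>K. K \<in> \<K> \<Longrightarrow> K = Proj_points - Proj_zeros (e K)" by metis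
  have "\<Union>\<K> = Proj_points - Proj_zeros (\<Union>K\<in>\<K>. e K)"
  proof (intro equalityI subsetI)
    fix P assume "P \<in> \<Union>\<K>"
    then obtain K where "K \<in> \<K>" "P \<in> K" by blast
    then show "P \<in> Proj_points - Proj_zeros (\<Union>K\<in>\<K>. e K)"
      using e[of K] by (auto simp: Proj_zeros_def)
  next
    fix P assume P: "P \<in> Proj_points - Proj_zeros (\<Union>K\<in>\<K>. e K)"
    then obtain K where K: "K \<in> \<K>" "\<not> e K \<subseteq> P" by (auto simp: Proj_zeros_def)
    then have "P \<in> K" using e[of K] P by (auto simp: Proj_zeros_def)
    then show "P \<in> \<Union>\<K>" using K by blast
  qed
  then show "\<exists>G. \<Union>\<K> = Proj_points - Proj_zeros G" by blast
qed

lemma openin_Proj_space: "openin Proj_space U \<longleftrightarrow> (\<exists>E. U = Proj_points - Proj_zeros E)"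
  unfolding Proj_space_def by (simp add: topology_inverse'[OF istopology_Proj])

lemma topspace_Proj_space:
  "topspace Proj_space = (Proj_points :: ('v, 'k::comm_ring_1) mpoly set set)"
proof -
  have "Proj_points = Proj_points - Proj_zeros {1 :: ('v, 'k) mpoly}"
  proof -
    have "1 \<notin> P" if "P \<in> Proj_points" for P :: "('v, 'k) mpoly set"
    proof
      assume 1: "1 \<in> P"
      from that have P: "primeideal P ring_of_type_algebra"
        by (simp add: Proj_points_def homogeneous_prime_def)
      interpret primeideal P "ring_of_type_algebra :: ('v, 'k) mpoly ring" by (rule P)
      have "P = UNIV" using I_l_closed[OF 1] by (auto simp: ring_of_type_algebra_def)
      with I_notcarr show False by (simp add: ring_of_type_algebra_def)
    qed
    then show ?thesis by (auto simp: Proj_zeros_def)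
  qed
  then have "openin Proj_space (Proj_points :: ('v, 'k) mpoly set set)"
    unfolding openin_Proj_space by blast
  moreover have "topspace Proj_space \<subseteq> (Proj_points :: ('v, 'k) mpoly set set)"
    using openin_topspace[of Proj_space] unfolding openin_Proj_space by blast
  ultimately show ?thesis using openin_subset by blast
qed

lemma closedin_Proj_space: "closedin Proj_space C \<longleftrightarrow> (\<exists>E. C = Proj_zeros E)"
proof
  assume "closedin Proj_space C"
  then obtain E where "C \<subseteq> Proj_points" "Proj_points - C = Proj_points - Proj_zeros E"
    unfolding closedin_def topspace_Proj_space openin_Proj_space by blast
  moreover have "Proj_zeros E \<subseteq> Proj_points" by (auto simp: Proj_zeros_def)
  ultimately show "\<exists>E. C = Proj_zeros E" by blast
next
  assume "\<exists>E. C = Proj_zeros E"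
  then show "closedin Proj_space C"
    unfolding closedin_def topspace_Proj_space openin_Proj_space
    by (auto simp: Proj_zeros_def)
qed

text \<open>
  The underlying topological space of the closed subscheme of \<open>Proj K[v. v \<in> UNIV]\<close> cut out by
  a set \<open>E\<close> of homogeneous polynomials. Irreducibility and dimension of a scheme are by
  definition those of its underlying space, so the structure sheaf is not needed for them.
\<close>

definition Proj_closed_subscheme ::
  "('v, 'k::comm_ring_1) mpoly set \<Rightarrow> ('v, 'k) mpoly set topology" where
  "Proj_closed_subscheme E = subtopology Proj_space (Proj_zeros E)"

section \<open>Irreducibility and Krull dimension of topological spaces\<close>

definition irreducible_space :: "'a topology \<Rightarrow> bool" where
  "irreducible_space T \<longleftrightarrow> topspace T \<noteq> {} \<and>
     (\<forall>C D. closedin T C \<longrightarrow> closedin T D \<longrightarrow> C \<union> D = topspace T \<longrightarrow>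
        C = topspace T \<or> D = topspace T)"

text \<open>The supremum is \<open>-\<infinity>\<close> for the empty space.\<close>

definition krull_dimension :: "'a topology \<Rightarrow> ereal" where
  "krull_dimension T = Sup {ereal (real d) | d. \<exists>C :: nat \<Rightarrow> 'a set.
     (\<forall>i\<le>d. closedin T (C i) \<and> irreducible_space (subtopology T (C i))) \<and>
     (\<forall>i<d. C i \<subset> C (Suc i))}"

section \<open>Matrices with prescribed characteristic polynomial\<close>

text \<open>
  The coordinate ring has a variable \<open>Some (i, j)\<close> for each matrix entry and the further
  variable \<open>None\<close>.
\<close>

definition generic_matrix :: "(('n \<times> 'n) option, 'k::comm_ring_1) mpoly ^ 'n ^ 'n" where
  "generic_matrix = (\<chi> i j. Var (Some (i, j)))"

definition Zvar :: "(('n \<times> 'n) option, 'k::comm_ring_1) mpoly" where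
  "Zvar = Var None"

definition charpoly :: "'r::comm_ring_1 ^ 'n ^ 'n \<Rightarrow> 'r poly" where
  "charpoly A = det (mat [:0, 1:] - (\<chi> i j. [:A $ i $ j:]))"

text \<open>This is the coefficient of \<open>X ^ (n - k)\<close>; it is only used for \<open>1 \<le> k \<le> n\<close>.\<close>

definition charpoly_coeff :: "nat \<Rightarrow> (('n::finite \<times> 'n) option, 'k::comm_ring_1) mpoly" where
  "charpoly_coeff k = poly.coeff
     (charpoly (generic_matrix :: (('n \<times> 'n) option, 'k) mpoly ^ 'n ^ 'n)) (CARD('n) - k)"

definition charpoly_scheme ::
  "(nat \<Rightarrow> int) \<Rightarrow> (('n::finite \<times> 'n) option, 'k::comm_ring_1) mpoly set topology" where
  "charpoly_scheme l =
     Proj_closed_subscheme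
       ((\<lambda>k. charpoly_coeff k - Const (of_int (l k)) * Zvar ^ k) ` {1..CARD('n)})"

end

theory Submission
  imports Defs
begin

text \<open>
  Let \<open>C\<close> be the cone of pairs \<open>(A, z)\<close> over \<open>K\<close> with
  \<open>det (x - A) = x\<^sup>n + \<Sum>\<^sub>k l\<^sub>k z\<^sup>k x\<^bsup>n-k\<^esup>\<close>. Expanding along the last row, this is a linear
  system for that row whose matrix depends only on the other rows; where the system is nonsingular,
  the other rows and \<open>z\<close> are free coordinates. Hence the nonsingular part of \<open>C\<close> is irreducible,
  and imposing \<open>n\<^sup>2 - n\<close> linear conditions one after the other on these coordinates gives a chain
  of irreducible subcones. Triangularizing \<open>A = g t g\<^sup>-\<^sup>1\<close> and moving \<open>g\<close> to the identity and the
  strictly upper part of \<open>t\<close> to the shift matrix joins every point of \<open>C\<close> to a nonsingular one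
  inside \<open>C\<close>, so by the Nullstellensatz the ideal of the nonsingular part lies in every prime that
  contains the equations. Modulo the equations the ring is finite over the polynomials in \<open>z\<close> and
  the off-diagonal entries, which bounds the number of independent variables, and so the lengths of
  chains of primes, from above.
\<close>

section \<open>Evaluation of polynomials\<close>

text \<open>Every density argument runs along a polynomial curve: two points of the cone are joined
  by a curve with polynomial coordinates, and two nonzero polynomials in its parameter are nonzero
  at a common value. Solving for a row and conjugating by a matrix both bring in denominators. They
  are cleared by rescaling the whole point, which keeps it on the cone because (A, z) may be
  multiplied by any nonzero scalar. The nonsingular locus consists of the A for which the last unit
  vector is cyclic; the shift matrix, completed by a suitable last row, is a companion matrix and
  lies in it. The number n^2 - n counts the entries outside the last row, which bounds the dimension
  from below, and also the entries off the diagonal, which bounds it from above. In both counts z is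
  one more coordinate of the affine cone, and passing to projective space takes it away again.
  Dimension is measured by sets of variables that are algebraically independent modulo a prime:
  strict inclusion of primes costs at least one variable. Characteristic 0 supplies the n distinct
  interpolation nodes 0, ..., n - 1.\<close>

definition monomial_value :: "('v::finite \<Rightarrow> 'k::comm_ring_1) \<Rightarrow> ('v \<Rightarrow>\<^sub>0 nat) \<Rightarrow> 'k" where
  "monomial_value a m = (\<Prod>v\<in>UNIV. a v ^ Poly_Mapping.lookup m v)"

definition meval :: "('v::finite \<Rightarrow> 'k::comm_ring_1) \<Rightarrow> ('v, 'k) mpoly \<Rightarrow> 'k" where
  "meval a f = (\<Sum>m\<in>Poly_Mapping.keys f. Poly_Mapping.lookup f m * monomial_value a m)"

lemma monomial_value_add: "monomial_value a (m + n) = monomial_value a m * monomial_value a n"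
  by (simp add: monomial_value_def lookup_add power_add prod.distrib)

lemma monomial_value_zero [simp]: "monomial_value a 0 = 1"
  by (simp add: monomial_value_def)

lemma monomial_value_single: "monomial_value a (Poly_Mapping.single v k) = a v ^ k"
proof -
  have "monomial_value a (Poly_Mapping.single v k) = (\<Prod>w\<in>{v}. a w ^ Poly_Mapping.lookup (Poly_Mapping.single v k) w)"
    unfolding monomial_value_def
    by (rule prod.mono_neutral_right) (auto simp: lookup_single when_def)
  then show ?thesis by (simp add: lookup_single)
qed

lemma meval_superset:
  assumes "finite S" "Poly_Mapping.keys f \<subseteq> S"
  shows "meval a f = (\<Sum>m\<in>S. Poly_Mapping.lookup f m * monomial_value a m)"
  unfolding meval_def using assms
  by (intro sum.mono_neutral_left) (auto simp: in_keys_iff)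

lemma meval_add: "meval a (f + g) = meval a f + meval a g"
proof -
  have "meval a (f + g) = (\<Sum>m\<in>Poly_Mapping.keys f \<union> Poly_Mapping.keys g. Poly_Mapping.lookup (f + g) m * monomial_value a m)"
    by (rule meval_superset) (auto simp: Poly_Mapping.keys_add)
  also have "\<dots> = (\<Sum>m\<in>Poly_Mapping.keys f \<union> Poly_Mapping.keys g. Poly_Mapping.lookup f m * monomial_value a m)
     + (\<Sum>m\<in>Poly_Mapping.keys f \<union> Poly_Mapping.keys g. Poly_Mapping.lookup g m * monomial_value a m)"
    by (simp add: lookup_add distrib_right sum.distrib)
  also have "\<dots> = meval a f + meval a g"
    by (simp add: meval_superset[symmetric])
  finally show ?thesis .
qed

lemma meval_zero [simp]: "meval a 0 = 0"
  by (simp add: meval_def)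

lemma meval_sum: "meval a (sum f I) = (\<Sum>i\<in>I. meval a (f i))"
  by (induction I rule: infinite_finite_induct) (auto simp: meval_add)

lemma meval_single: "meval a (Poly_Mapping.single m c) = c * monomial_value a m"
  by (cases "c = 0") (auto simp: meval_def lookup_single)

lemma mpoly_as_sum:
  "f = (\<Sum>m\<in>Poly_Mapping.keys f. Poly_Mapping.single m (Poly_Mapping.lookup f m))"
proof (rule poly_mapping_eqI)
  fix k
  have "Poly_Mapping.lookup (\<Sum>m\<in>Poly_Mapping.keys f. Poly_Mapping.single m (Poly_Mapping.lookup f m)) k
      = (\<Sum>m\<in>Poly_Mapping.keys f. if m = k then Poly_Mapping.lookup f m else 0)"
    by (simp add: lookup_sum lookup_single when_def)
  also have "\<dots> = Poly_Mapping.lookup f k"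
    by (auto simp: in_keys_iff)
  finally show "Poly_Mapping.lookup f k = Poly_Mapping.lookup (\<Sum>m\<in>Poly_Mapping.keys f. Poly_Mapping.single m (Poly_Mapping.lookup f m)) k" ..
qed

lemma meval_mult: "meval a (f * g) = meval a f * meval a g"
proof -
  have "f * g = (\<Sum>m\<in>Poly_Mapping.keys f. \<Sum>n\<in>Poly_Mapping.keys g.
      Poly_Mapping.single (m + n) (Poly_Mapping.lookup f m * Poly_Mapping.lookup g n))"
    by (subst mpoly_as_sum[of f], subst mpoly_as_sum[of g])
      (simp add: sum_product mult_single)
  then have "meval a (f * g) = (\<Sum>m\<in>Poly_Mapping.keys f. \<Sum>n\<in>Poly_Mapping.keys g.
      (Poly_Mapping.lookup f m * monomial_value a m) * (Poly_Mapping.lookup g n * monomial_value a n))"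
    by (simp add: meval_sum meval_single monomial_value_add mult_ac)
  then show ?thesis
    by (simp add: meval_def sum_product)
qed

lemma meval_Const [simp]: "meval a (Const c) = c"
  by (simp add: Const_def meval_single)

lemma meval_Var [simp]: "meval a (Var v) = a v"
  by (simp add: Var_def meval_single monomial_value_single)

lemma Const_one: "Const 1 = 1"
  by (simp add: Const_def)

lemma Const_zero [simp]: "Const 0 = 0"
  by (simp add: Const_def)

lemma Const_add: "Const (a + b) = Const a + Const b"
  by (simp add: Const_def single_add)

lemma Const_mult: "Const (a * b) = Const a * Const b"
  by (simp add: Const_def mult_single)

lemma meval_one [simp]: "meval a 1 = 1"
  using meval_Const[of a 1] by (simp add: Const_one)

lemma meval_uminus: "meval a (- f) = - meval a f"
  by (metis add.right_inverse add_eq_0_iff meval_add meval_zero)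

lemma meval_diff: "meval a (f - g) = meval a f - meval a g"
  using meval_add[of a f "- g"] by (simp add: meval_uminus)

lemma meval_prod: "meval a (prod f I) = (\<Prod>i\<in>I. meval a (f i))"
  by (induction I rule: infinite_finite_induct) (auto simp: meval_mult)

lemma meval_power: "meval a (f ^ k) = meval a f ^ k"
  by (induction k) (auto simp: meval_mult)


lemmas meval_simps = meval_add meval_mult meval_sum meval_prod meval_power meval_diff meval_uminus

lemma Var_power: "Var v ^ k = (Poly_Mapping.single (Poly_Mapping.single v k) 1 :: ('v, 'k::comm_ring_1) mpoly)"
proof (induction k)
  case (Suc k)
  have "Var v ^ Suc k = (Poly_Mapping.single (Poly_Mapping.single v 1 + Poly_Mapping.single v k) 1 :: ('v, 'k) mpoly)"
    by (simp add: Suc) (simp add: Var_def mult_single)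
  then show ?case by (simp add: single_add[symmetric])
qed simp

lemma single_eq_monomial:
  fixes m :: "'v::finite \<Rightarrow>\<^sub>0 nat"
  shows "(Poly_Mapping.single m c :: ('v, 'k::comm_ring_1) mpoly) = Const c * (\<Prod>v\<in>UNIV. Var v ^ Poly_Mapping.lookup m v)"
proof -
  have *: "(\<Prod>v\<in>S. Var v ^ Poly_Mapping.lookup m v)
      = (Poly_Mapping.single (\<Sum>v\<in>S. Poly_Mapping.single v (Poly_Mapping.lookup m v)) 1 :: ('v, 'k) mpoly)"
    if "finite S" for S
    using that by induction (auto simp: Var_power mult_single)
  have "(\<Sum>v\<in>UNIV. Poly_Mapping.single v (Poly_Mapping.lookup m v)) = m"
    by (rule poly_mapping_eqI) (simp add: lookup_sum lookup_single when_def)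
  then show ?thesis by (simp add: * Const_def mult_single)
qed

lemma mpoly_induct [case_names const var plus]:
  fixes f :: "('v::finite, 'k::comm_ring_1) mpoly"
  assumes c: "\<And>c. Q (Const c)"
    and m: "\<And>v f. Q f \<Longrightarrow> Q (Var v * f)"
    and a: "\<And>f g. Q f \<Longrightarrow> Q g \<Longrightarrow> Q (f + g)"
  shows "Q f"
proof -
  have pow: "Q (Var v ^ k * f)" if "Q f" for v k f
    using that by (induction k) (auto intro: m simp: mult.assoc)
  have pr: "Q ((\<Prod>v\<in>S. Var v ^ h v) * f)" if "finite S" "Q f" for S f and h :: "'v \<Rightarrow> nat"
    using that by induction (auto intro: pow simp: mult.assoc)
  have s: "Q (Poly_Mapping.single m c)" for m c
    using pr[OF finite c] by (simp add: single_eq_monomial mult.commute)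
  have "Q (\<Sum>m\<in>S. Poly_Mapping.single m (Poly_Mapping.lookup f m))" if "finite S" for S
    using that by induction (use c[of 0] in \<open>auto intro: a s\<close>)
  from this[of "Poly_Mapping.keys f"] show ?thesis
    by (simp add: mpoly_as_sum[symmetric])
qed

section \<open>Subrings generated by some of the variables\<close>

text \<open>A subset of the full ring and not a ring of its own, so that membership in an ideal of
  the full ring can be asked directly.\<close>

definition polys_in :: "'v set \<Rightarrow> ('v, 'k::comm_ring_1) mpoly set" where
  "polys_in T = {f. \<forall>m\<in>Poly_Mapping.keys f. Poly_Mapping.keys m \<subseteq> T}"

lemma polys_in_zero [simp]: "0 \<in> polys_in T"
  by (simp add: polys_in_def)

lemma polys_in_Const [simp]: "Const c \<in> polys_in T"
  by (cases "c = 0") (simp_all add: polys_in_def Const_def)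

lemma polys_in_one [simp]: "1 \<in> polys_in T"
  using polys_in_Const[of 1 T] by (simp add: Const_one)

lemma polys_in_Var: "v \<in> T \<Longrightarrow> Var v \<in> polys_in T"
  by (simp add: polys_in_def Var_def)

lemma polys_in_add: "f \<in> polys_in T \<Longrightarrow> g \<in> polys_in T \<Longrightarrow> f + g \<in> polys_in T"
  using Poly_Mapping.keys_add[of f g] unfolding polys_in_def by blast

lemma keys_add_nat: "Poly_Mapping.keys (m + n :: 'v \<Rightarrow>\<^sub>0 nat) = Poly_Mapping.keys m \<union> Poly_Mapping.keys n"
  by (auto simp: in_keys_iff lookup_add)

lemma polys_in_mult: "f \<in> polys_in T \<Longrightarrow> g \<in> polys_in T \<Longrightarrow> f * g \<in> polys_in T"
  using Poly_Mapping.keys_mult[of f g] unfolding polys_in_def by (fastforce simp: keys_add_nat)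

lemma polys_in_uminus: "f \<in> polys_in T \<Longrightarrow> - f \<in> polys_in T"
  by (simp add: polys_in_def in_keys_iff)

lemma polys_in_diff: "f \<in> polys_in T \<Longrightarrow> g \<in> polys_in T \<Longrightarrow> f - g \<in> polys_in T"
  using polys_in_add[of f T "- g"] by (simp add: polys_in_uminus)

lemma polys_in_sum: "(\<And>i. i \<in> I \<Longrightarrow> f i \<in> polys_in T) \<Longrightarrow> sum f I \<in> polys_in T"
  by (induction I rule: infinite_finite_induct) (auto intro: polys_in_add)

lemma polys_in_prod: "(\<And>i. i \<in> I \<Longrightarrow> f i \<in> polys_in T) \<Longrightarrow> prod f I \<in> polys_in T"
  by (induction I rule: infinite_finite_induct) (auto intro: polys_in_mult)

lemma polys_in_power: "f \<in> polys_in T \<Longrightarrow> f ^ k \<in> polys_in T"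
  by (induction k) (auto intro: polys_in_mult)

lemma polys_in_insert_expand:
  fixes f :: "('v::finite, 'k::comm_ring_1) mpoly"
  assumes "f \<in> polys_in (insert v T)"
  obtains g d where "\<And>i. g i \<in> polys_in T" "f = (\<Sum>i\<le>(d::nat). g i * Var v ^ i)"
proof -
  let ?K = "Poly_Mapping.keys f"
  let ?e = "\<lambda>m. Poly_Mapping.lookup m v"
  define r where "r m = m - Poly_Mapping.single v (?e m)" for m :: "'v \<Rightarrow>\<^sub>0 nat"
  define g where "g i = (\<Sum>m\<in>{m\<in>?K. ?e m = i}. Poly_Mapping.single (r m) (Poly_Mapping.lookup f m))" for i
  define d where "d = Max (insert 0 (?e ` ?K))"
  have r: "r m + Poly_Mapping.single v (?e m) = m" for m
    by (rule poly_mapping_eqI) (auto simp: r_def lookup_add lookup_minus lookup_single when_def)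
  have "f = (\<Sum>m\<in>?K. Poly_Mapping.single (r m) (Poly_Mapping.lookup f m) * Var v ^ ?e m)"
    by (subst mpoly_as_sum) (simp add: Var_power mult_single r)
  also have "\<dots> = (\<Sum>i\<in>{..d}. \<Sum>m\<in>{m\<in>?K. ?e m = i}. Poly_Mapping.single (r m) (Poly_Mapping.lookup f m) * Var v ^ ?e m)"
    by (rule sum.group[symmetric]) (auto simp: d_def)
  also have "\<dots> = (\<Sum>i\<le>d. g i * Var v ^ i)"
    unfolding g_def by (intro sum.cong refl) (simp add: sum_distrib_right)
  finally have 1: "f = (\<Sum>i\<le>d. g i * Var v ^ i)" .
  have "g i \<in> polys_in T" for i
    unfolding g_def
  proof (rule polys_in_sum)
    fix m assume m: "m \<in> {m\<in>?K. ?e m = i}"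
    have "Poly_Mapping.keys (r m) \<subseteq> T"
    proof
      fix w assume "w \<in> Poly_Mapping.keys (r m)"
      then have "w \<noteq> v" "w \<in> Poly_Mapping.keys m"
        by (auto simp: r_def in_keys_iff lookup_minus lookup_single when_def split: if_splits)
      with m assms show "w \<in> T" by (auto simp: polys_in_def)
    qed
    then show "Poly_Mapping.single (r m) (Poly_Mapping.lookup f m) \<in> polys_in T"
      by (auto simp: polys_in_def)
  qed
  with 1 that show ?thesis by blast
qed

lemma polys_in_empty: "f \<in> polys_in {} \<Longrightarrow> \<exists>c. f = Const c"
proof -
  assume "f \<in> polys_in {}"
  then have "Poly_Mapping.keys f \<subseteq> {0}" by (auto simp: polys_in_def)
  then have "f = Const (Poly_Mapping.lookup f 0)"
    by (intro poly_mapping_eqI) (auto simp: Const_def lookup_single when_def in_keys_iff)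
  then show ?thesis by blast
qed

section \<open>Kronecker substitution\<close>

lemma digits_unique:
  fixes d e :: "nat \<Rightarrow> nat"
  assumes "\<And>i. i < n \<Longrightarrow> d i < B" "\<And>i. i < n \<Longrightarrow> e i < B"
    and "(\<Sum>i<n. d i * B ^ i) = (\<Sum>i<n. e i * B ^ i)" "i < n"
  shows "d i = e i"
  using assms
proof (induction n arbitrary: d e i)
  case (Suc n)
  have s: "(\<Sum>i<Suc n. d i * B ^ i) = d 0 + B * (\<Sum>i<n. d (Suc i) * B ^ i)" for d :: "nat \<Rightarrow> nat"
    by (simp only: sum.lessThan_Suc_shift) (simp add: sum_distrib_left mult_ac)
  have B: "d 0 < B" "e 0 < B" using Suc.prems by auto
  have eq: "d 0 + B * (\<Sum>i<n. d (Suc i) * B ^ i) = e 0 + B * (\<Sum>i<n. e (Suc i) * B ^ i)"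
    using Suc.prems(3) unfolding s .
  then have "(d 0 + B * (\<Sum>i<n. d (Suc i) * B ^ i)) mod B = (e 0 + B * (\<Sum>i<n. e (Suc i) * B ^ i)) mod B"
    by simp
  with B have 0: "d 0 = e 0" by simp
  with eq B have "(\<Sum>i<n. d (Suc i) * B ^ i) = (\<Sum>i<n. e (Suc i) * B ^ i)" by simp
  then have "d (Suc j) = e (Suc j)" if "j < n" for j
    using Suc.IH[of "\<lambda>i. d (Suc i)" "\<lambda>i. e (Suc i)" j] Suc.prems(1,2) that by auto
  with 0 Suc.prems(4) show ?case by (cases i) auto
qed simp

text \<open>Replacing the variable \<open>v\<close> by \<open>s ^ (B ^ h v)\<close>, with
  \<open>B\<close> larger than every exponent, sends distinct monomials to distinct powers of
  \<open>s\<close>: the exponents of a monomial are the base \<open>B\<close> digits of the new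
  exponent. The coefficients survive unchanged, and with them being nonzero or nonconstant.\<close>

lemma Kronecker_substitution:
  fixes f :: "('v::finite, 'k::field) mpoly"
  obtains a p where "\<And>s. poly p s = meval (a s) f" "f \<noteq> 0 \<Longrightarrow> p \<noteq> 0"
    "(\<And>c. f \<noteq> Const c) \<Longrightarrow> Polynomial.degree p > 0"
proof -
  let ?K = "Poly_Mapping.keys f"
  obtain h :: "'v \<Rightarrow> nat" where h: "bij_betw h UNIV {0..<CARD('v)}"
    using ex_bij_betw_finite_nat[OF finite] by blast
  \<comment> \<open>\<open>insert 0\<close> covers \<open>f = 0\<close>, where there are no
    exponents; \<open>Suc\<close> puts \<open>B\<close> above all exponents and keeps it
    positive.\<close>
  define B where "B = Suc (Max (insert 0 ((\<lambda>(m, v). Poly_Mapping.lookup m v) ` (?K \<times> UNIV))))"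
  have B: "Poly_Mapping.lookup m v < B" if "m \<in> ?K" for m v
  proof -
    have "Poly_Mapping.lookup m v \<le> Max (insert 0 ((\<lambda>(m, v). Poly_Mapping.lookup m v) ` (?K \<times> UNIV)))"
      using that by (intro Max_ge) auto
    then show ?thesis by (simp add: B_def)
  qed
  define enc where "enc m = (\<Sum>v\<in>UNIV. Poly_Mapping.lookup m v * B ^ h v)" for m :: "'v \<Rightarrow>\<^sub>0 nat"
  define g where "g = inv_into UNIV h"
  have gh: "g (h v) = v" for v unfolding g_def using h by (simp add: bij_betw_def)
  have enc': "enc m = (\<Sum>i<CARD('v). Poly_Mapping.lookup m (g i) * B ^ i)" for m
    unfolding enc_def using h
    by (intro sum.reindex_bij_betw[OF h, where g="\<lambda>i. Poly_Mapping.lookup m (g i) * B ^ i", simplified gh lessThan_atLeast0[symmetric]])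
  have inj: "m = m'" if "m \<in> ?K" "m' \<in> ?K" "enc m = enc m'" for m m'
  proof (rule poly_mapping_eqI)
    fix v
    have "Poly_Mapping.lookup m (g (h v)) = Poly_Mapping.lookup m' (g (h v))"
      by (rule digits_unique[of "CARD('v)" "\<lambda>i. Poly_Mapping.lookup m (g i)" B "\<lambda>i. Poly_Mapping.lookup m' (g i)"])
        (use B that h enc' in \<open>auto simp: bij_betw_def\<close>)
    then show "Poly_Mapping.lookup m v = Poly_Mapping.lookup m' v" by (simp add: gh)
  qed
  define p where "p = (\<Sum>m\<in>?K. Polynomial.monom (Poly_Mapping.lookup f m) (enc m))"
  have co: "poly.coeff p (enc m) = Poly_Mapping.lookup f m" if "m \<in> ?K" for m
  proof -
    have "poly.coeff p (enc m) = (\<Sum>m'\<in>?K. if m' = m then Poly_Mapping.lookup f m' else 0)"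
      unfolding p_def coeff_sum by (intro sum.cong) (use inj that in auto)
    with that show ?thesis by simp
  qed
  show thesis
  proof (rule that[of p "\<lambda>s v. s ^ (B ^ h v)"])
    show "poly p s = meval (\<lambda>v. s ^ (B ^ h v)) f" for s
      by (simp add: p_def poly_sum poly_monom meval_def monomial_value_def enc_def power_sum
          power_mult[symmetric] mult.commute)
    show "p \<noteq> 0" if f: "f \<noteq> 0"
    proof -
      obtain m where "m \<in> ?K" using f by (metis ex_in_conv keys_eq_empty)
      with co[of m] show ?thesis by (auto simp: in_keys_iff)
    qed
    show "Polynomial.degree p > 0" if "\<And>c. f \<noteq> Const c"
    proof -
      have "f \<notin> polys_in {}" using that polys_in_empty by blast
      then obtain m v where m: "m \<in> ?K" "v \<in> Poly_Mapping.keys m" unfolding polys_in_def by blast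
      have "0 < Poly_Mapping.lookup m v * B ^ h v" using m by (simp add: in_keys_iff B_def)
      also have "\<dots> \<le> enc m" unfolding enc_def by (rule member_le_sum) auto
      finally have "0 < enc m" .
      moreover have "enc m \<le> Polynomial.degree p" using co[OF m(1)] m(1) by (intro le_degree) (auto simp: in_keys_iff)
      ultimately show ?thesis by simp
    qed
  qed
qed

lemma exists_nonroot:
  fixes p :: "'k::{idom, ring_char_0} poly"
  assumes "p \<noteq> 0"
  obtains s where "poly p s \<noteq> 0"
  using assms poly_all_0_iff_0 by blast

lemma mpoly_nonzero_value:
  fixes f :: "('v::finite, 'k::field_char_0) mpoly"
  assumes "f \<noteq> 0"
  obtains a where "meval a f \<noteq> 0"
proof -
  obtain a p where p: "\<And>s. poly p s = meval (a s) f" "p \<noteq> 0"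
    by (rule Kronecker_substitution[of f]) (use assms in blast)
  then obtain s where "poly p s \<noteq> 0" using exists_nonroot by blast
  with p(1)[of s] that show ?thesis by simp
qed

lemma mpoly_attains_value:
  fixes f :: "('v::finite, 'k::alg_closed_field) mpoly"
  assumes "\<And>c. f \<noteq> Const c"
  obtains a where "meval a f = y"
proof -
  obtain a p where p: "\<And>s. poly p s = meval (a s) f" "Polynomial.degree p > 0"
    by (rule Kronecker_substitution[of f]) (use assms in blast)
  have "Polynomial.degree (p - [:y:]) > 0"
    using p(2) degree_add_eq_left[of "- [:y:]" p] unfolding diff_conv_add_uminus by simp
  then obtain s where "poly (p - [:y:]) s = 0" using alg_closed_imp_poly_has_root by blast
  with p(1)[of s] that show ?thesis by simp
qed

section \<open>Prime ideals and linear dependence\<close>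

text \<open>Prime ideals in terms of the operations of the type class, so that ordinary ring
  arithmetic applies. The translation from and to \<open>primeideal\<close> is
  \<open>primeideal_imp_prime_set\<close> and \<open>prime_set_imp_primeideal\<close>.\<close>

locale prime_set =
  fixes P :: "'a::comm_ring_1 set"
  assumes zero: "0 \<in> P"
    and add: "a \<in> P \<Longrightarrow> b \<in> P \<Longrightarrow> a + b \<in> P"
    and mult: "a \<in> P \<Longrightarrow> x * a \<in> P"
    and one: "1 \<notin> P"
    and prime: "a * b \<in> P \<Longrightarrow> a \<in> P \<or> b \<in> P"
begin

lemma mult_right: "a \<in> P \<Longrightarrow> a * x \<in> P"
  using mult by (simp add: mult.commute)

lemma uminus: "a \<in> P \<Longrightarrow> - a \<in> P"
  using mult[of a "-1"] by simp

lemma diff: "a \<in> P \<Longrightarrow> b \<in> P \<Longrightarrow> a - b \<in> P"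
  using add[of a "-b"] uminus by simp

lemma sum: "(\<And>i. i \<in> I \<Longrightarrow> f i \<in> P) \<Longrightarrow> sum f I \<in> P"
  by (induction I rule: infinite_finite_induct) (auto intro: zero add)

lemma diff_cong: "a - b \<in> P \<Longrightarrow> a \<in> P \<longleftrightarrow> b \<in> P"
  using add[of "a - b" b] diff[of a "a - b"] by auto

lemma diff_trans: "a - b \<in> P \<Longrightarrow> b - c \<in> P \<Longrightarrow> a - c \<in> P"
  using add[of "a - b" "b - c"] by simp

lemma diff_power: "a - b \<in> P \<Longrightarrow> a ^ k - b ^ k \<in> P"
proof (induction k)
  case (Suc k)
  have "a ^ Suc k - b ^ Suc k = a * (a ^ k - b ^ k) + b ^ k * (a - b)" by (simp add: algebra_simps)
  with Suc show ?case by (simp add: add mult)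
qed (simp add: zero)

lemma power_notin: "a \<notin> P \<Longrightarrow> a ^ k \<notin> P"
  by (induction k) (use one prime in auto)

lemma prod_notin: "(\<And>i. i \<in> I \<Longrightarrow> f i \<notin> P) \<Longrightarrow> prod f I \<notin> P"
  by (induction I rule: infinite_finite_induct) (use one prime in auto)

text \<open>Gaussian elimination without division.\<close>

lemma linear_dependence:
  fixes a :: "'i \<Rightarrow> 'j \<Rightarrow> 'a"
  assumes A: "1 \<in> A" "0 \<in> A" "\<And>x y. x \<in> A \<Longrightarrow> y \<in> A \<Longrightarrow> x * y \<in> A" "\<And>x y. x \<in> A \<Longrightarrow> y \<in> A \<Longrightarrow> x - y \<in> A"
    and "finite J" "finite I" "card J < card I" "\<And>i j. i \<in> I \<Longrightarrow> j \<in> J \<Longrightarrow> a i j \<in> A"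
  shows "\<exists>c. (\<forall>i\<in>I. c i \<in> A) \<and> (\<exists>i\<in>I. c i \<notin> P) \<and> (\<forall>j\<in>J. (\<Sum>i\<in>I. c i * a i j) \<in> P)"
  using assms(5-)
proof (induction J arbitrary: I a rule: finite_induct)
  case empty
  then obtain i where "i \<in> I" by fastforce
  then show ?case using A one by (intro exI[of _ "\<lambda>_. 1"]) auto
next
  case (insert j J)
  show ?case
  proof (cases "\<forall>i\<in>I. a i j \<in> P")
    case True
    obtain c where c: "\<forall>i\<in>I. c i \<in> A" "\<exists>i\<in>I. c i \<notin> P" "\<forall>j\<in>J. (\<Sum>i\<in>I. c i * a i j) \<in> P"
      using insert.IH[of I a] insert.prems insert.hyps by auto
    moreover have "(\<Sum>i\<in>I. c i * a i j) \<in> P" using True by (intro sum mult) auto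
    ultimately show ?thesis by (intro exI[of _ c]) auto
  next
    case False
    then obtain k where k: "k \<in> I" "a k j \<notin> P" by blast
    \<comment> \<open>With the pivot \<open>a k j\<close>, the combinations \<open>a k j\<close>
      times row \<open>i\<close> minus \<open>a i j\<close> times row \<open>k\<close> vanish in
      column \<open>j\<close>. The induction hypothesis is applied to them for
      \<open>i \<noteq> k\<close>.\<close>
    have cI: "card J < card (I - {k})" using insert.prems insert.hyps k by (simp add: card_Diff_singleton)
    obtain c where c: "\<forall>i\<in>I-{k}. c i \<in> A" "\<exists>i\<in>I-{k}. c i \<notin> P"
      "\<forall>j'\<in>J. (\<Sum>i\<in>I-{k}. c i * (a k j * a i j' - a i j * a k j')) \<in> P"
    proof -
      have "\<exists>c. (\<forall>i\<in>I-{k}. c i \<in> A) \<and> (\<exists>i\<in>I-{k}. c i \<notin> P) \<and>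
        (\<forall>j'\<in>J. (\<Sum>i\<in>I-{k}. c i * (a k j * a i j' - a i j * a k j')) \<in> P)"
      proof (rule insert.IH)
        show "a k j * a i j' - a i j * a k j' \<in> A" if "i \<in> I - {k}" "j' \<in> J" for i j'
          using that k insert.prems(3) by (intro A(3,4)) auto
      qed (use cI insert.prems in auto)
      with that show thesis by blast
    qed
    \<comment> \<open>Undoes the elimination: this combination of the original rows equals the given
      combination of the eliminated rows.\<close>
    define c' where "c' i = (if i = k then - (\<Sum>i\<in>I-{k}. c i * a i j) else c i * a k j)" for i
    have sA: "(\<Sum>i\<in>I'. c i * a i j) \<in> A" if "I' \<subseteq> I - {k}" "finite I'" for I'
      using that(2,1)
    proof induction
      case (insert x F)
      have "0 - (\<Sum>i\<in>F. c i * a i j) \<in> A" using insert by (intro A(2,4)) auto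
      then have "c x * a x j - (0 - (\<Sum>i\<in>F. c i * a i j)) \<in> A"
        by (intro A(4)[OF A(3)]) (use insert.prems c(1) \<open>\<And>i j'. i \<in> I \<Longrightarrow> j' \<in> insert j J \<Longrightarrow> a i j' \<in> A\<close> in auto)
      then show ?case using insert by simp
    qed (use A in simp)
    have "c' i \<in> A" if "i \<in> I" for i
    proof (cases "i = k")
      case True
      have "0 - (\<Sum>i\<in>I-{k}. c i * a i j) \<in> A" using sA[of "I - {k}"] insert.prems(1) by (intro A(2,4)) auto
      with True show ?thesis by (simp add: c'_def)
    next
      case False
      with that c(1) k insert.prems(3) A(3) show ?thesis by (simp add: c'_def)
    qed
    moreover have "\<exists>i\<in>I. c' i \<notin> P"
      using c(2) k(2) prime by (auto simp: c'_def)
    moreover have "(\<Sum>i\<in>I. c' i * a i j') \<in> P" if "j' \<in> insert j J" for j'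
    proof -
      have "(\<Sum>i\<in>I. c' i * a i j') = c' k * a k j' + (\<Sum>i\<in>I-{k}. c' i * a i j')"
        using insert.prems(1) k(1) by (simp add: sum.remove)
      also have "(\<Sum>i\<in>I-{k}. c' i * a i j') = (\<Sum>i\<in>I-{k}. c i * a k j * a i j')"
        by (intro sum.cong) (auto simp: c'_def)
      also have "c' k * a k j' + \<dots> = (\<Sum>i\<in>I-{k}. c i * (a k j * a i j' - a i j * a k j'))"
        by (simp add: c'_def sum_distrib_right sum_distrib_left right_diff_distrib sum_subtractf algebra_simps)
      finally have *: "(\<Sum>i\<in>I. c' i * a i j') = (\<Sum>i\<in>I-{k}. c i * (a k j * a i j' - a i j * a k j'))" .
      show ?thesis
      proof (cases "j' = j")
        case True
        then show ?thesis unfolding * by (simp add: zero mult.commute)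
      next
        case False
        with that c(3) show ?thesis unfolding * by auto
      qed
    qed
    ultimately show ?thesis by (intro exI[of _ c']) auto
  qed
qed

end

lemma exists_max_card_subset:
  assumes "finite U" "S0 \<subseteq> U" "Q S0"
  obtains S where "S \<subseteq> U" "Q S" "\<And>S'. S' \<subseteq> U \<Longrightarrow> Q S' \<Longrightarrow> card S' \<le> card S"
proof -
  let ?C = "card ` {S. S \<subseteq> U \<and> Q S}"
  have fin: "finite ?C" using assms(1) by simp
  have "?C \<noteq> {}" using assms by auto
  then obtain S where S: "S \<subseteq> U" "Q S" "card S = Max ?C" using Max_in[OF fin] by auto
  show thesis
  proof (rule that[OF S(1,2)])
    fix S' assume "S' \<subseteq> U" "Q S'"
    then have "card S' \<in> ?C" by blast
    then show "card S' \<le> card S" unfolding S(3) by (rule Max_ge[OF fin])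
  qed
qed

section \<open>Algebraic independence modulo a prime ideal\<close>

text \<open>Only sets of variables are considered. Over a field and for prime \<open>P\<close> they
  suffice to reach the transcendence degree of the residue ring, because the variables generate
  it.\<close>

definition independent_mod :: "('v, 'k::comm_ring_1) mpoly set \<Rightarrow> 'v set \<Rightarrow> bool" where
  "independent_mod P T \<longleftrightarrow> (\<forall>f\<in>polys_in T. f \<in> P \<longrightarrow> f = 0)"

definition power_product :: "('v::finite \<Rightarrow> nat) \<Rightarrow> ('v, 'k::comm_ring_1) mpoly" where
  "power_product e = (\<Prod>v\<in>UNIV. Var v ^ e v)"

lemma power_product_zero [simp]: "power_product (\<lambda>_. 0) = 1"
  by (simp add: power_product_def)

lemma power_product_upd: "power_product (e(v := i)) = Var v ^ i * power_product (e(v := 0))"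
proof -
  have "(\<Prod>w\<in>UNIV - {v}. Var w ^ (e(v := i)) w) = (\<Prod>w\<in>UNIV - {v}. Var w ^ (e(v := 0)) w)"
    by (intro prod.cong) auto
  then show ?thesis
    by (simp add: power_product_def prod.remove[of UNIV v])
qed

lemma Var_mult_power_product: "Var v * power_product e = power_product (e(v := Suc (e v)))"
proof -
  have 1: "power_product e = Var v ^ e v * power_product (e(v := 0))"
    using power_product_upd[of e v "e v"] by simp
  show ?thesis unfolding power_product_upd[of e v "Suc (e v)"]
    by (subst 1) (simp add: mult.assoc)
qed

locale maximal_independent = prime_set P for P :: "('v::finite, 'k::comm_ring_1) mpoly set" +
  fixes T :: "'v set"
  assumes indep: "independent_mod P T"
    and maximal: "v \<notin> T \<Longrightarrow> \<not> independent_mod P (insert v T)"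
begin

lemma zero_if_in: "f \<in> polys_in T \<Longrightarrow> f \<in> P \<Longrightarrow> f = 0"
  using indep by (simp add: independent_mod_def)

lemma notin: "f \<in> polys_in T \<Longrightarrow> f \<noteq> 0 \<Longrightarrow> f \<notin> P"
  using zero_if_in by blast

text \<open>Maximality gives a nonzero element of \<open>P\<close> in the variables \<open>T\<close>
  and \<open>v\<close>. Its leading coefficient in \<open>v\<close> is a nonzero polynomial in
  \<open>T\<close>, hence outside \<open>P\<close>; degree 0 in \<open>v\<close> would put that
  coefficient into \<open>P\<close>.\<close>

lemma algebraic_relation:
  assumes "v \<notin> T"
  shows "\<exists>d g c. d > 0 \<and> (\<forall>i. g i \<in> polys_in T) \<and> c \<in> polys_in T \<and> c \<notin> P \<and>
     c * Var v ^ d - (\<Sum>i<d. g i * Var v ^ i) \<in> P"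
proof -
  obtain f where f: "f \<in> polys_in (insert v T)" "f \<in> P" "f \<noteq> 0"
    using maximal[OF assms] by (auto simp: independent_mod_def)
  obtain g D where g: "\<And>i. g i \<in> polys_in T" "f = (\<Sum>i\<le>(D::nat). g i * Var v ^ i)"
    using polys_in_insert_expand[OF f(1)] by blast
  have "\<exists>i\<le>D. g i \<noteq> 0"
  proof (rule ccontr)
    assume "\<not> ?thesis"
    then have "f = 0" unfolding g(2) by (intro sum.neutral) auto
    with f show False by simp
  qed
  then obtain d where d: "d \<le> D" "g d \<noteq> 0" "\<And>i. i \<le> D \<Longrightarrow> g i \<noteq> 0 \<Longrightarrow> i \<le> d"
  proof -
    let ?S = "{i. i \<le> D \<and> g i \<noteq> 0}"
    assume *: "\<And>d. d \<le> D \<Longrightarrow> g d \<noteq> 0 \<Longrightarrow> (\<And>i. i \<le> D \<Longrightarrow> g i \<noteq> 0 \<Longrightarrow> i \<le> d) \<Longrightarrow> thesis"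
    have "?S \<noteq> {}" "finite ?S" using \<open>\<exists>i\<le>D. g i \<noteq> 0\<close> by auto
    with Max_in[of ?S] Max_ge[of ?S] show thesis by (intro *[of "Max ?S"]) auto
  qed
  have "f = (\<Sum>i\<le>d. g i * Var v ^ i)"
    unfolding g(2)
  proof (rule sum.mono_neutral_right)
    show "\<forall>i\<in>{..D} - {..d}. g i * Var v ^ i = 0" using d(3) by force
  qed (use d(1) in auto)
  also have "\<dots> = g d * Var v ^ d + (\<Sum>i<d. g i * Var v ^ i)"
    by (simp add: lessThan_Suc_atMost[symmetric])
  finally have 1: "g d * Var v ^ d - (\<Sum>i<d. - g i * Var v ^ i) \<in> P"
    using f(2) by (simp add: sum_negf)
  have "d > 0"
  proof (rule ccontr)
    assume "\<not> d > 0"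
    with 1 have "g d \<in> P" by simp
    with d(2) g(1) zero_if_in show False by blast
  qed
  then show ?thesis
    using 1 g(1) d(2) notin by (intro exI[of _ d] exI[of _ "\<lambda>i. - g i"] exI[of _ "g d"]) (auto intro: polys_in_uminus)
qed

text \<open>The product \<open>c\<close> of the leading coefficients of the relations for all
  variables outside \<open>T\<close> is a common denominator. Once it is inverted, the residue ring
  is a finite module over \<open>polys_in T\<close>, spanned by the power products with exponents
  below the degrees of the relations. Inverting \<open>c\<close> is expressed by the factor
  \<open>c ^ e\<close>.\<close>

lemma finite_generation:
  obtains c and I :: "('v \<Rightarrow> nat) set" where "c \<in> polys_in T" "c \<notin> P" "finite I" "(\<lambda>_. 0) \<in> I"
    "\<forall>f. \<exists>e p. (\<forall>i. p i \<in> polys_in T) \<and> c ^ e * f - (\<Sum>i\<in>I. p i * power_product i) \<in> P"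
proof -
  have "\<forall>v. \<exists>d g c. v \<notin> T \<longrightarrow> d > 0 \<and> (\<forall>i. g i \<in> polys_in T) \<and> c \<in> polys_in T \<and> c \<notin> P \<and>
     c * Var v ^ d - (\<Sum>i<d. g i * Var v ^ i) \<in> P"
    using algebraic_relation by blast
  then obtain d1 g1 c1 where rel0: "\<forall>v. v \<notin> T \<longrightarrow> d1 v > 0 \<and> (\<forall>i. g1 v i \<in> polys_in T) \<and> c1 v \<in> polys_in T \<and> c1 v \<notin> P \<and>
     c1 v * Var v ^ d1 v - (\<Sum>i<d1 v. g1 v i * Var v ^ i) \<in> P"
    unfolding choice_iff by (elim exE)
  then have rel:
    "\<And>v. v \<notin> T \<Longrightarrow> d1 v > (0::nat)" "\<And>v i. v \<notin> T \<Longrightarrow> g1 v i \<in> polys_in T"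
    "\<And>v. v \<notin> T \<Longrightarrow> c1 v \<in> polys_in T" "\<And>v. v \<notin> T \<Longrightarrow> c1 v \<notin> P"
    "\<And>v. v \<notin> T \<Longrightarrow> c1 v * Var v ^ d1 v - (\<Sum>i<d1 v. g1 v i * Var v ^ i) \<in> P"
    by blast+
  define c where "c = (\<Prod>v\<in>-T. c1 v)"
  \<comment> \<open>The value 1 forces exponent 0 on the variables of \<open>T\<close>, which belong
    to the coefficients.\<close>
  define d where "d v = (if v \<in> T then 1 else d1 v)" for v
  define I where "I = {i. \<forall>v. i v < d v}"
  have c: "c \<in> polys_in T" "c \<notin> P"
    unfolding c_def by (intro polys_in_prod rel(3) prod_notin rel(4); simp)+
  have "I = PiE UNIV (\<lambda>v. {..<d v})" by (auto simp: I_def PiE_def Pi_def)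
  then have finI: "finite I" by (simp add: finite_PiE)
  have dpos: "d v > 0" for v using rel(1) by (simp add: d_def)
  then have zI: "(\<lambda>_. 0) \<in> I" by (simp add: I_def)
  have relc: "\<exists>g. (\<forall>i. g i \<in> polys_in T) \<and> c * Var v ^ d v - (\<Sum>i<d v. g i * Var v ^ i) \<in> P" if "v \<notin> T" for v
  proof -
    define r where "r = (\<Prod>v\<in>-T-{v}. c1 v)"
    have r: "r \<in> polys_in T" unfolding r_def by (intro polys_in_prod rel(3)) auto
    have c_eq: "c = c1 v * r" unfolding c_def r_def using that by (intro prod.remove) auto
    have "r * (c1 v * Var v ^ d1 v - (\<Sum>i<d1 v. g1 v i * Var v ^ i)) \<in> P"
      by (intro mult rel that)
    then have "c * Var v ^ d v - (\<Sum>i<d v. (r * g1 v i) * Var v ^ i) \<in> P"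
      using that by (simp add: c_eq d_def right_diff_distrib sum_distrib_left mult_ac)
    with r rel(2) that show ?thesis by (intro exI[of _ "\<lambda>i. r * g1 v i"]) (auto intro: polys_in_mult)
  qed
  \<comment> \<open>The elements that lie in the module once \<open>c\<close> is inverted.
    \<open>N\<close> contains the constants and is closed under sums and under multiplication by
    each variable, so it is the whole ring.\<close>
  define N where "N = {f. \<exists>e p. (\<forall>i. p i \<in> polys_in T) \<and> c ^ e * f - (\<Sum>i\<in>I. p i * power_product i) \<in> P}"
  have N_add: "f + g \<in> N" if fN: "f \<in> N" and gN: "g \<in> N" for f g
  proof -
    obtain e p where 1: "\<forall>i. p i \<in> polys_in T" "c ^ e * f - (\<Sum>i\<in>I. p i * power_product i) \<in> P"
      using fN unfolding N_def by blast
    obtain e' p' where 2: "\<forall>i. p' i \<in> polys_in T" "c ^ e' * g - (\<Sum>i\<in>I. p' i * power_product i) \<in> P"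
      using gN unfolding N_def by blast
    have "c ^ e' * (c ^ e * f - (\<Sum>i\<in>I. p i * power_product i)) + c ^ e * (c ^ e' * g - (\<Sum>i\<in>I. p' i * power_product i)) \<in> P"
      using 1 2 by (intro add mult)
    also have "c ^ e' * (c ^ e * f - (\<Sum>i\<in>I. p i * power_product i)) + c ^ e * (c ^ e' * g - (\<Sum>i\<in>I. p' i * power_product i))
      = c ^ (e + e') * (f + g) - (\<Sum>i\<in>I. (c ^ e' * p i + c ^ e * p' i) * power_product i)"
      by (simp add: sum_distrib_left right_diff_distrib distrib_left distrib_right power_add sum.distrib mult_ac)
    finally show ?thesis unfolding N_def using 1(1) 2(1) c(1)
      by (intro CollectI exI[of _ "e + e'"] exI[of _ "\<lambda>i. c ^ e' * p i + c ^ e * p' i"])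
        (auto intro: polys_in_add polys_in_mult polys_in_power)
  qed
  have N_scale: "g * f \<in> N" if fN: "f \<in> N" and g: "g \<in> polys_in T" for f g
  proof -
    obtain e p where 1: "\<forall>i. p i \<in> polys_in T" "c ^ e * f - (\<Sum>i\<in>I. p i * power_product i) \<in> P"
      using fN unfolding N_def by blast
    have "g * (c ^ e * f - (\<Sum>i\<in>I. p i * power_product i)) \<in> P" using 1 by (intro mult)
    also have "g * (c ^ e * f - (\<Sum>i\<in>I. p i * power_product i)) = c ^ e * (g * f) - (\<Sum>i\<in>I. (g * p i) * power_product i)"
      by (simp add: right_diff_distrib sum_distrib_left mult_ac)
    finally show ?thesis unfolding N_def using 1(1) g
      by (intro CollectI exI[of _ e] exI[of _ "\<lambda>i. g * p i"]) (auto intro: polys_in_mult)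
  qed
  have N_div: "f \<in> N" if ckf: "c ^ k * f \<in> N" for f k
  proof -
    obtain e p where "\<forall>i. p i \<in> polys_in T" "c ^ e * (c ^ k * f) - (\<Sum>i\<in>I. p i * power_product i) \<in> P"
      using ckf unfolding N_def by blast
    then show ?thesis unfolding N_def
      by (intro CollectI exI[of _ "e + k"] exI[of _ p]) (auto simp: power_add mult.assoc)
  qed
  have N_P: "f \<in> N" if "f \<in> P" for f
    unfolding N_def using that by (intro CollectI exI[of _ 0] exI[of _ "\<lambda>_. 0"]) auto
  have N_sum: "sum f S \<in> N" if "\<And>i. i \<in> S \<Longrightarrow> f i \<in> N" for f :: "'b \<Rightarrow> _" and S
    using that by (induction S rule: infinite_finite_induct) (auto intro: N_add N_P zero)
  have N_cong: "f \<in> N" if "f - g \<in> P" "g \<in> N" for f g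
    using N_add[OF N_P[OF that(1)] that(2)] by simp
  have N_w: "power_product i \<in> N" if "i \<in> I" for i
  proof -
    have "(\<Sum>j\<in>I. (if j = i then 1 else 0) * power_product j) = (power_product i :: ('v,'k) mpoly)"
      using that finI by (subst sum.mono_neutral_right[of I "{i}"]) auto
    then show ?thesis unfolding N_def
      by (intro CollectI exI[of _ 0] exI[of _ "\<lambda>j. if j = i then 1 else 0"]) (auto simp: zero)
  qed
  have N_vw: "Var v * power_product i \<in> N" if i: "i \<in> I" for v i
  proof (cases "Suc (i v) < d v")
    case True
    then have "i(v := Suc (i v)) \<in> I" using i by (auto simp: I_def)
    then show ?thesis unfolding Var_mult_power_product by (rule N_w)
  next
    case False
    show ?thesis
    proof (cases "v \<in> T")
      case True
      then show ?thesis by (intro N_scale N_w i polys_in_Var)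
    next
      \<comment> \<open>Multiplication by \<open>v\<close> produces \<open>Var v ^ d v\<close>,
        which the relation for \<open>v\<close> turns into lower powers at the cost of one factor
        \<open>c\<close>.\<close>
      case vT: False
      have d: "d v = Suc (i v)" using False i by (simp add: I_def Suc_leI le_antisym not_less)
      obtain g where g: "\<And>j. g j \<in> polys_in T" "c * Var v ^ d v - (\<Sum>j<d v. g j * Var v ^ j) \<in> P"
        using relc[OF vT] by blast
      have "power_product (i(v := 0)) * (c * Var v ^ d v - (\<Sum>j<d v. g j * Var v ^ j)) \<in> P"
        by (intro mult g)
      also have "power_product (i(v := 0)) * (c * Var v ^ d v - (\<Sum>j<d v. g j * Var v ^ j))
         = c ^ 1 * (Var v * power_product i) - (\<Sum>j<d v. g j * power_product (i(v := j)))"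
      proof -
        have 1: "Var v * power_product i = Var v ^ d v * (power_product (i(v := 0)) :: ('v, 'k) mpoly)"
          unfolding Var_mult_power_product d by (rule power_product_upd)
        have 2: "(\<Sum>j<d v. g j * power_product (i(v := j))) = (\<Sum>j<d v. g j * (Var v ^ j * power_product (i(v := 0))))"
          by (intro sum.cong refl arg_cong2[where f="(*)"] power_product_upd)
        show ?thesis unfolding 1 2 by (simp add: right_diff_distrib sum_distrib_left mult_ac)
      qed
      finally have *: "c ^ 1 * (Var v * power_product i) - (\<Sum>j<d v. g j * power_product (i(v := j))) \<in> P" .
      have "(\<Sum>j<d v. g j * power_product (i(v := j))) \<in> N"
        by (intro N_sum N_scale N_w g) (use i in \<open>auto simp: I_def\<close>)
      then show ?thesis by (rule N_div[OF N_cong[OF *]])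
    qed
  qed
  have N_v: "Var v * f \<in> N" if fN: "f \<in> N" for v f
  proof -
    obtain e p where 1: "\<forall>i. p i \<in> polys_in T" "c ^ e * f - (\<Sum>i\<in>I. p i * power_product i) \<in> P"
      using fN unfolding N_def by blast
    have "Var v * (c ^ e * f - (\<Sum>i\<in>I. p i * power_product i)) \<in> P" using 1 by (intro mult)
    also have "Var v * (c ^ e * f - (\<Sum>i\<in>I. p i * power_product i)) = c ^ e * (Var v * f) - (\<Sum>i\<in>I. p i * (Var v * power_product i))"
      by (simp add: right_diff_distrib sum_distrib_left mult_ac)
    finally have "c ^ e * (Var v * f) - (\<Sum>i\<in>I. p i * (Var v * power_product i)) \<in> P" .
    moreover have "(\<Sum>i\<in>I. p i * (Var v * power_product i)) \<in> N"
      using 1 by (intro N_sum N_scale N_vw) auto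
    ultimately show ?thesis by (rule N_div[OF N_cong])
  qed
  have "f \<in> N" for f
  proof (induction f rule: mpoly_induct)
    case (const k)
    show ?case using N_scale[OF N_w[OF zI] polys_in_Const] by simp
  qed (auto intro: N_v N_add)
  then have gen: "\<forall>f. \<exists>e p. (\<forall>i. p i \<in> polys_in T) \<and> c ^ e * f - (\<Sum>i\<in>I. p i * power_product i) \<in> P"
    unfolding N_def by blast
  show thesis by (rule that[OF c finI zI gen])
qed

text \<open>The residue ring is algebraic over \<open>polys_in T\<close>. A polynomial relation for
  \<open>f\<close> with the lowest power of \<open>f\<close> cancelled has a constant coefficient
  outside \<open>P\<close>, and that coefficient is a multiple of \<open>f\<close> modulo
  \<open>P\<close>.\<close>

lemma divides_base:
  assumes "f \<notin> P"
  obtains b h where "b \<in> polys_in T" "b \<notin> P" "b - f * h \<in> P"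
proof -
  obtain c and I :: "('v \<Rightarrow> nat) set" where c: "c \<in> polys_in T" "c \<notin> P" and I: "finite I" "(\<lambda>_. 0) \<in> I"
    and gen: "\<forall>f. \<exists>e p. (\<forall>i. p i \<in> polys_in T) \<and> c ^ e * f - (\<Sum>i\<in>I. p i * power_product i) \<in> P"
    by (rule finite_generation) (rule that)
  define n where "n = card I"
  have "\<forall>j. \<exists>e p. (\<forall>i. p i \<in> polys_in T) \<and> c ^ e * f ^ j - (\<Sum>i\<in>I. p i * power_product i) \<in> P"
    using gen by blast
  then obtain e p where "\<forall>j. (\<forall>i. p j i \<in> polys_in T) \<and> c ^ e j * f ^ j - (\<Sum>i\<in>I. p j i * power_product i) \<in> P"
    unfolding choice_iff by (elim exE)
  then have ep: "\<And>j i. p j i \<in> polys_in T"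
    "\<And>j. c ^ e j * f ^ j - (\<Sum>i\<in>I. p j i * power_product i) \<in> P" by blast+
  define E where "E = (\<Sum>j\<le>n. e j)"
  have eE: "e j \<le> E" if "j \<le> n" for j unfolding E_def using that by (intro member_le_sum) auto
  define q where "q j i = c ^ (E - e j) * p j i" for j i
  have q: "q j i \<in> polys_in T" for j i unfolding q_def by (intro polys_in_mult polys_in_power c ep)
  have qr: "c ^ E * f ^ j - (\<Sum>i\<in>I. q j i * power_product i) \<in> P" if "j \<le> n" for j
  proof -
    have "c ^ (E - e j) * (c ^ e j * f ^ j - (\<Sum>i\<in>I. p j i * power_product i)) \<in> P" by (intro mult ep)
    also have "c ^ (E - e j) * (c ^ e j * f ^ j - (\<Sum>i\<in>I. p j i * power_product i))
      = (c ^ (E - e j) * c ^ e j) * f ^ j - (\<Sum>i\<in>I. q j i * power_product i)"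
      by (simp add: q_def right_diff_distrib sum_distrib_left mult_ac)
    also have "c ^ (E - e j) * c ^ e j = c ^ E" using eE[OF that] by (simp add: power_add[symmetric])
    finally show ?thesis .
  qed
  \<comment> \<open>There are \<open>n + 1\<close> powers of \<open>f\<close> and only
    \<open>n\<close> generators of the module.\<close>
  obtain b where b: "\<forall>j\<in>{..n}. b j \<in> polys_in T" "\<exists>j\<in>{..n}. b j \<notin> P" "\<forall>i\<in>I. (\<Sum>j\<in>{..n}. b j * q j i) \<in> P"
    using linear_dependence[of "polys_in T" I "{..n}" q] I q
    by (auto simp: n_def intro: polys_in_mult polys_in_diff)
  have "(\<Sum>j\<in>{..n}. b j * (c ^ E * f ^ j - (\<Sum>i\<in>I. q j i * power_product i))) \<in> P"
    using qr by (intro sum mult) auto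
  also have "(\<Sum>j\<in>{..n}. b j * (c ^ E * f ^ j - (\<Sum>i\<in>I. q j i * power_product i)))
     = c ^ E * (\<Sum>j\<le>n. b j * f ^ j) - (\<Sum>i\<in>I. (\<Sum>j\<le>n. b j * q j i) * power_product i)"
  proof -
    have 1: "(\<Sum>i\<in>I. (\<Sum>j\<le>n. b j * q j i) * power_product i) = (\<Sum>j\<le>n. \<Sum>i\<in>I. b j * q j i * power_product i)"
      unfolding sum_distrib_right by (rule sum.swap)
    have 2: "b j * (c ^ E * f ^ j - (\<Sum>i\<in>I. q j i * power_product i))
        = c ^ E * (b j * f ^ j) - (\<Sum>i\<in>I. b j * q j i * power_product i)" for j
      by (simp only: right_diff_distrib sum_distrib_left mult.assoc mult.left_commute[of "b j"])
    show ?thesis unfolding 1 2 by (simp only: sum_distrib_left sum_subtractf)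
  qed
  finally have "c ^ E * (\<Sum>j\<le>n. b j * f ^ j) - (\<Sum>i\<in>I. (\<Sum>j\<le>n. b j * q j i) * power_product i) \<in> P" .
  moreover have "(\<Sum>i\<in>I. (\<Sum>j\<le>n. b j * q j i) * power_product i) \<in> P"
    by (rule sum, rule mult_right) (use b(3) in blast)
  ultimately have "c ^ E * (\<Sum>j\<le>n. b j * f ^ j) \<in> P" using diff_cong by blast
  then have s: "(\<Sum>j\<le>n. b j * f ^ j) \<in> P" using prime power_notin c(2) by blast
  \<comment> \<open>The first coefficient outside \<open>P\<close>. The terms before it lie in
    \<open>P\<close>, and from the rest the factor \<open>f ^ j\<close> can be cancelled.\<close>
  define j where "j = (LEAST j. j \<le> n \<and> b j \<notin> P)"
  have j: "j \<le> n" "b j \<notin> P" using LeastI_ex[of "\<lambda>j. j \<le> n \<and> b j \<notin> P"] b(2) by (auto simp: j_def)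
  have lt: "b i \<in> P" if "i < j" for i
    using not_less_Least[of i "\<lambda>j. j \<le> n \<and> b j \<notin> P"] that j(1) by (auto simp: j_def)
  define h where "h = (\<Sum>i\<in>{Suc j..n}. b i * f ^ (i - Suc j))"
  have "{..n} = {..<j} \<union> {j} \<union> {Suc j..n}" using j(1) by auto
  then have "(\<Sum>i\<le>n. b i * f ^ i) = (\<Sum>i\<in>{..<j} \<union> {j} \<union> {Suc j..n}. b i * f ^ i)" by simp
  also have "\<dots> = (\<Sum>i<j. b i * f ^ i) + b j * f ^ j + (\<Sum>i\<in>{Suc j..n}. b i * f ^ i)"
    by (subst sum.union_disjoint; (simp; fail | force))+
  also have "(\<Sum>i\<in>{Suc j..n}. b i * f ^ i) = f ^ j * (f * h)"
    unfolding h_def sum_distrib_left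
  proof (intro sum.cong refl)
    fix i assume "i \<in> {Suc j..n}"
    then have "f ^ i = f ^ (j + Suc (i - Suc j))" by (intro arg_cong[where f="\<lambda>i. f ^ i"]) auto
    then have "f ^ i = f ^ j * (f * f ^ (i - Suc j))" by (simp add: power_add)
    then show "b i * f ^ i = f ^ j * (f * (b i * f ^ (i - Suc j)))" by (simp add: mult_ac)
  qed
  finally have "(\<Sum>i<j. b i * f ^ i) + f ^ j * (b j + f * h) \<in> P" using s by (simp add: algebra_simps)
  moreover have "(\<Sum>i<j. b i * f ^ i) \<in> P" using lt by (intro sum mult_right) auto
  ultimately have "f ^ j * (b j + f * h) \<in> P"
    using diff[of "(\<Sum>i<j. b i * f ^ i) + f ^ j * (b j + f * h)" "\<Sum>i<j. b i * f ^ i"] by simp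
  then have "b j + f * h \<in> P" using prime power_notin assms by blast
  then have "b j - f * (- h) \<in> P" by simp
  with j b(1) show thesis by (intro that[of "b j" "- h"]) auto
qed

end

lemma exists_maximal_independent:
  fixes P' :: "('v::finite, 'k::comm_ring_1) mpoly set"
  assumes "prime_set P'" "independent_mod P' T0"
  obtains T where "maximal_independent P' T" "card T0 \<le> card T"
proof -
  obtain T where T: "independent_mod P' T" "\<And>S. independent_mod P' S \<Longrightarrow> card S \<le> card T"
    using exists_max_card_subset[of UNIV T0 "independent_mod P'"] assms(2) by auto
  have "\<not> independent_mod P' (insert v T)" if "v \<notin> T" for v
    using T(2)[of "insert v T"] that by auto
  with T assms show thesis
    by (intro that[of T] maximal_independent.intro maximal_independent_axioms.intro) auto
qed

section \<open>The Nullstellensatz\<close>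

text \<open>\<open>M\<close> is maximal among the ideals that contain \<open>P\<close> and no power
  of \<open>f\<close>. Adding any \<open>g\<close> outside \<open>M\<close> therefore brings in a
  power of \<open>f\<close>; in other words, the residue ring of \<open>M\<close> becomes a field
  when \<open>f\<close> is inverted.\<close>

lemma Zorn_prime_avoiding:
  fixes P :: "'a::comm_ring_1 set"
  assumes P: "prime_set P" and f: "f \<notin> P"
  obtains M where "prime_set M" "P \<subseteq> M" "f \<notin> M" "\<And>g. g \<notin> M \<Longrightarrow> \<exists>u k. f ^ k - g * u \<in> M"
proof -
  interpret P: prime_set P by (rule P)
  define ideals where "ideals = {I. P \<subseteq> I \<and> (\<forall>a\<in>I. \<forall>b\<in>I. a + b \<in> I) \<and> (\<forall>a\<in>I. \<forall>x. x * a \<in> I) \<and> (\<forall>k. f ^ k \<notin> I)}"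
  have "P \<in> ideals"
    using P.add P.mult P.power_notin[OF f] by (auto simp: ideals_def)
  moreover have "\<Union>C \<in> ideals" if C: "C \<noteq> {}" "subset.chain ideals C" for C
  proof -
    have CI: "I \<in> ideals" if "I \<in> C" for I using that C(2) by (auto simp: subset.chain_def)
    have tot: "I \<subseteq> J \<or> J \<subseteq> I" if "I \<in> C" "J \<in> C" for I J
      using that C(2) by (auto simp: subset.chain_def)
    have "a + b \<in> \<Union>C" if ab: "a \<in> \<Union>C" "b \<in> \<Union>C" for a b
    proof -
      obtain I J where IJ: "I \<in> C" "J \<in> C" "a \<in> I" "b \<in> J" using ab by blast
      define K where "K = I \<union> J"
      have "K \<in> C" using tot[OF IJ(1,2)] IJ(1,2) by (auto simp: K_def sup.absorb1 sup.absorb2)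
      moreover have "a + b \<in> K" using CI[OF \<open>K \<in> C\<close>] IJ by (auto simp: ideals_def K_def)
      ultimately show ?thesis by blast
    qed
    moreover have "P \<subseteq> \<Union>C"
    proof -
      obtain I where "I \<in> C" using C(1) by blast
      moreover from CI[OF this] have "P \<subseteq> I" by (simp add: ideals_def)
      ultimately show ?thesis by blast
    qed
    moreover have "x * a \<in> \<Union>C" if "a \<in> \<Union>C" for a x
    proof -
      obtain I where "I \<in> C" "a \<in> I" using \<open>a \<in> \<Union>C\<close> by blast
      moreover from CI[OF this(1)] this(2) have "x * a \<in> I" by (simp add: ideals_def)
      ultimately show ?thesis by blast
    qed
    moreover have "f ^ k \<notin> (\<Union>C)" for k using CI by (auto simp: ideals_def)
    ultimately show ?thesis unfolding ideals_def by blast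
  qed
  ultimately obtain M where M: "M \<in> ideals" "\<And>J. J \<in> ideals \<Longrightarrow> M \<subseteq> J \<Longrightarrow> J = M"
    using subset_Zorn_nonempty[of ideals] by blast
  have PM: "P \<subseteq> M" and Madd: "\<And>a b. a \<in> M \<Longrightarrow> b \<in> M \<Longrightarrow> a + b \<in> M"
    and Mmult: "\<And>a x. a \<in> M \<Longrightarrow> x * a \<in> M" and Mf: "\<And>k. f ^ k \<notin> M"
    using M(1) by (auto simp: ideals_def)
  have ex: "\<exists>u k. f ^ k - g * u \<in> M" if g: "g \<notin> M" for g
  proof (rule ccontr)
    assume no: "\<not> ?thesis"
    define J where "J = {a + g * u | a u. a \<in> M}"
    have "M \<subseteq> J"
    proof
      fix a assume "a \<in> M"
      then show "a \<in> J" unfolding J_def by (intro CollectI exI[of _ a] exI[of _ 0]) auto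
    qed
    have "g \<in> J" unfolding J_def using PM P.zero by (intro CollectI exI[of _ 0] exI[of _ 1]) auto
    have "J \<in> ideals" unfolding ideals_def
    proof (intro CollectI conjI ballI allI)
      show "P \<subseteq> J" using \<open>M \<subseteq> J\<close> PM by blast
    next
      fix a b assume "a \<in> J" "b \<in> J"
      then obtain a' u b' v where "a = a' + g * u" "b = b' + g * v" "a' \<in> M" "b' \<in> M" by (auto simp: J_def)
      then show "a + b \<in> J" unfolding J_def
        by (intro CollectI exI[of _ "a' + b'"] exI[of _ "u + v"]) (auto simp: algebra_simps intro: Madd)
    next
      fix a x assume "a \<in> J"
      then obtain a' u where "a = a' + g * u" "a' \<in> M" by (auto simp: J_def)
      then show "x * a \<in> J" unfolding J_def
        by (intro CollectI exI[of _ "x * a'"] exI[of _ "x * u"]) (auto simp: distrib_left mult.left_commute intro: Mmult)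
    next
      fix k show "f ^ k \<notin> J"
      proof
        assume "f ^ k \<in> J"
        then obtain a u where "f ^ k = a + g * u" "a \<in> M" by (auto simp: J_def)
        then have "f ^ k - g * u \<in> M" by simp
        with no show False by blast
      qed
    qed
    with M(2) \<open>M \<subseteq> J\<close> \<open>g \<in> J\<close> g show False by blast
  qed
  have "prime_set M"
  proof
    show "0 \<in> M" using PM P.zero by blast
    show "1 \<notin> M" using Mf[of 0] by simp
    show "a \<in> M \<or> b \<in> M" if "a * b \<in> M" for a b
    proof (rule ccontr)
      assume "\<not> ?thesis"
      then obtain u k v l where 1: "f ^ k - a * u \<in> M" "f ^ l - b * v \<in> M" using ex[of a] ex[of b] by blast
      \<comment> \<open>Modulo \<open>M\<close>, \<open>f ^ k\<close> is \<open>a * u\<close> and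
        \<open>f ^ l\<close> is \<open>b * v\<close>, so their product is a multiple of
        \<open>a * b\<close>.\<close>
      have "f ^ l * (f ^ k - a * u) + ((a * u) * (f ^ l - b * v) + (u * v) * (a * b)) \<in> M"
        by (rule Madd[OF Mmult[OF 1(1)] Madd[OF Mmult[OF 1(2)] Mmult[OF that]]])
      also have "f ^ l * (f ^ k - a * u) + ((a * u) * (f ^ l - b * v) + (u * v) * (a * b)) = f ^ (k + l)"
        by (simp add: algebra_simps power_add)
      finally show False using Mf by blast
    qed
  qed (use Madd Mmult in auto)
  with that[of M] PM ex Mf[of 1] show thesis by simp
qed

lemma Const_uminus: "Const (- a) = - Const a"
  by (simp add: Const_def single_uminus)

lemma Const_diff: "Const (a - b) = Const a - Const b"
  by (simp add: Const_def single_diff)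

text \<open>This is the core of Zariski's lemma: a finitely generated ring that is a field after
  inverting \<open>f\<close> cannot be finite, up to denominators, over a polynomial ring in at
  least one variable. Otherwise some \<open>1 + y\<close> in the base would be invertible up to the
  denominators, although it vanishes at a point where they do not. The assumption \<open>val\<close>
  provides such a point.\<close>

lemma (in maximal_independent) empty_if_almost_maximal:
  fixes f :: "('v::finite, 'k::comm_ring_1) mpoly"
  assumes f: "f \<notin> P" and ex: "\<And>g. g \<notin> P \<Longrightarrow> \<exists>u k. f ^ k - g * u \<in> P"
    and val: "\<And>y :: ('v, 'k) mpoly. (\<And>r. y \<noteq> Const r) \<Longrightarrow> \<exists>a. meval a y = -1"
    and nz: "\<And>x y :: 'k. x * y = 0 \<Longrightarrow> x = 0 \<or> y = 0"
  shows "T = {}"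
proof (rule ccontr)
  assume "T \<noteq> {}"
  then obtain x where x: "x \<in> T" by blast
  obtain c and I :: "('v \<Rightarrow> nat) set" where c: "c \<in> polys_in T" "c \<notin> P" and I: "finite I" "(\<lambda>_. 0) \<in> I"
    and gen: "\<forall>f. \<exists>e p. (\<forall>i. p i \<in> polys_in T) \<and> c ^ e * f - (\<Sum>i\<in>I. p i * power_product i) \<in> P"
    by (rule finite_generation) (rule that)
  obtain b h where b: "b \<in> polys_in T" "b \<notin> P" "b - f * h \<in> P"
    using divides_base[OF f] by blast
  \<comment> \<open>\<open>z\<close> is the exponent of the power product 1, and \<open>lin\<close>
    is linear independence over \<open>polys_in T\<close> modulo \<open>P\<close>. A largest
    independent \<open>S\<close> containing \<open>z\<close> serves as a basis, in which the
    coefficient at 1 can be read off.\<close>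
  define z :: "'v \<Rightarrow> nat" where "z = (\<lambda>_. 0)"
  define lin where "lin S \<longleftrightarrow> (\<forall>p. (\<forall>i. p i \<in> polys_in T) \<longrightarrow> (\<Sum>i\<in>S. p i * power_product i) \<in> P \<longrightarrow> (\<forall>i\<in>S. p i = 0))" for S
  have "lin {z}" unfolding lin_def z_def using zero_if_in by auto
  then have zS: "{z} \<subseteq> I" "z \<in> {z} \<and> lin {z}" using I(2) by (simp_all add: z_def)
  obtain S where S0: "S \<subseteq> I" "z \<in> S \<and> lin S" and Smax: "\<And>S'. S' \<subseteq> I \<Longrightarrow> z \<in> S' \<and> lin S' \<Longrightarrow> card S' \<le> card S"
    by (rule exists_max_card_subset[where Q="\<lambda>S. z \<in> S \<and> lin S", OF I(1) zS]) (rule that)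
  then have S: "S \<subseteq> I" "z \<in> S" "lin S" by simp_all
  have finS: "finite S" using S(1) I(1) finite_subset by blast
  have "\<forall>i. \<exists>q p. i \<in> I - S \<longrightarrow> q \<in> polys_in T \<and> q \<notin> P \<and> (\<forall>j. p j \<in> polys_in T) \<and> q * power_product i - (\<Sum>j\<in>S. p j * power_product j) \<in> P"
  proof
    fix i
    show "\<exists>q p. i \<in> I - S \<longrightarrow> q \<in> polys_in T \<and> q \<notin> P \<and> (\<forall>j. p j \<in> polys_in T) \<and> q * power_product i - (\<Sum>j\<in>S. p j * power_product j) \<in> P"
    proof (cases "i \<in> I - S")
      case True
      then have "\<not> lin (insert i S)"
        using Smax[of "insert i S"] S finS by auto
      then obtain p where p: "\<forall>i. p i \<in> polys_in T" "(\<Sum>j\<in>insert i S. p j * power_product j) \<in> P" "\<not> (\<forall>j\<in>insert i S. p j = 0)"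
        unfolding lin_def by blast
      have s: "p i * power_product i + (\<Sum>j\<in>S. p j * power_product j) \<in> P"
        using p(2) True finS by simp
      have "p i \<noteq> 0"
      proof
        assume 0: "p i = 0"
        with s have "(\<Sum>j\<in>S. p j * power_product j) \<in> P" by simp
        with S(3) p(1) have "\<forall>j\<in>S. p j = 0" unfolding lin_def by blast
        with 0 p(3) show False by blast
      qed
      then show ?thesis
        using p(1) s notin by (intro exI[of _ "p i"] exI[of _ "\<lambda>j. - p j"]) (auto simp: sum_negf intro: polys_in_uminus)
    qed auto
  qed
  then obtain q1 p1 where q1: "\<forall>i. i \<in> I - S \<longrightarrow> q1 i \<in> polys_in T \<and> q1 i \<notin> P \<and> (\<forall>j. p1 i j \<in> polys_in T) \<and> q1 i * power_product i - (\<Sum>j\<in>S. p1 i j * power_product j) \<in> P"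
    unfolding choice_iff by (elim exE)
  define q where "q = (\<Prod>i\<in>I-S. q1 i)"
  have q: "q \<in> polys_in T" "q \<notin> P"
    unfolding q_def using q1 by (intro polys_in_prod prod_notin; blast)+
  text \<open>Every element of the ring is, up to a power of \<open>c\<close> and the factor \<open>q\<close>, a combination of the
    independent power products in \<open>S\<close>.\<close>
  have pp: "\<exists>p. (\<forall>j. p j \<in> polys_in T) \<and> q * power_product i - (\<Sum>j\<in>S. p j * power_product j) \<in> P" if "i \<in> I" for i
  proof (cases "i \<in> S")
    case True
    have "(\<Sum>j\<in>S. (if j = i then q else 0) * power_product j) = q * (power_product i :: ('v,'k) mpoly)"
      using True finS by (subst sum.mono_neutral_right[of S "{i}"]) auto
    then show ?thesis using q(1)
      by (intro exI[of _ "\<lambda>j. if j = i then q else 0"]) (auto simp: zero)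
  next
    case False
    define r where "r = (\<Prod>i\<in>I-S-{i}. q1 i)"
    have r: "r \<in> polys_in T" unfolding r_def using q1 by (intro polys_in_prod) blast
    have qr: "q = q1 i * r" unfolding q_def r_def using that False I(1) by (intro prod.remove) auto
    have "r * (q1 i * power_product i - (\<Sum>j\<in>S. p1 i j * power_product j)) \<in> P"
      using q1 that False by (intro mult) blast
    then have "q * power_product i - (\<Sum>j\<in>S. (r * p1 i j) * power_product j) \<in> P"
      by (simp add: qr right_diff_distrib sum_distrib_left mult_ac)
    moreover have "\<forall>j. r * p1 i j \<in> polys_in T" using r q1 that False by (auto intro: polys_in_mult)
    ultimately show ?thesis by (intro exI[of _ "\<lambda>j. r * p1 i j"]) auto
  qed
  have gen2: "\<exists>e p. (\<forall>j. p j \<in> polys_in T) \<and> q * c ^ e * g - (\<Sum>j\<in>S. p j * power_product j) \<in> P" for g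
  proof -
    obtain e p where p: "\<forall>i. p i \<in> polys_in T" "c ^ e * g - (\<Sum>i\<in>I. p i * power_product i) \<in> P"
      using gen by blast
    have "\<forall>i. \<exists>p. i \<in> I \<longrightarrow> (\<forall>j. p j \<in> polys_in T) \<and> q * power_product i - (\<Sum>j\<in>S. p j * power_product j) \<in> P"
      using pp by blast
    then obtain s where s: "\<forall>i. i \<in> I \<longrightarrow> (\<forall>j. s i j \<in> polys_in T) \<and> q * power_product i - (\<Sum>j\<in>S. s i j * power_product j) \<in> P"
      unfolding choice_iff by (elim exE)
    have "q * (c ^ e * g - (\<Sum>i\<in>I. p i * power_product i)) + (\<Sum>i\<in>I. p i * (q * power_product i - (\<Sum>j\<in>S. s i j * power_product j))) \<in> P"
    proof (intro add mult p(2) sum)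
      fix i assume "i \<in> I"
      with s show "q * power_product i - (\<Sum>j\<in>S. s i j * power_product j) \<in> P" by blast
    qed
    also have "q * (c ^ e * g - (\<Sum>i\<in>I. p i * power_product i)) + (\<Sum>i\<in>I. p i * (q * power_product i - (\<Sum>j\<in>S. s i j * power_product j)))
       = q * c ^ e * g - (\<Sum>j\<in>S. (\<Sum>i\<in>I. p i * s i j) * power_product j)"
    proof -
      have 1: "(\<Sum>j\<in>S. (\<Sum>i\<in>I. p i * s i j) * power_product j) = (\<Sum>i\<in>I. \<Sum>j\<in>S. p i * s i j * power_product j)"
        unfolding sum_distrib_right by (rule sum.swap)
      have 2: "p i * (q * power_product i - (\<Sum>j\<in>S. s i j * power_product j))
         = q * (p i * power_product i) - (\<Sum>j\<in>S. p i * s i j * power_product j)" for i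
        by (simp only: right_diff_distrib sum_distrib_left mult.assoc mult.left_commute[of "p i"])
      show ?thesis unfolding 1 2
        by (simp add: sum_subtractf right_diff_distrib sum_distrib_left[symmetric] mult.assoc)
    qed
    finally have "q * c ^ e * g - (\<Sum>j\<in>S. (\<Sum>i\<in>I. p i * s i j) * power_product j) \<in> P" .
    moreover have "\<forall>j. (\<Sum>i\<in>I. p i * s i j) \<in> polys_in T"
      using p(1) s by (auto intro!: polys_in_sum polys_in_mult)
    ultimately show ?thesis by (intro exI[of _ e] exI[of _ "\<lambda>j. \<Sum>i\<in>I. p i * s i j"]) auto
  qed
  text \<open>\<open>y + 1\<close> is invertible up to powers of \<open>b\<close>, but vanishes at points where \<open>b\<close> does not.\<close>
  define y where "y = c * q * b * Var x"
  have xT: "Var x \<in> polys_in T" using x by (rule polys_in_Var)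
  have x0: "(Var x :: ('v,'k) mpoly) \<noteq> 0" "(1::'k) \<noteq> 0"
  proof -
    show 1: "(1::'k) \<noteq> 0"
    proof
      assume "(1::'k) = 0"
      then have "(1 :: ('v,'k) mpoly) = 0" unfolding Const_one[symmetric] by simp
      with one zero show False by simp
    qed
    show "(Var x :: ('v,'k) mpoly) \<noteq> 0"
    proof
      assume "(Var x :: ('v,'k) mpoly) = 0"
      then have "meval (\<lambda>_. 1) (Var x :: ('v,'k) mpoly) = 0" by simp
      with 1 show False by simp
    qed
  qed
  have y: "y \<in> polys_in T" "y \<notin> P"
    unfolding y_def using c q b xT notin[OF xT x0(1)] prime by (auto intro!: polys_in_mult)
  have yc: "y \<noteq> Const r" for r
  proof
    assume r: "y = Const r"
    have "meval (\<lambda>_. 0) y = 0" by (simp add: y_def meval_mult)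
    with r have "y = 0" by simp
    with y(2) zero show False by simp
  qed
  obtain a where a: "meval a y = -1" using val[OF yc] by blast
  have "1 + y \<noteq> 0"
  proof
    assume "1 + y = 0"
    then have "y = Const (-1)" by (simp add: Const_uminus Const_one add_eq_0_iff)
    with yc show False by blast
  qed
  then have "1 + y \<notin> P" using y(1) by (intro notin polys_in_add) auto
  then obtain u k where u: "f ^ k - (1 + y) * u \<in> P" using ex by blast
  have "b ^ k - (f * h) ^ k \<in> P" by (intro diff_power b)
  moreover have "(f * h) ^ k - (1 + y) * (u * h ^ k) \<in> P"
    using mult[OF u, of "h ^ k"] by (simp add: algebra_simps power_mult_distrib)
  ultimately have bk: "b ^ k - (1 + y) * (u * h ^ k) \<in> P" by (rule diff_trans)
  obtain e p where p: "\<forall>j. p j \<in> polys_in T" "q * c ^ e * (u * h ^ k) - (\<Sum>j\<in>S. p j * power_product j) \<in> P"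
    using gen2 by blast
  \<comment> \<open>Coefficients representing
    \<open>(1 + y) * (q * c ^ e * (u * h ^ k)) - q * c ^ e * b ^ k\<close> modulo \<open>P\<close>.
    That element lies in \<open>P\<close>, so by independence the coefficient at \<open>z\<close> is
    0, which is an identity of polynomials.\<close>
  define s where "s j = (1 + y) * p j - (if j = z then q * c ^ e * b ^ k else 0)" for j
  have sT: "\<forall>j. s j \<in> polys_in T"
    unfolding s_def using p(1) y(1) q(1) c(1) b(1) by (auto intro!: polys_in_add polys_in_mult polys_in_diff polys_in_power)
  have "(\<Sum>j\<in>S. s j * power_product j) = (1 + y) * (\<Sum>j\<in>S. p j * power_product j) - q * c ^ e * b ^ k"
  proof -
    have "(\<Sum>j\<in>S. (if j = z then q * c ^ e * b ^ k else 0) * power_product j) = q * c ^ e * b ^ k * (power_product z :: ('v,'k) mpoly)"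
      using S(2) finS by (subst sum.mono_neutral_right[of S "{z}"]) auto
    then show ?thesis unfolding s_def left_diff_distrib sum_subtractf
      by (simp add: z_def sum_distrib_left mult.assoc)
  qed
  also have "\<dots> = - ((1 + y) * (q * c ^ e * (u * h ^ k) - (\<Sum>j\<in>S. p j * power_product j)) + (q * c ^ e) * (b ^ k - (1 + y) * (u * h ^ k)))"
    by (simp add: algebra_simps)
  also have "\<dots> \<in> P" by (intro uminus add mult p(2) bk)
  finally have "s z = 0" using S(2,3) sT unfolding lin_def by blast
  \<comment> \<open>Where \<open>y\<close> takes the value -1, the factors \<open>c\<close>,
    \<open>q\<close> and \<open>b\<close> of \<open>y\<close> are nonzero, whereas
    \<open>1 + y\<close> vanishes.\<close>
  then have "meval a ((1 + y) * p z) = meval a (q * c ^ e * b ^ k)" by (simp add: s_def)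
  then have "meval a q * meval a c ^ e * meval a b ^ k = 0" by (simp add: meval_simps a)
  moreover have nzp: "w ^ n \<noteq> 0" if "w \<noteq> (0::'k)" for w n using that nz x0(2) by (induction n) auto
  have "meval a c * meval a q * meval a b * a x = -1" using a by (simp add: y_def meval_simps)
  then have "meval a q \<noteq> 0" "meval a c \<noteq> 0" "meval a b \<noteq> 0" using x0(2) by auto
  moreover have "meval a q * meval a c ^ e \<noteq> 0" using \<open>meval a q \<noteq> 0\<close> nzp[OF \<open>meval a c \<noteq> 0\<close>] nz by blast
  ultimately show False using nzp[OF \<open>meval a b \<noteq> 0\<close>] nz by blast
qed

text \<open>Over an algebraically closed field \<open>p\<close> splits into linear factors, and a
  prime ideal containing their product contains one of them; a nonzero constant would be a
  unit.\<close>

lemma prime_set_root: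
  fixes M :: "('v, 'k::alg_closed_field) mpoly set"
  assumes M: "prime_set M" and "p \<noteq> 0" "poly (map_poly Const p) (Var v) \<in> M"
  obtains a where "Var v - Const a \<in> M"
proof -
  interpret prime_set M by (rule M)
  have "\<exists>a. Var v - Const a \<in> M" using assms(2,3)
  proof (induction "Polynomial.degree p" arbitrary: p rule: less_induct)
    case less
    show ?case
    proof (cases "Polynomial.degree p = 0")
      case True
      then obtain c where c: "p = [:c:]" "c \<noteq> 0" using less.prems(1) by (auto elim: degree_eq_zeroE)
      then have "Const c \<in> M" using less.prems(2) by (simp add: map_poly_pCons)
      then have "Const (1 / c) * Const c \<in> M" by (rule mult)
      with c(2) one show ?thesis by (simp add: Const_mult[symmetric] Const_one)
    next
      case False
      then obtain a where "poly p a = 0" using alg_closed_imp_poly_has_root by blast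
      then obtain q where q: "p = [:-a, 1:] * q" by (auto simp: poly_eq_0_iff_dvd)
      have q0: "q \<noteq> 0" using less.prems(1) q by auto
      have d: "Polynomial.degree q < Polynomial.degree p" unfolding q using q0 by (subst degree_mult_eq) auto
      have ca: "map_poly Const (f - g) = map_poly Const f - (map_poly Const g :: ('v,'k) mpoly poly)" for f g :: "'k poly"
        by (rule poly_eqI) (simp add: coeff_map_poly Const_diff)
      have cs: "map_poly Const (Polynomial.smult a f) = Polynomial.smult (Const a) (map_poly Const f :: ('v,'k) mpoly poly)" for f :: "'k poly" and a
        by (rule poly_eqI) (simp add: coeff_map_poly Const_mult)
      have Cm: "Const (-a) = - (Const a :: ('v,'k) mpoly)"
        by (rule Const_uminus)
      have "poly (map_poly Const p) (Var v) = (Var v - Const a) * (poly (map_poly Const q) (Var v) :: ('v,'k) mpoly)"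
        unfolding q by (simp add: ca cs map_poly_pCons Cm algebra_simps)
      with less.prems(2) prime have "Var v - Const a \<in> M \<or> poly (map_poly Const q) (Var v) \<in> M" by simp
      with less.hyps[OF d q0] show ?thesis by blast
    qed
  qed
  with that show thesis by blast
qed

text \<open>Modulo the almost maximal prime \<open>M\<close> no variable is independent, so each
  satisfies a polynomial equation over \<open>K\<close> and is congruent to a constant. These
  constants form a point at which every polynomial is congruent to its value; hence \<open>M\<close>
  is exactly the set of polynomials vanishing there.\<close>

theorem Nullstellensatz_prime:
  fixes P :: "('v::finite, 'k::alg_closed_field) mpoly set"
  assumes P: "prime_set P" and f: "f \<notin> P"
  obtains a where "\<And>g. g \<in> P \<Longrightarrow> meval a g = 0" "meval a f \<noteq> 0"
proof -
  obtain M where M: "prime_set M" "P \<subseteq> M" "f \<notin> M" "\<And>g. g \<notin> M \<Longrightarrow> \<exists>u k. f ^ k - g * u \<in> M"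
    using Zorn_prime_avoiding[OF P f] by blast
  interpret prime_set M by (rule M)
  have z: "independent_mod M {}"
    unfolding independent_mod_def
  proof (intro ballI impI)
    fix g assume g: "g \<in> polys_in {}" "g \<in> M"
    then obtain r where r: "g = Const r" using polys_in_empty by blast
    show "g = 0"
    proof (rule ccontr)
      assume "g \<noteq> 0"
      with r have "r \<noteq> 0" by auto
      then have "Const (1 / r) * g = 1" by (simp add: r Const_mult[symmetric] Const_one)
      moreover have "Const (1 / r) * g \<in> M" using g(2) by (rule mult)
      ultimately show False using one by simp
    qed
  qed
  obtain T where T: "maximal_independent M T"
    using exists_maximal_independent[OF M(1) z] by blast
  interpret maximal_independent M T by (rule T)
  have val: "\<exists>a. meval a y = -1" if "\<And>r. y \<noteq> Const r" for y :: "('v, 'k) mpoly"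
    using mpoly_attains_value[OF that] by blast
  have "T = {}"
    by (rule empty_if_almost_maximal[OF M(3,4) val]) auto
  have "\<exists>a. Var v - Const a \<in> M" for v
  proof -
    obtain g where g: "g \<in> polys_in (insert v {})" "g \<in> M" "g \<noteq> 0"
      using maximal[of v] \<open>T = {}\<close> by (auto simp: independent_mod_def)
    obtain h d where h: "\<And>i. h i \<in> polys_in {}" "g = (\<Sum>i\<le>(d::nat). h i * Var v ^ i)"
      using polys_in_insert_expand[OF g(1)] by blast
    have "\<forall>i. \<exists>r. h i = Const r" using h(1) polys_in_empty by blast
    then obtain r where r: "\<And>i. h i = Const (r i)" by metis
    define p where "p = (\<Sum>i\<le>d. Polynomial.monom (r i) i)"
    have cp: "poly.coeff p i = (if i \<le> d then r i else 0)" for i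
      by (simp add: p_def coeff_sum)
    have "map_poly Const p = (\<Sum>i\<le>d. Polynomial.monom (h i) i)"
      by (rule poly_eqI) (auto simp: coeff_map_poly cp coeff_sum r)
    then have pg: "poly (map_poly Const p) (Var v) = g"
      by (simp add: poly_sum poly_monom h(2))
    have "p \<noteq> 0" using pg g(3) by auto
    then obtain a where "Var v - Const a \<in> M" using prime_set_root[OF M(1), of p v] pg g(2) by auto
    then show ?thesis by blast
  qed
  then obtain a where a: "\<And>v. Var v - Const (a v) \<in> M" by metis
  have ev: "g - Const (meval a g) \<in> M" for g
  proof (induction g rule: mpoly_induct)
    case (var v g)
    have "g * (Var v - Const (a v)) + Const (a v) * (g - Const (meval a g)) \<in> M"
      using a var by (intro add mult)
    then show ?case by (simp add: meval_mult Const_mult algebra_simps)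
  next
    case (plus f g)
    from add[OF plus.IH] show ?case by (simp add: meval_add Const_add algebra_simps)
  qed (auto simp: zero)
  have 0: "meval a g = 0 \<longleftrightarrow> g \<in> M" for g
  proof
    assume "meval a g = 0"
    with ev[of g] show "g \<in> M" by simp
  next
    assume g: "g \<in> M"
    with diff_cong[OF ev[of g]] have "Const (meval a g) \<in> M" by simp
    with z have "Const (meval a g) = (0 :: ('v, 'k) mpoly)" unfolding independent_mod_def by simp
    then have "meval a (Const (meval a g)) = meval a 0" by (rule arg_cong)
    then show "meval a g = 0" by simp
  qed
  with that[of a] M(2,3) show thesis by blast
qed

section \<open>Irreducible closed subsets of a projective scheme\<close>

lemma primeideal_imp_prime_set:
  assumes "primeideal P (ring_of_type_algebra :: 'a::comm_ring_1 ring)"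
  shows "prime_set P"
proof -
  interpret primeideal P "ring_of_type_algebra :: 'a ring" by (rule assms)
  show ?thesis
  proof
    show "0 \<in> P" using additive_subgroup.zero_closed[OF is_additive_subgroup]
      by (simp add: ring_of_type_algebra_def)
    show "a + b \<in> P" if "a \<in> P" "b \<in> P" for a b
      using additive_subgroup.a_closed[OF is_additive_subgroup that] by (simp add: ring_of_type_algebra_def)
    show "x * a \<in> P" if "a \<in> P" for a x
      using I_l_closed[OF that, of x] by (simp add: ring_of_type_algebra_def)
    show "1 \<notin> P"
    proof
      assume 1: "1 \<in> P"
      have "P = UNIV" using I_l_closed[OF 1] by (auto simp: ring_of_type_algebra_def)
      with I_notcarr show False by (simp add: ring_of_type_algebra_def)
    qed
    show "a \<in> P \<or> b \<in> P" if "a * b \<in> P" for a b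
      using I_prime[of a b] that by (simp add: ring_of_type_algebra_def)
  qed
qed

lemma prime_set_imp_primeideal:
  assumes "prime_set (P :: 'a::comm_ring_1 set)"
  shows "primeideal P (ring_of_type_algebra :: 'a ring)"
proof -
  interpret prime_set P by (rule assms)
  have inv: "inv\<^bsub>add_monoid (ring_of_type_algebra :: 'a ring)\<^esub> a = - a" for a :: 'a
  proof -
    interpret R: cring "ring_of_type_algebra :: 'a ring" by (rule cring_from_type_algebra)
    show ?thesis
      by (rule R.add.inv_equality[unfolded a_inv_def]) (simp_all add: ring_of_type_algebra_def)
  qed
  have "ideal P (ring_of_type_algebra :: 'a ring)"
  proof (rule idealI)
    show "ring (ring_of_type_algebra :: 'a ring)" by (rule ring_from_type_algebra)
    show "subgroup P (add_monoid (ring_of_type_algebra :: 'a ring))"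
    proof
      show "inv\<^bsub>add_monoid (ring_of_type_algebra :: 'a ring)\<^esub> a \<in> P" if "a \<in> P" for a
        unfolding inv using that by (rule uminus)
    qed (auto simp: ring_of_type_algebra_def zero add)
  qed (auto simp: ring_of_type_algebra_def mult mult_right)
  then show ?thesis
  proof (rule primeidealI)
    show "cring (ring_of_type_algebra :: 'a ring)" by (rule cring_from_type_algebra)
    show "carrier (ring_of_type_algebra :: 'a ring) \<noteq> P"
      using one by (auto simp: ring_of_type_algebra_def)
  qed (use prime in \<open>auto simp: ring_of_type_algebra_def\<close>)
qed

lemma homogeneous_prime_iff:
  "homogeneous_prime P \<longleftrightarrow> prime_set P \<and> (\<forall>f\<in>P. \<forall>d. homogeneous_component d f \<in> P)"
  unfolding homogeneous_prime_def using primeideal_imp_prime_set prime_set_imp_primeideal by blast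

text \<open>\<open>Q\<close> is a generic point: a closed set that contains \<open>Q\<close>
  contains \<open>Proj_zeros Q\<close>.\<close>

lemma irreducible_Proj_zeros_point:
  assumes "Q \<in> Proj_points"
  shows "irreducible_space (subtopology Proj_space (Proj_zeros Q))"
proof -
  have sub: "Proj_zeros Q \<subseteq> Proj_points" by (auto simp: Proj_zeros_def)
  have top: "topspace (subtopology Proj_space (Proj_zeros Q)) = Proj_zeros Q"
    using sub by (auto simp: topspace_Proj_space)
  have QQ: "Q \<in> Proj_zeros Q" using assms by (simp add: Proj_zeros_def)
  have whole: "C = Proj_zeros Q" if cC: "closedin (subtopology Proj_space (Proj_zeros Q)) C" and QC: "Q \<in> C" for C
  proof -
    obtain F where F: "C = Proj_zeros F \<inter> Proj_zeros Q"
      using cC unfolding closedin_subtopology closedin_Proj_space by blast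
    have "Proj_zeros Q \<subseteq> Proj_zeros F" using QC F by (auto simp: Proj_zeros_def)
    with F show ?thesis by blast
  qed
  show ?thesis
    unfolding irreducible_space_def top using QQ whole by blast
qed

text \<open>The generic point is the intersection of all points of \<open>C\<close>. It is prime
  because a product \<open>a * b\<close> in it covers \<open>C\<close> by the zeros of
  \<open>a\<close> and those of \<open>b\<close>, and one of the two must be all of
  \<open>C\<close>.\<close>

lemma closed_irreducible_is_point_closure:
  fixes C :: "('v, 'k::comm_ring_1) mpoly set set"
  assumes C: "closedin Proj_space C" and irr: "irreducible_space (subtopology Proj_space C)"
  obtains Q where "Q \<in> Proj_points" "C = Proj_zeros Q"
proof -
  obtain F where F: "C = Proj_zeros F" using C by (auto simp: closedin_Proj_space)
  have sub: "C \<subseteq> Proj_points" unfolding F by (auto simp: Proj_zeros_def)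
  have top: "topspace (subtopology Proj_space C) = C"
    using sub by (auto simp: topspace_Proj_space)
  have ne: "C \<noteq> {}" using irr unfolding irreducible_space_def top by blast
  define Q where "Q = \<Inter>C"
  have prC: "prime_set P" if "P \<in> C" for P
    using that sub by (auto simp: Proj_points_def homogeneous_prime_iff)
  have CQ: "C = Proj_zeros Q"
  proof
    show "C \<subseteq> Proj_zeros Q" using sub by (auto simp: Proj_zeros_def Q_def)
    have "F \<subseteq> Q" by (auto simp: Q_def F Proj_zeros_def)
    then show "Proj_zeros Q \<subseteq> C" unfolding F by (auto simp: Proj_zeros_def)
  qed
  obtain P where P: "P \<in> C" using ne by blast
  have "prime_set Q"
  proof
    show "1 \<notin> Q" using P prime_set.one[OF prC[OF P]] by (auto simp: Q_def)
    show "a \<in> Q \<or> b \<in> Q" if ab: "a * b \<in> Q" for a b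
    proof -
      have cl: "closedin (subtopology Proj_space C) (C \<inter> Proj_zeros {a})" for a
        by (auto simp: closedin_subtopology closedin_Proj_space)
      have "(C \<inter> Proj_zeros {a}) \<union> (C \<inter> Proj_zeros {b}) = C"
        using ab prime_set.prime[OF prC] sub unfolding Q_def Proj_zeros_def by blast
      then have "C \<inter> Proj_zeros {a} = C \<or> C \<inter> Proj_zeros {b} = C"
        using irr cl unfolding irreducible_space_def top by blast
      then show ?thesis unfolding Q_def Proj_zeros_def by blast
    qed
  qed (use prC in \<open>auto simp: Q_def intro: prime_set.zero prime_set.add prime_set.mult\<close>)
  moreover have "homogeneous_component d f \<in> Q" if "f \<in> Q" for f d
    using that sub by (auto simp: Q_def Proj_points_def homogeneous_prime_def)
  moreover have "\<not> irrelevant_ideal \<subseteq> Q"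
    using P sub by (auto simp: Q_def Proj_points_def)
  ultimately have "Q \<in> Proj_points" by (simp add: Proj_points_def homogeneous_prime_iff)
  with CQ that show thesis by blast
qed

lemma Proj_zeros_subset_iff:
  assumes "P \<in> Proj_points" "Q \<in> Proj_points"
  shows "Proj_zeros P \<subseteq> Proj_zeros Q \<longleftrightarrow> Q \<subseteq> P"
  using assms by (auto simp: Proj_zeros_def)

lemma Proj_zeros_psubset_iff:
  assumes "P \<in> Proj_points" "Q \<in> Proj_points"
  shows "Proj_zeros P \<subset> Proj_zeros Q \<longleftrightarrow> Q \<subset> P"
  using Proj_zeros_subset_iff[OF assms] Proj_zeros_subset_iff[OF assms(2,1)] by auto

lemma irreducible_Proj_closed_subscheme:
  assumes "Q \<in> Proj_zeros E" "\<And>P. P \<in> Proj_zeros E \<Longrightarrow> Q \<subseteq> P"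
  shows "irreducible_space (Proj_closed_subscheme E)"
proof -
  have "Proj_zeros E = Proj_zeros Q" using assms by (auto simp: Proj_zeros_def)
  then show ?thesis
    using irreducible_Proj_zeros_point[of Q] assms(1)
    by (simp add: Proj_closed_subscheme_def Proj_zeros_def)
qed

text \<open>Irreducible closed subsets are zero sets of points, and inclusion is reversed; hence the
  indices \<open>n - i\<close> and \<open>d - i\<close> in the proof.\<close>

lemma krull_dimension_Proj_closed_subscheme:
  fixes E :: "('v, 'k::comm_ring_1) mpoly set"
  assumes lower: "\<And>i. i \<le> n \<Longrightarrow> q i \<in> Proj_zeros E" "\<And>i. i < n \<Longrightarrow> q i \<subset> q (Suc i)"
    and upper: "\<And>d p. (\<And>i. i \<le> d \<Longrightarrow> p i \<in> Proj_zeros E) \<Longrightarrow> (\<And>i. i < d \<Longrightarrow> p i \<subset> p (Suc i)) \<Longrightarrow> d \<le> n"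
  shows "krull_dimension (Proj_closed_subscheme E) = ereal (real n)"
proof -
  let ?V = "Proj_closed_subscheme E"
  define chain where "chain d \<longleftrightarrow> (\<exists>C :: nat \<Rightarrow> ('v, 'k) mpoly set set.
     (\<forall>i\<le>d. closedin ?V (C i) \<and> irreducible_space (subtopology ?V (C i))) \<and>
     (\<forall>i<d. C i \<subset> C (Suc i)))" for d
  have sub: "subtopology ?V C = subtopology Proj_space C" if "C \<subseteq> Proj_zeros E" for C
    using that by (simp add: Proj_closed_subscheme_def subtopology_subtopology Int_absorb1)
  have cl: "closedin ?V C \<longleftrightarrow> closedin Proj_space C \<and> C \<subseteq> Proj_zeros E" for C
    unfolding Proj_closed_subscheme_def
    by (rule closedin_closed_subtopology) (auto simp: closedin_Proj_space)
  have "chain n"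
    unfolding chain_def
  proof (intro exI[of _ "\<lambda>i. Proj_zeros (q (n - i))"] conjI allI impI)
    fix i assume "i \<le> n"
    have q: "q (n - i) \<in> Proj_zeros E" by (rule lower) simp
    then have s: "Proj_zeros (q (n - i)) \<subseteq> Proj_zeros E" by (auto simp: Proj_zeros_def)
    then show "closedin ?V (Proj_zeros (q (n - i)))" by (auto simp: cl closedin_Proj_space)
    show "irreducible_space (subtopology ?V (Proj_zeros (q (n - i))))"
      unfolding sub[OF s] by (rule irreducible_Proj_zeros_point) (use q in \<open>simp add: Proj_zeros_def\<close>)
  next
    fix i assume i: "i < n"
    have "q (n - Suc i) \<subset> q (Suc (n - Suc i))" using i by (intro lower) auto
    then have "q (n - Suc i) \<subset> q (n - i)" using i by (simp add: Suc_diff_Suc)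
    then show "Proj_zeros (q (n - i)) \<subset> Proj_zeros (q (n - Suc i))"
      using lower(1)[of "n - i"] lower(1)[of "n - Suc i"]
      by (subst Proj_zeros_psubset_iff) (auto simp: Proj_zeros_def)
  qed
  moreover have "d \<le> n" if "chain d" for d
  proof -
    obtain C where C: "\<And>i. i \<le> d \<Longrightarrow> closedin ?V (C i)" "\<And>i. i \<le> d \<Longrightarrow> irreducible_space (subtopology ?V (C i))"
      "\<And>i. i < d \<Longrightarrow> C i \<subset> C (Suc i)" using \<open>chain d\<close> unfolding chain_def by blast
    have "\<exists>Q. i \<le> d \<longrightarrow> Q \<in> Proj_zeros E \<and> C i = Proj_zeros Q" for i
    proof (cases "i \<le> d")
      case True
      obtain Q where Q: "Q \<in> Proj_points" "C i = Proj_zeros Q"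
        using closed_irreducible_is_point_closure[of "C i"] C(1,2)[OF True] sub[of "C i"] by (auto simp: cl)
      moreover have "C i \<subseteq> Proj_zeros E" using C(1)[OF True] by (simp add: cl)
      ultimately have "Q \<in> Proj_zeros E" by (auto simp: Proj_zeros_def)
      with Q show ?thesis by blast
    qed auto
    then obtain Q where Q: "\<And>i. i \<le> d \<Longrightarrow> Q i \<in> Proj_zeros E \<and> C i = Proj_zeros (Q i)" by metis
    show ?thesis
    proof (rule upper)
      show "Q (d - i) \<in> Proj_zeros E" if "i \<le> d" for i using Q[of "d - i"] by simp
      show "Q (d - i) \<subset> Q (d - Suc i)" if i: "i < d" for i
      proof -
        have 1: "Suc (d - Suc i) = d - i" using i by simp
        have "Proj_zeros (Q (d - Suc i)) \<subset> Proj_zeros (Q (d - i))"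
          using C(3)[of "d - Suc i"] Q[of "d - i"] Q[of "d - Suc i"] i unfolding 1 by simp
        then show ?thesis
          using Q[of "d - i"] Q[of "d - Suc i"] by (subst (asm) Proj_zeros_psubset_iff) (auto simp: Proj_zeros_def)
      qed
    qed
  qed
  ultimately have "krull_dimension ?V = Sup {ereal (real d) | d. chain d}" "chain n" "\<And>d. chain d \<Longrightarrow> d \<le> n"
    by (auto simp: krull_dimension_def chain_def)
  then show ?thesis
    by (intro antisym) (auto intro!: Sup_least Sup_upper)
qed

section \<open>Polynomial functions of one parameter\<close>

text \<open>Curves are functions of a parameter whose coordinates are polynomial. Closure under
  sums, products and determinants then shows this for matrices built along the curve without any
  polynomial being written down.\<close>

definition polyfun :: "('k::field_char_0 \<Rightarrow> 'k) \<Rightarrow> bool" where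
  "polyfun f \<longleftrightarrow> (\<exists>p. \<forall>s. f s = poly p s)"

lemma polyfun_const [intro, simp]: "polyfun (\<lambda>s. c)"
  unfolding polyfun_def by (rule exI[of _ "[:c:]"]) simp

lemma polyfun_id [intro, simp]: "polyfun (\<lambda>s. s)"
  unfolding polyfun_def by (rule exI[of _ "[:0, 1:]"]) simp

lemma polyfun_add [intro]: "polyfun f \<Longrightarrow> polyfun g \<Longrightarrow> polyfun (\<lambda>s. f s + g s)"
  unfolding polyfun_def by (metis poly_add)

lemma polyfun_mult [intro]: "polyfun f \<Longrightarrow> polyfun g \<Longrightarrow> polyfun (\<lambda>s. f s * g s)"
  unfolding polyfun_def by (metis poly_mult)

lemma polyfun_diff [intro]: "polyfun f \<Longrightarrow> polyfun g \<Longrightarrow> polyfun (\<lambda>s. f s - g s)"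
  unfolding polyfun_def by (metis poly_diff)

lemma polyfun_sum [intro]: "(\<And>i. i \<in> I \<Longrightarrow> polyfun (f i)) \<Longrightarrow> polyfun (\<lambda>s. \<Sum>i\<in>I. f i s)"
  by (induction I rule: infinite_finite_induct) auto

lemma polyfun_prod [intro]: "(\<And>i. i \<in> I \<Longrightarrow> polyfun (f i)) \<Longrightarrow> polyfun (\<lambda>s. \<Prod>i\<in>I. f i s)"
  by (induction I rule: infinite_finite_induct) auto

lemma polyfun_power [intro]: "polyfun f \<Longrightarrow> polyfun (\<lambda>s. f s ^ k)"
  by (induction k) auto

lemma polyfun_if [intro]: "(b \<Longrightarrow> polyfun f) \<Longrightarrow> (\<not> b \<Longrightarrow> polyfun g) \<Longrightarrow> polyfun (\<lambda>s. if b then f s else g s)"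
  by (cases b) auto

lemma polyfun_det [intro]:
  "(\<And>i j. polyfun (\<lambda>s. A s $ i $ j)) \<Longrightarrow> polyfun (\<lambda>s. det (A s :: 'k::field_char_0 ^ 'n ^ 'n))"
  unfolding det_def by (intro polyfun_sum polyfun_mult polyfun_const polyfun_prod) auto

lemma polyfun_meval [intro]:
  fixes f :: "('v::finite, 'k::field_char_0) mpoly"
  assumes "\<And>v. polyfun (\<lambda>s. a s v)"
  shows "polyfun (\<lambda>s. meval (a s) f)"
  unfolding meval_def monomial_value_def
  by (intro polyfun_sum polyfun_mult polyfun_const polyfun_prod polyfun_power assms)

text \<open>Irreducibility of the affine line in the form used throughout: an inequation at one end
  of a curve and another at the other end hold together at some parameter.\<close>

lemma polyfun_common_nonzero:
  assumes "polyfun f" "polyfun g" "f s \<noteq> 0" "g t \<noteq> 0"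
  obtains u where "f u \<noteq> 0" "g u \<noteq> 0"
proof -
  obtain p q where p: "\<And>s. f s = poly p s" and q: "\<And>s. g s = poly q s"
    using assms(1,2) by (auto simp: polyfun_def)
  have "p * q \<noteq> 0" using assms(3,4) p q by auto
  then obtain u where "poly (p * q) u \<noteq> 0" by (rule exists_nonroot)
  with that p q show thesis by auto
qed

lemma polyfun_eqI:
  assumes "polyfun f" "polyfun g" "g t \<noteq> 0" "\<And>s. g s \<noteq> 0 \<Longrightarrow> f s = 0"
  shows "f s = 0"
  using polyfun_common_nonzero[of f g s t] assms by metis

section \<open>Characteristic polynomials\<close>

lemma poly_det: "poly (det A) x = det (\<chi> i j. poly (A $ i $ j) x)"
proof -
  have "poly (of_int z) x = of_int z" for z :: int
    by (metis of_int_poly poly_const_conv poly_pCons poly_0 mult_zero_right add.right_neutral)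
  then show ?thesis
    unfolding det_def by (simp add: poly_sum poly_prod)
qed

lemma poly_charpoly: "poly (charpoly A) x = det (mat x - A)"
  unfolding charpoly_def poly_det
  by (intro arg_cong[where f=det]) (simp add: vec_eq_iff mat_def)

text \<open>A permutation contributes degree at most the number of its fixed points, so only the
  identity reaches degree n, and it contributes a product of monic linear factors.\<close>

lemma
  fixes A :: "'k::field ^ 'n ^ 'n"
  shows degree_charpoly_le: "Polynomial.degree (charpoly A) \<le> CARD('n)"
    and coeff_charpoly_top: "poly.coeff (charpoly A) CARD('n) = 1"
proof -
  let ?B = "mat [:0, 1:] - (\<chi> i j. [:A $ i $ j:])"
  have d1: "Polynomial.degree (?B $ i $ j) \<le> (if i = j then 1 else 0)" for i j
    by (simp add: mat_def)
  have deg: "Polynomial.degree (\<Prod>i\<in>UNIV. ?B $ i $ p i) \<le> card {i. p i = i}" for p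
  proof -
    have "Polynomial.degree (\<Prod>i\<in>UNIV. ?B $ i $ p i) \<le> (\<Sum>i\<in>UNIV. Polynomial.degree (?B $ i $ p i))"
      using degree_prod_sum_le[of UNIV "\<lambda>i. ?B $ i $ p i"] by simp
    also have "\<dots> \<le> (\<Sum>i\<in>UNIV. if i = p i then 1 else 0)" by (intro sum_mono d1)
    also have "\<dots> = card {i. p i = i}" by (simp add: sum.If_cases eq_commute)
    finally show ?thesis .
  qed
  have sg: "Polynomial.degree (of_int z * q) \<le> Polynomial.degree q" for z and q :: "'k poly"
    using degree_mult_le[of "of_int z" q] by simp
  have top: "Polynomial.degree (of_int (sign p) * (\<Prod>i\<in>UNIV. ?B $ i $ p i)) < CARD('n)" if pid: "p \<noteq> id" for p
  proof -
    obtain i where "p i \<noteq> i" using pid by (auto simp: fun_eq_iff)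
    then have "card {i. p i = i} < CARD('n)" by (intro psubset_card_mono) auto
    with deg[of p] sg[of "sign p" "\<Prod>i\<in>UNIV. ?B $ i $ p i"] show ?thesis by linarith
  qed
  have cid: "(\<Prod>i\<in>UNIV. ?B $ i $ i) = (\<Prod>i\<in>UNIV. [:- A $ i $ i, 1:])"
    by (intro prod.cong) (auto simp: mat_def)
  have "Polynomial.degree (\<Prod>i\<in>UNIV. [:- A $ i $ i, 1:]) = CARD('n)"
    by (subst degree_prod_eq_sum_degree) auto
  moreover have "Polynomial.lead_coeff (\<Prod>i\<in>UNIV. [:- A $ i $ i, 1:]) = 1"
    by (subst lead_coeff_prod) simp
  ultimately have c1: "poly.coeff (\<Prod>i\<in>UNIV. ?B $ i $ i) CARD('n) = 1" unfolding cid by metis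
  have "poly.coeff (charpoly A) CARD('n) = (\<Sum>p\<in>{p. p permutes UNIV}. poly.coeff (of_int (sign p) * (\<Prod>i\<in>UNIV. ?B $ i $ p i)) CARD('n))"
    by (simp add: charpoly_def det_def coeff_sum)
  also have "\<dots> = (\<Sum>p\<in>{id}. poly.coeff (of_int (sign p) * (\<Prod>i\<in>UNIV. ?B $ i $ p i)) CARD('n))"
  proof (rule sum.mono_neutral_right)
    show "\<forall>p\<in>{p. p permutes UNIV} - {id}. poly.coeff (of_int (sign p) * (\<Prod>i\<in>UNIV. ?B $ i $ p i)) CARD('n) = 0"
      using coeff_eq_0[OF top] by blast
  qed (auto simp: permutes_id)
  also have "\<dots> = 1" using c1 by (simp add: sign_id del: vector_minus_component vec_lambda_beta)
  finally show "poly.coeff (charpoly A) CARD('n) = 1" .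
  show "Polynomial.degree (charpoly A) \<le> CARD('n)"
    unfolding charpoly_def det_def
  proof (rule degree_sum_le)
    fix p :: "'n \<Rightarrow> 'n"
    have "card {i. p i = i} \<le> CARD('n)" by (intro card_mono) auto
    with deg[of p] sg[of "sign p" "\<Prod>i\<in>UNIV. ?B $ i $ p i"]
    show "Polynomial.degree (of_int (sign p) * (\<Prod>i\<in>UNIV. ?B $ i $ p i)) \<le> CARD('n)" by linarith
  qed auto
qed

section \<open>The cone of matrices with prescribed characteristic polynomial\<close>

type_synonym ('n, 'k) point = "('n \<times> 'n) option \<Rightarrow> 'k"

definition matrix_of :: "('n::finite, 'k) point \<Rightarrow> 'k ^ 'n ^ 'n" where
  "matrix_of a = (\<chi> i j. a (Some (i, j)))"

definition target_poly :: "'n::finite itself \<Rightarrow> (nat \<Rightarrow> int) \<Rightarrow> 'k::field_char_0 \<Rightarrow> 'k poly" where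
  "target_poly _ l z = Polynomial.monom 1 CARD('n) +
     (\<Sum>k\<in>{1..CARD('n)}. Polynomial.monom (of_int (l k) * z ^ k) (CARD('n) - k))"

text \<open>Stated through values of determinants over the field, where conjugation and row
  expansion are available; \<open>in_cone_iff\<close> identifies it with the vanishing of the
  defining equations.\<close>

definition in_cone :: "(nat \<Rightarrow> int) \<Rightarrow> ('n::finite, 'k::field_char_0) point \<Rightarrow> bool" where
  "in_cone l a \<longleftrightarrow> (\<forall>x. det (mat x - matrix_of a) = poly (target_poly TYPE('n) l (a None)) x)"

lemma poly_target_poly:
  "poly (target_poly TYPE('n::finite) l z) x = x ^ CARD('n) + (\<Sum>k\<in>{1..CARD('n)}. of_int (l k) * z ^ k * x ^ (CARD('n) - k))"
  by (simp add: target_poly_def poly_sum poly_monom)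

lemma coeff_target_poly:
  assumes "1 \<le> k" "k \<le> CARD('n)"
  shows "poly.coeff (target_poly TYPE('n::finite) l z) (CARD('n) - k) = of_int (l k) * z ^ k"
proof -
  have "(\<Sum>j\<in>{1..CARD('n)}. poly.coeff (Polynomial.monom (of_int (l j) * z ^ j) (CARD('n) - j)) (CARD('n) - k))
     = (\<Sum>j\<in>{k}. poly.coeff (Polynomial.monom (of_int (l j) * z ^ j) (CARD('n) - j)) (CARD('n) - k))"
    using assms by (intro sum.mono_neutral_right) auto
  with assms show ?thesis by (simp add: target_poly_def coeff_sum)
qed

lemma coeff_target_poly_top: "poly.coeff (target_poly TYPE('n::finite) l z) CARD('n) = 1"
proof -
  have "(\<Sum>j\<in>{1..CARD('n)}. poly.coeff (Polynomial.monom (of_int (l j) * z ^ j) (CARD('n) - j)) CARD('n)) = 0"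
    by (intro sum.neutral) auto
  then show ?thesis by (simp add: target_poly_def coeff_sum)
qed

lemma degree_target_poly_le: "Polynomial.degree (target_poly TYPE('n::finite) l z) \<le> CARD('n)"
  unfolding target_poly_def
  by (intro degree_add_le degree_sum_le degree_monom_le order_trans[OF degree_monom_le]) auto

lemma in_cone_iff_charpoly:
  "in_cone l a \<longleftrightarrow> charpoly (matrix_of a) = target_poly TYPE('n) l (a None)" for a :: "('n::finite, 'k::field_char_0) point"
  unfolding in_cone_def poly_charpoly[symmetric] poly_eq_poly_eq_iff[symmetric] by (simp add: fun_eq_iff)

lemma map_poly_meval_mult:
  "map_poly (meval a) (p * q) = map_poly (meval a) p * map_poly (meval a) q"
  by (rule poly_eqI) (simp add: coeff_map_poly coeff_mult meval_simps)

lemma map_poly_meval_add: "map_poly (meval a) (p + q) = map_poly (meval a) p + map_poly (meval a) q"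
  by (rule poly_eqI) (simp add: coeff_map_poly meval_simps)

lemma meval_of_int [simp]: "meval a (of_int z) = of_int z"
proof -
  have n: "meval a (of_nat m) = of_nat m" for m
    by (induction m) (auto simp: meval_add)
  show ?thesis by (cases z) (auto simp: n meval_diff meval_uminus simp del: of_nat_Suc)
qed

lemma map_poly_meval_charpoly:
  "map_poly (meval a) (charpoly (generic_matrix :: (('n::finite \<times> 'n) option, 'k::comm_ring_1) mpoly ^ 'n ^ 'n)) = charpoly (matrix_of a)"
proof -
  have s: "map_poly (meval a) (\<Sum>i\<in>I. f i) = (\<Sum>i\<in>I. map_poly (meval a) (f i))" for f :: "'b \<Rightarrow> _" and I
    by (induction I rule: infinite_finite_induct) (auto simp: map_poly_meval_add)
  have p: "map_poly (meval a) (\<Prod>i\<in>I. f i) = (\<Prod>i\<in>I. map_poly (meval a) (f i))" for f :: "'b \<Rightarrow> _" and I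
    by (induction I rule: infinite_finite_induct) (auto simp: map_poly_meval_mult)
  have i: "map_poly (meval a) (of_int z) = of_int z" for z
    by (rule poly_eqI) (simp add: coeff_map_poly of_int_poly coeff_pCons split: nat.split)
  have e: "map_poly (meval a) ((mat [:0, 1:] - (\<chi> i j. [:generic_matrix $ i $ j:])) $ i $ j)
      = (mat [:0, 1:] - (\<chi> i j. [:matrix_of a $ i $ j:])) $ i $ j" for i j
    by (rule poly_eqI) (auto simp: coeff_map_poly mat_def generic_matrix_def matrix_of_def coeff_pCons meval_simps split: nat.split)
  show ?thesis
    unfolding charpoly_def det_def s map_poly_meval_mult i p e ..
qed

text \<open>Both polynomials are monic of degree n, so only the coefficients below the top carry a
  condition, and those are the given equations evaluated at \<open>a\<close>.\<close>

lemma in_cone_iff: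
  fixes a :: "('n::finite, 'k::field_char_0) point"
  shows "in_cone l a \<longleftrightarrow> (\<forall>f\<in>(\<lambda>k. charpoly_coeff k - Const (of_int (l k)) * Zvar ^ k) ` {1..CARD('n)}. meval a f = 0)"
proof -
  have m: "meval a (charpoly_coeff k - Const (of_int (l k)) * Zvar ^ k)
     = poly.coeff (charpoly (matrix_of a)) (CARD('n) - k) - of_int (l k) * a None ^ k" for k
    by (simp add: charpoly_coeff_def Zvar_def meval_simps map_poly_meval_charpoly[symmetric] coeff_map_poly)
  have "charpoly (matrix_of a) = target_poly TYPE('n) l (a None)"
    if "\<And>k. 1 \<le> k \<Longrightarrow> k \<le> CARD('n) \<Longrightarrow> poly.coeff (charpoly (matrix_of a)) (CARD('n) - k) = of_int (l k) * a None ^ k"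
  proof (rule poly_eqI)
    fix i
    consider "i > CARD('n)" | "i = CARD('n)" | k where "i = CARD('n) - k" "1 \<le> k" "k \<le> CARD('n)"
      by (metis diff_diff_cancel diff_le_self le_neq_implies_less less_one linorder_not_le zero_less_diff)
    then show "poly.coeff (charpoly (matrix_of a)) i = poly.coeff (target_poly TYPE('n) l (a None)) i"
    proof cases
      case 1
      then show ?thesis
        using degree_charpoly_le[of "matrix_of a"] degree_target_poly_le[where 'n='n, of l "a None"]
        by (simp add: coeff_eq_0)
    next
      case 2
      then show ?thesis by (simp add: coeff_charpoly_top coeff_target_poly_top)
    next
      case 3
      with that show ?thesis by (simp add: coeff_target_poly)
    qed
  qed
  then show ?thesis
    unfolding in_cone_iff_charpoly using coeff_target_poly[where 'n='n] by (auto simp: m)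
qed


lemma det_scaled_entries:
  fixes A :: "'k::comm_ring_1 ^ 'n ^ 'n"
  shows "det (\<chi> i j. c i * A $ i $ j) = (\<Prod>i\<in>UNIV. c i) * det A"
proof -
  have "(\<chi> i j. c i * A $ i $ j) = (\<chi> i. c i *s A $ i)" by (simp add: vec_eq_iff)
  then show ?thesis by (simp add: det_rows_mul)
qed

text \<open>\<open>det (x - c A)\<close> is \<open>c ^ n\<close> times
  \<open>det (x / c - A)\<close>, and the target polynomial scales in the same way because
  \<open>z ^ k\<close> accompanies the coefficient of degree \<open>k\<close>.\<close>

lemma in_cone_scale:
  fixes a :: "('n::finite, 'k::field_char_0) point"
  assumes "in_cone l a" "c \<noteq> 0"
  shows "in_cone l (\<lambda>v. c * a v)"
proof -
  have "det (mat x - matrix_of (\<lambda>v. c * a v)) = poly (target_poly TYPE('n) l (c * a None)) x" for x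
  proof -
    have "mat x - matrix_of (\<lambda>v. c * a v) = (\<chi> i j. c * (mat (x / c) - matrix_of a) $ i $ j)"
      using assms(2) by (auto simp: vec_eq_iff mat_def matrix_of_def right_diff_distrib)
    then have "det (mat x - matrix_of (\<lambda>v. c * a v)) = c ^ CARD('n) * poly (target_poly TYPE('n) l (a None)) (x / c)"
      using assms(1) by (simp only: det_scaled_entries in_cone_def prod_constant)
    also have "\<dots> = (c * (x / c)) ^ CARD('n) + (\<Sum>k\<in>{1..CARD('n)}. of_int (l k) * (c * a None) ^ k * (c * (x / c)) ^ (CARD('n) - k))"
    proof -
      have "c ^ CARD('n) * (of_int (l k) * a None ^ k * (x / c) ^ (CARD('n) - k)) = of_int (l k) * (c * a None) ^ k * (c * (x / c)) ^ (CARD('n) - k)"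
        if "k \<in> {1..CARD('n)}" for k
      proof -
        have "c ^ CARD('n) = c ^ k * c ^ (CARD('n) - k)" using that by (simp add: power_add[symmetric])
        then show ?thesis by (simp only: power_mult_distrib mult_ac)
      qed
      then have "(\<Sum>k\<in>{1..CARD('n)}. c ^ CARD('n) * (of_int (l k) * a None ^ k * (x / c) ^ (CARD('n) - k)))
         = (\<Sum>k\<in>{1..CARD('n)}. of_int (l k) * (c * a None) ^ k * (c * (x / c)) ^ (CARD('n) - k))"
        by (rule sum.cong[OF refl])
      then show ?thesis by (simp only: poly_target_poly distrib_left sum_distrib_left power_mult_distrib)
    qed
    also have "\<dots> = poly (target_poly TYPE('n) l (c * a None)) x"
      using assms(2) by (simp add: poly_target_poly)
    finally show ?thesis .
  qed
  then show ?thesis by (simp add: in_cone_def)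
qed

section \<open>Solving for the last row\<close>

text \<open>An arbitrary numbering: the index type carries no order, but the last row, the shift
  matrix and triangularity refer to one.\<close>

definition index_of :: "'n::finite \<Rightarrow> nat" where
  "index_of = (SOME h. bij_betw h UNIV {0..<CARD('n)})"

definition of_index :: "nat \<Rightarrow> 'n::finite" where
  "of_index = inv_into UNIV index_of"

definition last_row :: "'n::finite" where
  "last_row = of_index (CARD('n) - 1)"

lemma bij_index_of: "bij_betw (index_of :: 'n::finite \<Rightarrow> nat) UNIV {0..<CARD('n)}"
  unfolding index_of_def using someI_ex[OF ex_bij_betw_finite_nat[OF finite[of "UNIV :: 'n set"]]] .

lemma index_of_less: "index_of (i::'n::finite) < CARD('n)"
  using bij_index_of[where 'n='n] by (auto simp: bij_betw_def)

lemma index_of_eq_iff [simp]: "index_of i = index_of j \<longleftrightarrow> i = (j::'n::finite)"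
  using bij_index_of[where 'n='n] by (auto simp: bij_betw_def inj_on_def)

lemma of_index_index_of [simp]: "of_index (index_of i) = (i::'n::finite)"
  unfolding of_index_def using bij_index_of[where 'n='n] by (simp add: bij_betw_def)

lemma index_of_of_index: "k < CARD('n) \<Longrightarrow> index_of (of_index k :: 'n::finite) = k"
  unfolding of_index_def using bij_index_of[where 'n='n]
  by (simp add: bij_betw_def f_inv_into_f)

lemma index_of_last_row: "index_of (last_row :: 'n::finite) = CARD('n) - 1"
  unfolding last_row_def by (rule index_of_of_index) simp

definition with_row :: "'n \<Rightarrow> 'k ^ 'n \<Rightarrow> 'k ^ 'n ^ 'n \<Rightarrow> 'k ^ 'n ^ 'n" where
  "with_row r w B = (\<chi> i. if i = r then w else B $ i)"

lemma det_with_row: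
  fixes B :: "'k::comm_ring_1 ^ 'n ^ 'n"
  shows "det (with_row r w B) = (\<Sum>j\<in>UNIV. w $ j * det (with_row r (axis j 1) B))"
proof -
  have "w = (\<Sum>j\<in>UNIV. w $ j *s axis j 1)" by (simp add: basis_expansion)
  then have "with_row r w B = (\<chi> i. if i = r then (\<Sum>j\<in>UNIV. w $ j *s axis j 1) else B $ i)"
    unfolding with_row_def by (rule arg_cong)
  also have "det \<dots> = (\<Sum>j\<in>UNIV. det (\<chi> i. if i = r then w $ j *s axis j 1 else B $ i))"
    by (rule det_linear_row_sum) simp
  also have "\<dots> = (\<Sum>j\<in>UNIV. w $ j * det (with_row r (axis j 1) B))"
    unfolding with_row_def by (intro sum.cong refl det_row_mul)
  finally show ?thesis .
qed

text \<open>The cofactor of \<open>mat x - A\<close> at position \<open>j\<close> of the last row: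
  putting a unit vector into that row removes all dependence on the last row of
  \<open>A\<close>.\<close>

definition row_cofactor :: "'k::comm_ring_1 ^ 'n::finite ^ 'n \<Rightarrow> 'k \<Rightarrow> 'n \<Rightarrow> 'k" where
  "row_cofactor A x j = det (with_row last_row (axis j 1) (mat x - A))"

lemma det_expand_last_row:
  "det (mat x - A) = x * row_cofactor A x last_row - (\<Sum>j\<in>UNIV. A $ last_row $ j * row_cofactor A x j)"
proof -
  have "with_row last_row ((mat x - A) $ last_row) (mat x - A) = mat x - A"
    by (simp add: with_row_def vec_eq_iff)
  then have "det (mat x - A) = (\<Sum>j\<in>UNIV. (mat x - A) $ last_row $ j * row_cofactor A x j)"
    unfolding row_cofactor_def by (metis det_with_row)
  also have "\<dots> = (\<Sum>j\<in>UNIV. (if j = last_row then x * row_cofactor A x j else 0) - A $ last_row $ j * row_cofactor A x j)"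
    by (intro sum.cong) (auto simp: mat_def left_diff_distrib)
  also have "\<dots> = x * row_cofactor A x last_row - (\<Sum>j\<in>UNIV. A $ last_row $ j * row_cofactor A x j)"
    by (simp add: sum_subtractf)
  finally show ?thesis .
qed

lemma row_cofactor_cong:
  assumes "\<And>i. i \<noteq> last_row \<Longrightarrow> A $ i = B $ i"
  shows "row_cofactor A x j = row_cofactor B x j"
  unfolding row_cofactor_def
  by (intro arg_cong[where f=det]) (auto simp: with_row_def vec_eq_iff assms)

section \<open>Interpolation nodes and the nondegeneracy condition\<close>

definition node :: "'n::finite \<Rightarrow> 'k::field_char_0" where
  "node i = of_nat (index_of i)"

lemma inj_node: "inj (node :: 'n::finite \<Rightarrow> 'k::field_char_0)"
  by (auto simp: inj_def node_def)

lemma card_nodes: "card (range (node :: 'n::finite \<Rightarrow> 'k::field_char_0)) = CARD('n)"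
  by (rule card_image) (rule inj_node)

text \<open>The cofactors are polynomials in x of degree below n, sampled here at n nodes. The
  matrix is thus a Vandermonde matrix times the matrix of their coefficients.\<close>

definition cofactor_matrix :: "'k::field_char_0 ^ 'n::finite ^ 'n \<Rightarrow> 'k ^ 'n ^ 'n" where
  "cofactor_matrix A = (\<chi> i j. row_cofactor A (node i) j)"

text \<open>Nonzero exactly when the cofactors of the last row are linearly independent polynomials,
  equivalently when the last unit vector is cyclic for \<open>A\<close>.\<close>

definition nondeg :: "'k::field_char_0 ^ 'n::finite ^ 'n \<Rightarrow> 'k" where
  "nondeg A = det (cofactor_matrix A)"

text \<open>The leading terms cancel in the difference, which then has degree below n and n
  zeros.\<close>

lemma monic_eq_on_nodes:
  fixes p q :: "'k::field_char_0 poly"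
  assumes "Polynomial.degree p \<le> CARD('n)" "poly.coeff p CARD('n) = 1"
    and "Polynomial.degree q \<le> CARD('n)" "poly.coeff q CARD('n) = 1"
    and "\<And>i :: 'n::finite. poly p (node i) = poly q (node i)"
  shows "p = q"
  by (rule poly_eqI_degree_lead_coeff[where A="range (node :: 'n \<Rightarrow> 'k)" and n="CARD('n)"])
    (use assms in \<open>auto simp: card_nodes\<close>)

text \<open>Frees nondegeneracy from the choice of nodes. The combination with coefficients
  \<open>w\<close> is the difference of the characteristic polynomials for last rows 0 and
  \<open>w\<close>; both are monic of degree n, so its vanishing at the nodes means vanishing
  everywhere.\<close>

lemma nondeg_iff:
  fixes A :: "'k::field_char_0 ^ 'n::finite ^ 'n"
  shows "nondeg A \<noteq> 0 \<longleftrightarrow> (\<forall>w. (\<forall>x. (\<Sum>j\<in>UNIV. w $ j * row_cofactor A x j) = 0) \<longrightarrow> w = 0)"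
proof -
  have *: "(\<Sum>j\<in>UNIV. w $ j * row_cofactor A x j) = 0" if w: "cofactor_matrix A *v w = 0" for w x
  proof -
    define A0 where "A0 = with_row last_row 0 A"
    define Aw where "Aw = with_row last_row w A"
    have c: "row_cofactor A0 x j = row_cofactor A x j" "row_cofactor Aw x j = row_cofactor A x j" for x j
      by (intro row_cofactor_cong; simp add: A0_def Aw_def with_row_def)+
    have d: "det (mat x - A0) - det (mat x - Aw) = (\<Sum>j\<in>UNIV. w $ j * row_cofactor A x j)" for x
      unfolding det_expand_last_row c by (simp add: A0_def Aw_def with_row_def)
    have n: "(\<Sum>j\<in>UNIV. w $ j * row_cofactor A (node i) j) = 0" for i :: 'n
      using w by (simp add: vec_eq_iff matrix_vector_mult_def cofactor_matrix_def mult.commute)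
    have "charpoly A0 = charpoly Aw"
    proof (rule monic_eq_on_nodes[where 'n='n])
      show "poly (charpoly A0) (node i) = poly (charpoly Aw) (node i)" for i :: 'n
        using d[of "node i"] n[of i] by (simp add: poly_charpoly)
    qed (simp_all add: degree_charpoly_le coeff_charpoly_top)
    then show ?thesis using d[of x] by (metis poly_charpoly diff_self)
  qed
  have "nondeg A \<noteq> 0 \<longleftrightarrow> (\<exists>B. B ** cofactor_matrix A = mat 1)"
    unfolding nondeg_def invertible_det_nz[symmetric] by (simp add: invertible_left_inverse)
  also have "\<dots> \<longleftrightarrow> (\<forall>w. cofactor_matrix A *v w = 0 \<longrightarrow> w = 0)"
    by (rule matrix_left_invertible_ker)
  also have "\<dots> \<longleftrightarrow> (\<forall>w. (\<forall>x. (\<Sum>j\<in>UNIV. w $ j * row_cofactor A x j) = 0) \<longrightarrow> w = 0)"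
  proof -
    have "cofactor_matrix A *v w = 0" if "\<forall>x. (\<Sum>j\<in>UNIV. w $ j * row_cofactor A x j) = 0" for w
      using that by (simp add: vec_eq_iff matrix_vector_mult_def cofactor_matrix_def mult.commute)
    with * show ?thesis by blast
  qed
  finally show ?thesis .
qed

lemma nondeg_cong:
  assumes "\<And>i. i \<noteq> last_row \<Longrightarrow> A $ i = B $ i"
  shows "nondeg A = nondeg B"
proof -
  have "row_cofactor A = row_cofactor B" by (intro ext row_cofactor_cong assms)
  then show ?thesis by (simp add: nondeg_def cofactor_matrix_def)
qed

text \<open>Scaling both \<open>A\<close> and \<open>x\<close> by \<open>c\<close> multiplies every
  cofactor by \<open>c ^ (n - 1)\<close>. As this moves the nodes, the argument goes through
  \<open>nondeg_iff\<close>.\<close>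

lemma nondeg_scale:
  fixes A :: "'k::field_char_0 ^ 'n::finite ^ 'n"
  assumes "nondeg A \<noteq> 0" "c \<noteq> 0"
  shows "nondeg (\<chi> i j. c * A $ i $ j) \<noteq> 0"
proof -
  let ?d = "\<lambda>i :: 'n. if i = last_row then 1 else c"
  have rc: "row_cofactor (\<chi> i j. c * A $ i $ j) (c * x) j = (\<Prod>i\<in>UNIV. ?d i) * row_cofactor A x j" for x j
  proof -
    have "with_row last_row (axis j 1) (mat (c * x) - (\<chi> i j. c * A $ i $ j))
        = (\<chi> i k. ?d i * with_row last_row (axis j 1) (mat x - A) $ i $ k)"
      by (auto simp: vec_eq_iff with_row_def mat_def right_diff_distrib)
    then show ?thesis unfolding row_cofactor_def by (simp only: det_scaled_entries)
  qed
  have "(\<Prod>i\<in>UNIV. ?d i) \<noteq> 0" using assms(2) by simp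
  then have eq: "(\<Sum>j\<in>UNIV. w $ j * row_cofactor (\<chi> i j. c * A $ i $ j) (c * x) j) = 0
      \<longleftrightarrow> (\<Sum>j\<in>UNIV. w $ j * row_cofactor A x j) = 0" for w x
    unfolding rc mult.left_commute[of _ "\<Prod>i\<in>UNIV. ?d i"] sum_distrib_left[symmetric] by simp
  show ?thesis
    unfolding nondeg_iff
  proof (intro allI impI)
    fix w :: "'k ^ 'n" assume "\<forall>x. (\<Sum>j\<in>UNIV. w $ j * row_cofactor (\<chi> i j. c * A $ i $ j) x j) = 0"
    then have "\<forall>x. (\<Sum>j\<in>UNIV. w $ j * row_cofactor A x j) = 0" using eq by blast
    with assms(1) show "w = 0" unfolding nondeg_iff by blast
  qed
qed

lemma polyfun_row_cofactor:
  fixes A :: "'k::field_char_0 \<Rightarrow> 'k ^ 'n::finite ^ 'n"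
  assumes "\<And>i j. polyfun (\<lambda>s. A s $ i $ j)"
  shows "polyfun (\<lambda>s. row_cofactor (A s) x k)"
proof -
  have "polyfun (\<lambda>s. with_row last_row (axis k 1) (mat x - A s) $ i $ j)" for i j
    by (cases "i = last_row") (auto simp: with_row_def intro: assms)
  then show ?thesis unfolding row_cofactor_def by (rule polyfun_det)
qed

lemma polyfun_nondeg:
  fixes A :: "'k::field_char_0 \<Rightarrow> 'k ^ 'n::finite ^ 'n"
  assumes "\<And>i j. polyfun (\<lambda>s. A s $ i $ j)"
  shows "polyfun (\<lambda>s. nondeg (A s))"
  unfolding nondeg_def cofactor_matrix_def
  by (rule polyfun_det) (simp add: polyfun_row_cofactor[OF assms])

section \<open>The linear system for the last row and its solution\<close>

definition row_rhs :: "(nat \<Rightarrow> int) \<Rightarrow> ('n::finite, 'k::field_char_0) point \<Rightarrow> 'k ^ 'n" where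
  "row_rhs l a = (\<chi> i. node i * row_cofactor (matrix_of a) (node i) last_row -
      poly (target_poly TYPE('n) l (a None)) (node i))"

text \<open>Cramer's rule without the division by \<open>nondeg\<close>.\<close>

definition row_numerator :: "(nat \<Rightarrow> int) \<Rightarrow> ('n::finite, 'k::field_char_0) point \<Rightarrow> 'n \<Rightarrow> 'k" where
  "row_numerator l a k = det (\<chi> i j. if j = k then row_rhs l a $ i else cofactor_matrix (matrix_of a) $ i $ j)"

text \<open>The point with its last row solved for, multiplied throughout by \<open>c\<close> times
  the determinant of the system. All coordinates are then polynomial in \<open>a\<close> and
  \<open>c\<close>, and \<open>c = 1 / nondeg\<close> undoes the scaling. Keeping \<open>c\<close>
  as an argument lets it vary along a curve.\<close>

definition complete_row :: "(nat \<Rightarrow> int) \<Rightarrow> 'k \<Rightarrow> ('n::finite, 'k::field_char_0) point \<Rightarrow> ('n, 'k) point" where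
  "complete_row l c a v = (case v of
      Some (i, j) \<Rightarrow> if i = last_row then c * row_numerator l a j else c * nondeg (matrix_of a) * a v
    | None \<Rightarrow> c * nondeg (matrix_of a) * a v)"

text \<open>Agreement of the two monic polynomials at the n nodes is enough, and expanding the
  determinant along the last row makes it a linear system for that row.\<close>

lemma in_cone_iff_row:
  fixes a :: "('n::finite, 'k::field_char_0) point"
  shows "in_cone l a \<longleftrightarrow> cofactor_matrix (matrix_of a) *v (matrix_of a $ last_row) = row_rhs l a"
proof -
  let ?A = "matrix_of a"
  have d: "det (mat (node i) - ?A) = node i * row_cofactor ?A (node i) last_row - (cofactor_matrix ?A *v (?A $ last_row)) $ i" for i
    unfolding det_expand_last_row by (simp add: matrix_vector_mult_def cofactor_matrix_def mult.commute)
  have "in_cone l a \<longleftrightarrow> (\<forall>i :: 'n. det (mat (node i) - ?A) = poly (target_poly TYPE('n) l (a None)) (node i))"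
  proof
    assume *: "\<forall>i :: 'n. det (mat (node i) - ?A) = poly (target_poly TYPE('n) l (a None)) (node i)"
    show "in_cone l a"
      unfolding in_cone_iff_charpoly
      by (rule monic_eq_on_nodes[where 'n='n])
        (use * in \<open>auto simp: degree_charpoly_le coeff_charpoly_top degree_target_poly_le coeff_target_poly_top poly_charpoly\<close>)
  qed (simp add: in_cone_def)
  also have "\<dots> \<longleftrightarrow> cofactor_matrix ?A *v (?A $ last_row) = row_rhs l a"
    unfolding d by (auto simp: vec_eq_iff row_rhs_def algebra_simps)
  finally show ?thesis .
qed

lemma in_cone_iff_row_numerator:
  assumes "nondeg (matrix_of a) \<noteq> 0"
  shows "in_cone l a \<longleftrightarrow> (\<forall>j. a (Some (last_row, j)) = row_numerator l a j / nondeg (matrix_of a))"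
  unfolding in_cone_iff_row using assms unfolding nondeg_def
  by (subst cramer) (auto simp: vec_eq_iff row_numerator_def matrix_of_def)

lemma complete_row_fixed:
  assumes "in_cone l a" "nondeg (matrix_of a) \<noteq> 0"
  shows "complete_row l (1 / nondeg (matrix_of a)) a = a"
proof
  fix v show "complete_row l (1 / nondeg (matrix_of a)) a v = a v"
    using assms(1) unfolding in_cone_iff_row_numerator[OF assms(2)]
    by (auto simp: complete_row_def assms(2) split: option.split)
qed

lemma complete_row_in_cone:
  assumes "c \<noteq> 0" "nondeg (matrix_of a) \<noteq> 0"
  shows "in_cone l (complete_row l c a)" "nondeg (matrix_of (complete_row l c a)) \<noteq> 0"
proof -
  let ?d = "nondeg (matrix_of a)"
  define b where "b v = (case v of Some (i, j) \<Rightarrow> if i = last_row then row_numerator l a j / ?d else a v | None \<Rightarrow> a v)" for v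
  have rows: "matrix_of b $ i = matrix_of a $ i" if "i \<noteq> last_row" for i
    using that by (simp add: matrix_of_def b_def vec_eq_iff)
  have None: "b None = a None" by (simp add: b_def)
  have d: "nondeg (matrix_of b) = ?d" by (rule nondeg_cong) (rule rows)
  have rc: "row_cofactor (matrix_of b) = row_cofactor (matrix_of a)"
    by (intro ext row_cofactor_cong rows)
  have num: "row_numerator l b j = row_numerator l a j" for j
    unfolding row_numerator_def row_rhs_def cofactor_matrix_def rc None ..
  have bc: "in_cone l b"
    using assms(2) by (subst in_cone_iff_row_numerator) (simp_all add: d num, simp add: b_def)
  have eq: "complete_row l c a = (\<lambda>v. (c * ?d) * b v)"
    using assms(2) by (auto simp: complete_row_def b_def fun_eq_iff split: option.split)
  show "in_cone l (complete_row l c a)"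
    unfolding eq using bc assms by (intro in_cone_scale) auto
  have "matrix_of (\<lambda>v. (c * ?d) * b v) = (\<chi> i j. (c * ?d) * matrix_of b $ i $ j)"
    by (simp add: matrix_of_def vec_eq_iff)
  then show "nondeg (matrix_of (complete_row l c a)) \<noteq> 0"
    unfolding eq using nondeg_scale[of "matrix_of b" "c * ?d"] assms d by (simp del: vec_lambda_beta)
qed

text \<open>A recursion along the superdiagonal shows that the cofactors are a common nonzero factor
  times monic polynomials of degrees 0, ..., n - 1, which are linearly independent.\<close>

lemma nondeg_superdiagonal:
  fixes A :: "'k::field_char_0 ^ 'n::finite ^ 'n"
  assumes rows: "\<And>i j. i \<noteq> last_row \<Longrightarrow> A $ i $ j = (if j = i then \<mu> i else if index_of j = Suc (index_of i) then 1 else 0)"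
  shows "nondeg A \<noteq> 0"
proof -
  define D where "D x k = row_cofactor A x (of_index k)" for x k
  define N where "N k = (\<Prod>i<k. [:- \<mu> (of_index i), 1:])" for k
  have rec: "D x (Suc k) = (x - \<mu> (of_index k)) * D x k" if k: "Suc k < CARD('n)" for x k
  proof -
    define i :: 'n where "i = of_index k"
    define i' :: 'n where "i' = of_index (Suc k)"
    have ik: "index_of i = k" "index_of i' = Suc k"
      using k by (auto simp: i_def i'_def index_of_of_index)
    have il: "i \<noteq> last_row" using ik(1) k index_of_last_row[where 'n='n] by auto
    have ii: "i \<noteq> i'" using ik by auto
    let ?B = "mat x - A"
    \<comment> \<open>Row \<open>i\<close> repeated in the last place gives determinant 0. Its
      expansion involves only the two nonzero entries of row \<open>i\<close> and so relates two
      consecutive cofactors.\<close>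
    have "det (with_row last_row (?B $ i) ?B) = 0"
      by (rule det_identical_rows[OF il]) (simp add: row_def with_row_def vec_eq_iff il)
    then have "0 = (\<Sum>j\<in>UNIV. ?B $ i $ j * row_cofactor A x j)"
      unfolding row_cofactor_def by (metis det_with_row)
    also have "\<dots> = (\<Sum>j\<in>{i, i'}. ?B $ i $ j * row_cofactor A x j)"
    proof (rule sum.mono_neutral_right)
      have "?B $ i $ j = 0" if "j \<noteq> i" "j \<noteq> i'" for j
        using that rows[OF il, of j] ik by (auto simp: mat_def simp flip: index_of_eq_iff)
      then show "\<forall>j\<in>UNIV - {i, i'}. ?B $ i $ j * row_cofactor A x j = 0" by auto
    qed auto
    also have "\<dots> = (x - \<mu> i) * D x k - D x (Suc k)"
      using ii rows[OF il, of i] rows[OF il, of i'] ik by (simp add: mat_def D_def i_def[symmetric] i'_def[symmetric])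
    finally show ?thesis by (simp add: i_def)
  qed
  have DN: "D x k = D x 0 * poly (N k) x" if "k < CARD('n)" for x k
    using that
  proof (induction k)
    case (Suc k)
    then show ?case using rec[of k x] by (simp add: N_def algebra_simps)
  qed (simp add: N_def)
  have degN: "Polynomial.degree (N k) = k" for k
    unfolding N_def by (subst degree_prod_eq_sum_degree) auto
  have "Polynomial.lead_coeff (N k) = 1" for k
    unfolding N_def by (subst lead_coeff_prod) simp
  then have topN: "poly.coeff (N k) k = 1" for k by (simp only: degN)
  \<comment> \<open>With last row 0 the characteristic polynomial is x times the last cofactor. As
    it is monic, that cofactor is nonzero somewhere, and with it the common factor
    \<open>D x 0\<close>.\<close>
  define A0 where "A0 = with_row last_row 0 A"
  have A0: "row_cofactor A0 x j = row_cofactor A x j" for x j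
    by (rule row_cofactor_cong) (simp add: A0_def with_row_def)
  have "charpoly A0 \<noteq> 0" using coeff_charpoly_top[of A0] by auto
  then obtain x0 where "poly (charpoly A0) x0 \<noteq> 0" by (rule exists_nonroot)
  then have "row_cofactor A x0 last_row \<noteq> 0"
    by (auto simp: poly_charpoly det_expand_last_row A0) (simp add: A0_def with_row_def)
  then have D0: "D x0 0 \<noteq> 0"
    using DN[of "index_of (last_row :: 'n)" x0] index_of_less[of "last_row :: 'n"] by (auto simp: D_def)
  have pD: "polyfun (\<lambda>x. D x 0)"
  proof -
    have "polyfun (\<lambda>x. with_row last_row (axis k 1) (mat x - A) $ i $ j)" for i j k
      by (cases "i = last_row"; cases "i = j") (auto simp: with_row_def mat_def)
    then show ?thesis unfolding D_def row_cofactor_def by (rule polyfun_det)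
  qed
  show ?thesis
    unfolding nondeg_iff
  proof (intro allI impI)
    fix w :: "'k ^ 'n" assume w: "\<forall>x. (\<Sum>j\<in>UNIV. w $ j * row_cofactor A x j) = 0"
    define q where "q = (\<Sum>j\<in>UNIV. Polynomial.smult (w $ j) (N (index_of j)))"
    have q: "D x 0 * poly q x = 0" for x
    proof -
      have rc: "row_cofactor A x j = D x 0 * poly (N (index_of j)) x" for j
        using DN[OF index_of_less[of j], of x] by (simp add: D_def)
      have "D x 0 * poly q x = (\<Sum>j\<in>UNIV. w $ j * row_cofactor A x j)"
        unfolding rc by (simp add: q_def poly_sum sum_distrib_left mult_ac)
      with w show ?thesis by simp
    qed
    have "poly q x = 0" for x
      by (rule polyfun_eqI[OF _ pD D0]) (use q in \<open>auto simp: polyfun_def\<close>)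
    then have q0: "q = 0" using poly_all_0_iff_0 by blast
    show "w = 0"
    proof (rule ccontr)
      assume "w \<noteq> 0"
      then have ne: "{j. w $ j \<noteq> 0} \<noteq> {}" by (auto simp: vec_eq_iff)
      \<comment> \<open>The largest index with a nonzero coefficient determines the leading term of
        \<open>q\<close>, since \<open>N i\<close> has degree \<open>i\<close>.\<close>
      define k where "k = Max (index_of ` {j. w $ j \<noteq> 0})"
      have "k \<in> index_of ` {j. w $ j \<noteq> 0}" unfolding k_def using ne by (intro Max_in) auto
      then obtain j where j: "w $ j \<noteq> 0" "k = index_of j" by blast
      have le: "index_of i \<le> k" if "w $ i \<noteq> 0" for i unfolding k_def using that by (intro Max_ge) auto
      have "0 = poly.coeff q k" using q0 by simp
      also have "\<dots> = (\<Sum>i\<in>UNIV. w $ i * poly.coeff (N (index_of i)) k)" by (simp add: q_def coeff_sum)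
      also have "\<dots> = (\<Sum>i\<in>{j}. w $ i * poly.coeff (N (index_of i)) k)"
      proof (rule sum.mono_neutral_right)
        have "w $ i * poly.coeff (N (index_of i)) k = 0" if "i \<noteq> j" for i
        proof (cases "w $ i = 0")
          case False
          then have "index_of i < k" using le[OF False] that j(2) by (metis index_of_eq_iff le_neq_implies_less)
          then show ?thesis by (simp add: coeff_eq_0 degN)
        qed auto
        then show "\<forall>i\<in>UNIV - {j}. w $ i * poly.coeff (N (index_of i)) k = 0" by blast
      qed auto
      also have "\<dots> = w $ j" using topN[of k] j by simp
      finally show False using j by simp
    qed
  qed
qed

section \<open>Irreducible subcones\<close>

lemma polyfun_complete_row:
  fixes a :: "'k::field_char_0 \<Rightarrow> ('n::finite, 'k) point"
  assumes a: "\<And>v. polyfun (\<lambda>s. a s v)" and c: "polyfun c"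
  shows "polyfun (\<lambda>s. complete_row l (c s) (a s) v)"
proof -
  have m: "polyfun (\<lambda>s. matrix_of (a s) $ i $ j)" for i j
    by (simp add: matrix_of_def a)
  note rc = polyfun_row_cofactor[of "\<lambda>s. matrix_of (a s)", OF m]
  have rr: "polyfun (\<lambda>s. row_rhs l (a s) $ i)" for i
    unfolding row_rhs_def poly_target_poly
    by (simp, intro polyfun_diff polyfun_mult polyfun_const rc polyfun_add polyfun_sum polyfun_power a)
  have cm: "polyfun (\<lambda>s. cofactor_matrix (matrix_of (a s)) $ i $ j)" for i j
    by (simp add: cofactor_matrix_def rc)
  have "polyfun (\<lambda>s. row_numerator l (a s) j)" for j
    unfolding row_numerator_def by (rule polyfun_det) (auto intro: rr cm)
  moreover have "polyfun (\<lambda>s. nondeg (matrix_of (a s)))" by (rule polyfun_nondeg[OF m])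
  ultimately show ?thesis
    by (cases v) (auto simp: complete_row_def split: prod.split intro!: polyfun_mult c a)
qed

text \<open>The conditions are linear and homogeneous in (A, z), so a slice is stable under nonzero
  scaling and its vanishing ideal is homogeneous. For \<open>S\<close> outside the last row they
  involve only free coordinates.\<close>

definition slice :: "(nat \<Rightarrow> int) \<Rightarrow> ('n \<times> 'n \<Rightarrow> 'k) \<Rightarrow> ('n \<times> 'n) set \<Rightarrow> ('n::finite, 'k::field_char_0) point set" where
  "slice l t S = {a. in_cone l a \<and> nondeg (matrix_of a) \<noteq> 0 \<and> (\<forall>s\<in>S. a (Some s) = a None * t s)}"

definition vanishing_ideal :: "('v::finite \<Rightarrow> 'k::comm_ring_1) set \<Rightarrow> ('v, 'k) mpoly set" where
  "vanishing_ideal Y = {f. \<forall>a\<in>Y. meval a f = 0}"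

lemma complete_row_in_slice:
  assumes "c \<noteq> 0" "nondeg (matrix_of a) \<noteq> 0" "\<And>s. s \<in> S \<Longrightarrow> fst s \<noteq> last_row" "\<And>s. s \<in> S \<Longrightarrow> a (Some s) = a None * t s"
  shows "complete_row l c a \<in> slice l t S"
proof -
  have "complete_row l c a (Some s) = complete_row l c a None * t s" if "s \<in> S" for s
    using assms(3,4)[OF that] by (cases s) (simp add: complete_row_def)
  then show ?thesis using complete_row_in_cone[OF assms(1,2)] by (auto simp: slice_def)
qed

text \<open>Two points of the slice are joined by the segment between their free coordinates,
  completed at each parameter by a last row. On this curve \<open>f\<close> is nonzero at one end
  and \<open>g\<close> at the other, so both are nonzero at some point of the slice.\<close>

lemma prime_vanishing_ideal_slice:
  assumes ne: "slice l t S \<noteq> {}" and S: "\<And>s. s \<in> S \<Longrightarrow> fst s \<noteq> last_row"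
  shows "prime_set (vanishing_ideal (slice l t S))"
proof
  let ?Q = "vanishing_ideal (slice l t S)"
  show "1 \<notin> ?Q" using ne by (auto simp: vanishing_ideal_def)
  show "f \<in> ?Q \<or> g \<in> ?Q" if fg: "f * g \<in> ?Q" for f g
  proof (rule ccontr)
    assume "\<not> (f \<in> ?Q \<or> g \<in> ?Q)"
    then obtain a b where a: "a \<in> slice l t S" "meval a f \<noteq> 0" and b: "b \<in> slice l t S" "meval b g \<noteq> 0"
      by (auto simp: vanishing_ideal_def)
    let ?na = "nondeg (matrix_of a)" and ?nb = "nondeg (matrix_of b)"
    have n0: "?na \<noteq> 0" "?nb \<noteq> 0" using a b by (auto simp: slice_def)
    define h where "h s v = a v + s * (b v - a v)" for s v
    \<comment> \<open>Interpolates between the scalings that make the completion reproduce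
      \<open>a\<close> at 0 and \<open>b\<close> at 1.\<close>
    define c where "c s = (1 - s) * (1 / ?na) + s * (1 / ?nb)" for s
    define p where "p s = complete_row l (c s) (h s)" for s
    have h: "polyfun (\<lambda>s. h s v)" for v unfolding h_def by (intro polyfun_add polyfun_mult polyfun_diff polyfun_const polyfun_id)
    have c: "polyfun c" unfolding c_def[abs_def] by (intro polyfun_add polyfun_mult polyfun_diff polyfun_const polyfun_id)
    have p: "polyfun (\<lambda>s. p s v)" for v unfolding p_def by (rule polyfun_complete_row[OF h c])
    have h01: "h 0 = a" "h 1 = b" by (auto simp: h_def)
    have p01: "p 0 = a" "p 1 = b"
      using complete_row_fixed[of l a] complete_row_fixed[of l b] a b by (auto simp: p_def h01 c_def slice_def)
    \<comment> \<open>\<open>k s \<noteq> 0\<close> is what keeps the completed point inside the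
      slice; at 0 its value is 1.\<close>
    define k where "k s = c s * nondeg (matrix_of (h s))" for s
    have k: "polyfun k" unfolding k_def[abs_def]
      by (intro polyfun_mult c polyfun_nondeg) (simp add: matrix_of_def h)
    have "k 0 \<noteq> 0" using n0 by (simp add: k_def h01 c_def)
    obtain u where u: "k u * meval (p u) f \<noteq> 0" "meval (p u) g \<noteq> 0"
    proof (rule polyfun_common_nonzero)
      show "polyfun (\<lambda>s. k s * meval (p s) f)" "polyfun (\<lambda>s. meval (p s) g)"
        by (intro polyfun_mult polyfun_meval k p)+
      show "k 0 * meval (p 0) f \<noteq> 0" using \<open>k 0 \<noteq> 0\<close> a(2) p01 by simp
      show "meval (p 1) g \<noteq> 0" using b(2) p01 by simp
    qed
    have "p u \<in> slice l t S"
      unfolding p_def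
    proof (rule complete_row_in_slice)
      show "c u \<noteq> 0" "nondeg (matrix_of (h u)) \<noteq> 0" using u by (auto simp: k_def)
      show "h u (Some s) = h u None * t s" if "s \<in> S" for s
        using a(1) b(1) that by (simp add: slice_def h_def algebra_simps)
    qed (rule S)
    with fg u show False by (auto simp: vanishing_ideal_def meval_mult)
  qed
qed (auto simp: vanishing_ideal_def meval_simps)

lemma meval_scale:
  fixes a :: "'v::finite \<Rightarrow> 'k::comm_ring_1"
  shows "meval (\<lambda>v. c * a v) f = (\<Sum>m\<in>Poly_Mapping.keys f. Poly_Mapping.lookup f m * monomial_value a m * c ^ monomial_degree m)"
proof -
  have "(\<Prod>v\<in>UNIV. c ^ Poly_Mapping.lookup m v) = c ^ monomial_degree m" for m :: "'v \<Rightarrow>\<^sub>0 nat"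
  proof -
    have "monomial_degree m = (\<Sum>v\<in>UNIV. Poly_Mapping.lookup m v)"
      unfolding monomial_degree_def by (rule sum.mono_neutral_left) (auto simp: in_keys_iff)
    then show ?thesis by (simp add: power_sum)
  qed
  then show ?thesis by (simp add: meval_def monomial_value_def power_mult_distrib prod.distrib mult_ac)
qed

text \<open>On the line through a point \<open>a\<close> of the cone, \<open>f\<close> is a
  polynomial in the scalar whose coefficients are the values at \<open>a\<close> of the homogeneous
  components. It vanishes at all nonzero scalars, hence identically.\<close>

lemma homogeneous_component_vanishing:
  fixes Y :: "('v::finite \<Rightarrow> 'k::field_char_0) set"
  assumes cone: "\<And>a c. a \<in> Y \<Longrightarrow> c \<noteq> 0 \<Longrightarrow> (\<lambda>v. c * a v) \<in> Y" and f: "f \<in> vanishing_ideal Y"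
  shows "homogeneous_component d f \<in> vanishing_ideal Y"
  unfolding vanishing_ideal_def
proof (intro CollectI ballI)
  fix a assume a: "a \<in> Y"
  define p where "p = (\<Sum>m\<in>Poly_Mapping.keys f. Polynomial.monom (Poly_Mapping.lookup f m * monomial_value a m) (monomial_degree m))"
  have pc: "poly p c = meval (\<lambda>v. c * a v) f" for c
    by (simp add: p_def poly_sum poly_monom meval_scale)
  have "poly p c = 0" for c
  proof (rule polyfun_eqI[where f="poly p" and g="\<lambda>s. s" and t=1])
    show "polyfun (poly p)" unfolding polyfun_def by blast
    show "polyfun (\<lambda>s. s :: 'k)" "(1 :: 'k) \<noteq> 0" by simp_all
    show "poly p s = 0" if "s \<noteq> 0" for s
      using cone[OF a that] f by (simp add: pc vanishing_ideal_def)
  qed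
  then have "p = 0" using poly_all_0_iff_0 by blast
  then have "0 = poly.coeff p d" by simp
  also have "\<dots> = (\<Sum>m\<in>Poly_Mapping.keys f. if monomial_degree m = d then Poly_Mapping.lookup f m * monomial_value a m else 0)"
    by (simp add: p_def coeff_sum)
  also have "\<dots> = meval a (homogeneous_component d f)"
    by (subst sum.inter_filter[symmetric]) (simp_all add: homogeneous_component_def meval_sum meval_single)
  finally show "meval a (homogeneous_component d f) = 0" ..
qed

section \<open>Triangularization\<close>

text \<open>The vector q(A) w, computed by Horner's scheme.\<close>

definition apply_poly :: "'k::field ^ 'n ^ 'n \<Rightarrow> 'k poly \<Rightarrow> 'k ^ 'n \<Rightarrow> 'k ^ 'n" where
  "apply_poly A q w = fold_coeffs (\<lambda>a b. a *s w + A *v b) q 0"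

lemma apply_poly_0 [simp]: "apply_poly A 0 w = 0"
  by (simp add: apply_poly_def)

lemma apply_poly_pCons [simp]: "apply_poly A (pCons a q) w = a *s w + A *v apply_poly A q w"
  by (cases "q = 0"; cases "a = 0") (simp_all add: apply_poly_def)

lemma apply_poly_add: "apply_poly A (p + q) w = apply_poly A p w + apply_poly A q w"
  by (induction p q rule: poly_induct2) (simp_all add: vec.add vec.scale_left_distrib algebra_simps)

lemma apply_poly_smult: "apply_poly A (Polynomial.smult c q) w = c *s apply_poly A q w"
  by (induction q) (simp_all add: vec.scale vec.scale_right_distrib)

lemma apply_poly_sum: "apply_poly A (\<Sum>i\<in>I. q i) w = (\<Sum>i\<in>I. apply_poly A (q i) w)"
  by (induction I rule: infinite_finite_induct) (simp_all add: apply_poly_add)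

lemma apply_poly_monom: "apply_poly A (Polynomial.monom c i) w = c *s (((*v) A) ^^ i) w"
proof (induction i)
  case 0
  then show ?case by (simp add: monom_0)
next
  case (Suc i)
  then show ?case by (simp add: monom_Suc vec.scale)
qed

lemma annihilating_poly:
  fixes A :: "'k::field ^ 'n ^ 'n"
  obtains q where "q \<noteq> 0" "apply_poly A q u = 0"
proof -
  \<comment> \<open>With the zero ideal of a field, \<open>linear_dependence\<close> is the usual
    statement about vectors; here it is applied to the n + 1 vectors u, A u, ..., A^n u.\<close>
  interpret prime_set "{0 :: 'k}" by unfold_locales auto
  obtain c where c: "\<exists>i\<in>{..CARD('n)}. c i \<notin> {0 :: 'k}" "\<forall>j\<in>UNIV. (\<Sum>i\<in>{..CARD('n)}. c i * ((((*v) A) ^^ i) u) $ j) \<in> {0}"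
    using linear_dependence[of UNIV "UNIV :: 'n set" "{..CARD('n)}" "\<lambda>i j. ((((*v) A) ^^ i) u) $ j"] by auto
  define q where "q = (\<Sum>i\<le>CARD('n). Polynomial.monom (c i) i)"
  obtain i where i: "i \<le> CARD('n)" "c i \<noteq> 0" using c(1) by auto
  have "poly.coeff q i = c i" using i(1) by (simp add: q_def coeff_sum)
  then have "q \<noteq> 0" using i(2) by auto
  moreover have "apply_poly A q u = 0"
    using c(2) by (simp add: q_def apply_poly_sum apply_poly_monom vec_eq_iff)
  ultimately show thesis by (rule that)
qed

text \<open>Split a root \<open>c\<close> off a polynomial \<open>q\<close> with q(A) u in
  \<open>W\<close>, say q = (x - c) p. Either p(A) u lies outside \<open>W\<close> and is the wanted
  vector, or \<open>p\<close> replaces \<open>q\<close>; the descent ends because \<open>u\<close>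
  itself is outside \<open>W\<close>.\<close>

lemma eigenvector_modulo_subspace:
  fixes A :: "'k::alg_closed_field ^ 'n ^ 'n"
  assumes W: "vec.subspace W" and u: "u \<notin> W"
  obtains w c where "w \<notin> W" "A *v w - c *s w \<in> W"
proof -
  have "\<exists>w c. w \<notin> W \<and> A *v w - c *s w \<in> W" if "q \<noteq> 0" "apply_poly A q u \<in> W" for q
    using that
  proof (induction "Polynomial.degree q" arbitrary: q rule: less_induct)
    case less
    show ?case
    proof (cases "Polynomial.degree q = 0")
      case True
      then obtain c where c: "q = [:c:]" by (auto elim: degree_eq_zeroE)
      then have "c \<noteq> 0" "c *s u \<in> W" using less.prems by auto
      then have "(1 / c) *s (c *s u) \<in> W" using vec.subspace_scale[OF W] by blast
      with \<open>c \<noteq> 0\<close> u show ?thesis by simp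
    next
      case False
      then obtain c where "poly q c = 0" using alg_closed_imp_poly_has_root by blast
      then obtain p where p: "q = [:-c, 1:] * p" by (auto simp: poly_eq_0_iff_dvd)
      have p0: "p \<noteq> 0" using less.prems(1) p by auto
      have d: "Polynomial.degree p < Polynomial.degree q" unfolding p using p0 by (subst degree_mult_eq) auto
      have "q = pCons 0 p + Polynomial.smult (- c) p" unfolding p by simp
      then have "apply_poly A q u = A *v apply_poly A p u - c *s apply_poly A p u"
        by (simp only: apply_poly_add apply_poly_smult apply_poly_pCons) simp
      then show ?thesis
        using less.hyps[OF d p0] less.prems(2) by (cases "apply_poly A p u \<in> W") auto
    qed
  qed
  with annihilating_poly[of A u] vec.subspace_0[OF W] that show thesis by metis
qed

lemma span_image_lessThan:
  fixes v :: "nat \<Rightarrow> 'k::field ^ 'n"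
  assumes "x \<in> vec.span (v ` {..<k})"
  shows "\<exists>c. x = (\<Sum>i<k. c i *s v i)"
  using assms
proof (induction k arbitrary: x)
  case (Suc k)
  have "v ` {..<Suc k} = insert (v k) (v ` {..<k})" by (auto simp: lessThan_Suc)
  then obtain b where "x - b *s v k \<in> vec.span (v ` {..<k})"
    using Suc.prems vec.span_breakdown_eq by metis
  then obtain c where c: "x - b *s v k = (\<Sum>i<k. c i *s v i)" using Suc.IH by blast
  have "x = (\<Sum>i<Suc k. (c(k := b)) i *s v i)"
  proof -
    have "(\<Sum>i<k. (c(k := b)) i *s v i) = (\<Sum>i<k. c i *s v i)" by (intro sum.cong) auto
    with c show ?thesis by (simp add: algebra_simps)
  qed
  then show ?case by blast
qed auto

text \<open>Each new vector is an eigenvector modulo the span of the earlier ones, which is a proper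
  subspace as long as there are fewer than n of them.\<close>

lemma triangular_flag:
  fixes A :: "'k::alg_closed_field ^ 'n ^ 'n"
  assumes "k \<le> CARD('n)"
  shows "\<exists>v. \<forall>j<k. v j \<notin> vec.span (v ` {..<j}) \<and> A *v v j \<in> vec.span (v ` {..<Suc j})"
  using assms
proof (induction k)
  case (Suc k)
  then obtain v where v: "\<And>j. j < k \<Longrightarrow> v j \<notin> vec.span (v ` {..<j})"
    "\<And>j. j < k \<Longrightarrow> A *v v j \<in> vec.span (v ` {..<Suc j})" by auto
  let ?W = "vec.span (v ` {..<k})"
  have "vec.dim ?W \<le> card (v ` {..<k})" by (simp add: vec.dim_le_card vec.span_superset)
  also have "\<dots> \<le> k" using card_image_le[of "{..<k}" v] by simp
  also have "\<dots> < vec.dim (UNIV :: ('k ^ 'n) set)" unfolding vec_dim_card using Suc.prems by simp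
  finally have lt: "vec.dim ?W < vec.dim (UNIV :: ('k ^ 'n) set)" .
  have "?W \<noteq> UNIV"
  proof
    assume "?W = UNIV"
    from lt[unfolded this] show False by (rule less_irrefl[THEN notE])
  qed
  then obtain u where "u \<notin> ?W" by blast
  then obtain w c where w: "w \<notin> ?W" "A *v w - c *s w \<in> ?W"
    using eigenvector_modulo_subspace[OF vec.subspace_span] by metis
  define v' where "v' = v(k := w)"
  have im: "v' ` {..<j} = v ` {..<j}" if "j \<le> k" for j using that by (auto simp: v'_def)
  have "v' j \<notin> vec.span (v' ` {..<j}) \<and> A *v v' j \<in> vec.span (v' ` {..<Suc j})" if "j < Suc k" for j
  proof (cases "j = k")
    case True
    have sub: "?W \<subseteq> vec.span (v' ` {..<Suc k})"
      unfolding im[OF order_refl, symmetric] by (intro vec.span_mono) auto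
    have "w \<in> v' ` {..<Suc k}" unfolding v'_def by (intro image_eqI[of _ _ k]) auto
    then have "c *s w \<in> vec.span (v' ` {..<Suc k})" by (intro vec.span_scale vec.span_base)
    then have "(A *v w - c *s w) + c *s w \<in> vec.span (v' ` {..<Suc k})"
      using w(2) sub by (intro vec.span_add) auto
    with True w(1) im[of k] show ?thesis by (simp add: v'_def)
  next
    case False
    with that have "j < k" by simp
    with v im[of j] im[of "Suc j"] show ?thesis by (simp add: v'_def)
  qed
  then show ?case by blast
qed auto

definition upper_tri :: "'k::zero ^ 'n::finite ^ 'n \<Rightarrow> bool" where
  "upper_tri t \<longleftrightarrow> (\<forall>i j. index_of j < index_of i \<longrightarrow> t $ i $ j = 0)"

lemma sum_index_of: "(\<Sum>i\<in>UNIV. f (index_of (i :: 'n::finite))) = (\<Sum>k<CARD('n). f k)"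
  using sum.reindex_bij_betw[OF bij_index_of[where 'n='n], of f] by (simp add: lessThan_atLeast0)

text \<open>The columns of \<open>g\<close> are the vectors of a flag stable under \<open>A\<close>,
  and \<open>t\<close> collects the coordinates of their images.\<close>

theorem triangularization:
  fixes A :: "'k::alg_closed_field ^ 'n::finite ^ 'n"
  obtains g t where "det g \<noteq> 0" "upper_tri t" "A ** g = g ** t"
proof -
  obtain v where v: "\<And>j. j < CARD('n) \<Longrightarrow> v j \<notin> vec.span (v ` {..<j})"
    "\<And>j. j < CARD('n) \<Longrightarrow> A *v v j \<in> vec.span (v ` {..<Suc j})"
    using triangular_flag[of "CARD('n)" A] by blast
  have "\<forall>j. \<exists>c. j < CARD('n) \<longrightarrow> A *v v j = (\<Sum>i<Suc j. c i *s v i)"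
    using v(2) span_image_lessThan by blast
  then obtain c where c: "\<And>j. j < CARD('n) \<Longrightarrow> A *v v j = (\<Sum>i<Suc j. c j i *s v i)" by metis
  define g :: "'k ^ 'n ^ 'n" where "g = (\<chi> i j. v (index_of j) $ i)"
  define t :: "'k ^ 'n ^ 'n" where "t = (\<chi> i j. if index_of i \<le> index_of j then c (index_of j) (index_of i) else 0)"
  have gw: "g *v w = (\<Sum>i\<in>UNIV. w $ i *s v (index_of i))" for w
    by (simp add: vec_eq_iff matrix_vector_mult_def g_def mult.commute)
  have "w = 0" if gw0: "g *v w = 0" for w
  proof (rule ccontr)
    assume "w \<noteq> 0"
    then have ne: "{j. w $ j \<noteq> 0} \<noteq> {}" by (auto simp: vec_eq_iff)
    define k where "k = Max (index_of ` {j. w $ j \<noteq> 0})"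
    have "k \<in> index_of ` {j. w $ j \<noteq> 0}" unfolding k_def using ne by (intro Max_in) auto
    then obtain j where j: "w $ j \<noteq> 0" "k = index_of j" by blast
    have le: "index_of i \<le> k" if "w $ i \<noteq> 0" for i unfolding k_def using that by (intro Max_ge) auto
    let ?S = "vec.span (v ` {..<k})"
    have "(\<Sum>i\<in>UNIV - {j}. w $ i *s v (index_of i)) \<in> ?S"
    proof (rule vec.span_sum)
      fix i assume i: "i \<in> UNIV - {j}"
      show "w $ i *s v (index_of i) \<in> ?S"
      proof (cases "w $ i = 0")
        case True
        then show ?thesis by (simp add: vec.span_zero)
      next
        case False
        then have "index_of i < k" using le[OF False] i j(2) by (metis DiffD2 index_of_eq_iff le_neq_implies_less singletonI)
        then show ?thesis by (intro vec.span_scale vec.span_base) auto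
      qed
    qed
    then have "- (\<Sum>i\<in>UNIV - {j}. w $ i *s v (index_of i)) \<in> ?S" by (rule vec.span_neg)
    moreover have "w $ j *s v k + (\<Sum>i\<in>UNIV - {j}. w $ i *s v (index_of i)) = 0"
      using gw0 unfolding gw j(2) by (subst (asm) sum.remove[of UNIV j]) auto
    ultimately have "w $ j *s v k \<in> ?S" by (simp add: eq_neg_iff_add_eq_0[symmetric])
    then have "(1 / w $ j) *s (w $ j *s v k) \<in> ?S" by (rule vec.span_scale)
    then have "v k \<in> ?S" using j(1) by simp
    with v(1)[of k] j(2) index_of_less[of j] show False by simp
  qed
  then have "\<exists>B. B ** g = mat 1" by (simp add: matrix_left_invertible_ker)
  then have "det g \<noteq> 0" by (simp add: invertible_det_nz[symmetric] invertible_left_inverse)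
  moreover have "upper_tri t" by (simp add: upper_tri_def t_def)
  moreover have "A ** g = g ** t"
  proof -
    have "(A ** g) $ i $ j = (g ** t) $ i $ j" for i j
    proof -
      let ?k = "index_of j"
      have "(A ** g) $ i $ j = (A *v v ?k) $ i"
        by (simp add: matrix_matrix_mult_def matrix_vector_mult_def g_def)
      also have "\<dots> = (\<Sum>m<Suc ?k. c ?k m * v m $ i)" by (simp add: c[OF index_of_less] del: sum.lessThan_Suc)
      also have "\<dots> = (\<Sum>m<CARD('n). if m \<le> ?k then c ?k m * v m $ i else 0)"
        using index_of_less[of j] by (intro sum.mono_neutral_cong_left) (auto simp: less_Suc_eq_le)
      also have "\<dots> = (\<Sum>h\<in>UNIV. if index_of (h :: 'n) \<le> ?k then c ?k (index_of h) * v (index_of h) $ i else 0)"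
        by (rule sum_index_of[symmetric])
      also have "\<dots> = (g ** t) $ i $ j"
        unfolding matrix_matrix_mult_def g_def t_def by (simp, intro sum.cong) (auto simp: mult.commute)
      finally show ?thesis .
    qed
    then show ?thesis by (simp add: vec_eq_iff)
  qed
  ultimately show thesis by (rule that)
qed

text \<open>A permutation with a nonzero term never lowers an index; the sum of the indices is
  preserved, so it fixes every index.\<close>

lemma det_upper_tri:
  fixes B :: "'k::comm_ring_1 ^ 'n::finite ^ 'n"
  assumes "upper_tri B"
  shows "det B = (\<Prod>i\<in>UNIV. B $ i $ i)"
proof -
  have "of_int (sign p) * (\<Prod>i\<in>UNIV. B $ i $ p i) = 0" if p: "p permutes UNIV" "p \<noteq> id" for p
  proof -
    have "\<exists>i. index_of (p i) < index_of i"
    proof (rule ccontr)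
      assume "\<not> ?thesis"
      then have le: "index_of i \<le> index_of (p i)" for i by (simp add: not_less)
      have "(\<Sum>i\<in>UNIV. index_of (p i)) = (\<Sum>i\<in>UNIV. index_of (i :: 'n))"
        using sum.permute[OF p(1), of index_of, symmetric] by (simp only: o_def)
      then have "index_of (p i) = index_of i" for i
        using sum_mono_inv[of index_of UNIV "\<lambda>i. index_of (p i)" i] le by simp
      then have "p = id" by (auto simp: fun_eq_iff)
      with p(2) show False by blast
    qed
    then obtain i where "index_of (p i) < index_of i" by blast
    then have "B $ i $ p i = 0" using assms by (simp add: upper_tri_def)
    then have "(\<Prod>i\<in>UNIV. B $ i $ p i) = 0" by (intro prod_zero) auto
    then show ?thesis by simp
  qed
  then have "det B = (\<Sum>p\<in>{id}. of_int (sign p) * (\<Prod>i\<in>UNIV. B $ i $ p i))"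
    unfolding det_def by (intro sum.mono_neutral_right) (auto simp: permutes_id)
  then show ?thesis by (simp add: sign_id)
qed

section \<open>Every point of the cone is a limit of nondegenerate ones\<close>

text \<open>The adjugate, written by Cramer's rule: \<open>det G\<close> times the inverse, but
  polynomial in the entries and defined for singular \<open>G\<close> as well.\<close>

definition adjoint_matrix :: "'k::field ^ 'n::finite ^ 'n \<Rightarrow> 'k ^ 'n ^ 'n" where
  "adjoint_matrix G = (\<chi> i j. det (\<chi> k m. if m = i then mat 1 $ k $ j else G $ k $ m))"

lemma adjoint_matrix:
  fixes G :: "'k::field ^ 'n::finite ^ 'n"
  assumes "det G \<noteq> 0"
  shows "G ** (\<chi> i j. adjoint_matrix G $ i $ j / det G) = mat 1"
    and "(\<chi> i j. adjoint_matrix G $ i $ j / det G) ** G = mat 1"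
proof -
  let ?H = "\<chi> i j. adjoint_matrix G $ i $ j / det G"
  have c: "G *v (\<chi> i. ?H $ i $ j) = (\<chi> k. mat 1 $ k $ j)" for j
    unfolding cramer[OF assms] by (simp add: vec_eq_iff adjoint_matrix_def cong: if_cong)
  have "(G ** ?H) $ i $ j = mat 1 $ i $ j" for i j
    using arg_cong[OF c[of j], of "\<lambda>v. v $ i"] by (simp add: matrix_vector_mult_def matrix_matrix_mult_def)
  then show "G ** ?H = mat 1" by (simp add: vec_eq_iff)
  then show "?H ** G = mat 1" by (simp add: matrix_left_right_inverse)
qed

lemma mat_diff_mult:
  fixes N G T :: "'k::field ^ 'n::finite ^ 'n"
  assumes "N ** G = G ** T" "det G \<noteq> 0"
  shows "det (mat x - N) = det (mat x - T)"
proof -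
  have "(mat x - N) ** G = G ** (mat x - T)"
  proof -
    have "(mat x ** G) $ i $ j = (G ** mat x) $ i $ j" for i j
      by (simp add: matrix_matrix_mult_def mat_def if_distrib if_distribR cong: if_cong)
    then have "mat x ** G = G ** mat x" by (simp add: vec_eq_iff)
    moreover have "(B - C) ** D = B ** D - C ** D" "D ** (B - C) = D ** B - D ** C" for B C D :: "'k ^ 'n ^ 'n"
      by (simp_all add: vec_eq_iff matrix_matrix_mult_def left_diff_distrib right_diff_distrib sum_subtractf)
    ultimately show ?thesis using assms(1) by simp
  qed
  then have "det (mat x - N) * det G = det G * det (mat x - T)" by (metis det_mul)
  with assms(2) show ?thesis by simp
qed

text \<open>A polynomial curve starts at \<open>a\<close> and ends at a nondegenerate point. If
  \<open>f\<close> were nonzero at \<open>a\<close>, some parameter would give a nondegenerate point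
  of the cone with \<open>f\<close> nonzero.\<close>

theorem vanishing_on_slice_imp_vanishing_on_cone:
  fixes a :: "('n::finite, 'k::{alg_closed_field, field_char_0}) point"
  assumes f: "f \<in> vanishing_ideal (slice l r {})" and a: "in_cone l a"
  shows "meval a f = 0"
proof (rule ccontr)
  assume fa: "meval a f \<noteq> 0"
  let ?A = "matrix_of a"
  obtain g t where g: "det g \<noteq> 0" "upper_tri t" "?A ** g = g ** t" by (rule triangularization)
  define e where "e i j = (if index_of j = Suc (index_of i) then 1 else 0 :: 'k)" for i j :: 'n
  \<comment> \<open>The diagonal of \<open>t\<close> stays fixed, so all \<open>T s\<close> have the
    characteristic polynomial of \<open>t\<close>, while the strictly upper part moves to the shift
    matrix.\<close>
  define T where "T s = (\<chi> i j. if i = j then t $ i $ i else if index_of i < index_of j then t $ i $ j + s * (e i j - t $ i $ j) else 0)" for s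
  define G where "G s = (\<chi> i j. g $ i $ j + s * (mat 1 $ i $ j - g $ i $ j))" for s
  \<comment> \<open>\<open>k 0 * det g = 1\<close> and \<open>k 1 = 1\<close>, so that the curve
    starts exactly at \<open>a\<close> and ends at \<open>T 1\<close>.\<close>
  define k where "k s = (1 - s) * (1 / det g) + s" for s
  \<comment> \<open>The adjugate in place of the inverse multiplies the conjugated matrix by
    \<open>det (G s)\<close>. Giving \<open>z\<close> the same factor makes this a scalar multiple
    of a point of the cone whenever \<open>G s\<close> is invertible.\<close>
  define p where "p s v = k s * (case v of Some (i, j) \<Rightarrow> (G s ** T s ** adjoint_matrix (G s)) $ i $ j | None \<Rightarrow> det (G s) * a None)" for s v
  note I = polyfun_add polyfun_mult polyfun_diff polyfun_const polyfun_id polyfun_sum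
  have pk: "polyfun k" unfolding k_def[abs_def] by (intro I)
  have pT: "polyfun (\<lambda>s. T s $ i $ j)" for i j
    unfolding T_def by (cases "i = j"; cases "index_of i < index_of j"; simp; intro I)
  have pG: "polyfun (\<lambda>s. G s $ i $ j)" for i j unfolding G_def by (simp, intro I)
  have pA: "polyfun (\<lambda>s. adjoint_matrix (G s) $ i $ j)" for i j
    unfolding adjoint_matrix_def by (simp, rule polyfun_det) (simp, rule polyfun_if, simp_all add: pG)
  have pdet: "polyfun (\<lambda>s. det (G s))" by (rule polyfun_det) (rule pG)
  have pp: "polyfun (\<lambda>s. p s v)" for v
  proof (cases v)
    case None
    then show ?thesis unfolding p_def by (simp, intro I pk pdet)
  next
    case (Some ij)
    obtain i j where "ij = (i, j)" by (cases ij)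
    with Some show ?thesis unfolding p_def matrix_matrix_mult_def
      by (simp, intro I pk pT pG pA)
  qed
  have T0: "T 0 = t" using g(2) by (auto simp: T_def vec_eq_iff upper_tri_def not_less le_less)
  have G0: "G 0 = g" by (simp add: G_def vec_eq_iff)
  have G1: "G 1 = mat 1" by (simp add: G_def vec_eq_iff)
  have utT: "upper_tri (T s)" for s by (auto simp: upper_tri_def T_def)
  have detT: "det (mat x - T s) = det (mat x - t)" for x s
  proof -
    have "upper_tri (mat x - T s)" "upper_tri (mat x - t)"
      using utT[of s] g(2) by (auto simp: upper_tri_def mat_def)
    then show ?thesis by (simp add: det_upper_tri T_def)
  qed
  have detA: "det (mat x - ?A) = det (mat x - t)" for x by (rule mat_diff_mult[OF g(3,1)])
  have cone: "in_cone l (p s)" if "k s \<noteq> 0" "det (G s) \<noteq> 0" for s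
  proof -
    let ?H = "\<chi> i j. adjoint_matrix (G s) $ i $ j / det (G s)"
    define b where "b v = (case v of Some (i, j) \<Rightarrow> (G s ** T s ** ?H) $ i $ j | None \<Rightarrow> a None)" for v
    have mb: "matrix_of b = G s ** T s ** ?H" by (simp add: matrix_of_def b_def vec_eq_iff)
    have "matrix_of b ** G s = G s ** T s"
      unfolding mb matrix_mul_assoc[symmetric] adjoint_matrix(2)[OF that(2)] by simp
    then have "det (mat x - matrix_of b) = det (mat x - T s)" for x
      by (rule mat_diff_mult[OF _ that(2)])
    then have "in_cone l b" using a by (simp add: in_cone_def detT detA[symmetric] b_def)
    moreover have "p s = (\<lambda>v. (k s * det (G s)) * b v)"
    proof
      fix v show "p s v = (k s * det (G s)) * b v"
        using that(2) unfolding p_def b_def matrix_matrix_mult_def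
        by (auto simp: sum_distrib_left split: option.split intro!: sum.cong)
    qed
    ultimately show ?thesis using that by (simp add: in_cone_scale)
  qed
  have p0: "p 0 = a"
  proof
    fix v
    let ?H = "\<chi> i j. adjoint_matrix g $ i $ j / det g"
    have "?A = ?A ** g ** ?H" by (simp add: matrix_mul_assoc[symmetric] adjoint_matrix(1)[OF g(1)])
    then have A: "?A = g ** t ** ?H" by (simp add: g(3))
    have "a (Some (i, j)) = (1 / det g) * (g ** t ** adjoint_matrix g) $ i $ j" for i j
    proof -
      have "a (Some (i, j)) = ?A $ i $ j" by (simp add: matrix_of_def)
      also have "\<dots> = (g ** t ** ?H) $ i $ j" by (rule arg_cong[OF A])
      also have "\<dots> = (1 / det g) * (g ** t ** adjoint_matrix g) $ i $ j"
        unfolding matrix_matrix_mult_def[of "g ** t"] by (simp add: sum_divide_distrib)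
      finally show ?thesis .
    qed
    then show "p 0 v = a v"
      using g(1) by (auto simp: p_def k_def T0 G0 split: option.split)
  qed
  have n1: "nondeg (matrix_of (p 1)) \<noteq> 0"
  proof -
    have "adjoint_matrix (mat 1 :: 'k ^ 'n ^ 'n) = mat 1"
      using adjoint_matrix(1)[of "mat 1 :: 'k ^ 'n ^ 'n"] by (simp add: vec_eq_iff)
    then have "p 1 (Some (i, j)) = T 1 $ i $ j" for i j by (simp add: p_def G1 k_def)
    then have "matrix_of (p 1) = T 1" by (simp add: matrix_of_def vec_eq_iff)
    moreover have "nondeg (T 1) \<noteq> 0"
    proof (rule nondeg_superdiagonal)
      fix i j :: 'n
      show "T 1 $ i $ j = (if j = i then t $ i $ i else if index_of j = Suc (index_of i) then 1 else 0)"
        by (auto simp: T_def e_def)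
    qed
    ultimately show ?thesis by simp
  qed
  have pn: "polyfun (\<lambda>s. nondeg (matrix_of (p s)))"
    by (rule polyfun_nondeg) (simp add: matrix_of_def pp)
  obtain u where u: "k u * det (G u) * nondeg (matrix_of (p u)) \<noteq> 0" "meval (p u) f \<noteq> 0"
  proof (rule polyfun_common_nonzero)
    show "polyfun (\<lambda>s. k s * det (G s) * nondeg (matrix_of (p s)))" by (intro polyfun_mult pk pdet pn)
    show "polyfun (\<lambda>s. meval (p s) f)" by (rule polyfun_meval) (rule pp)
    show "k 1 * det (G 1) * nondeg (matrix_of (p 1)) \<noteq> 0" using n1 by (simp add: G1 k_def)
    show "meval (p 0) f \<noteq> 0" using fa p0 by simp
  qed
  then have "p u \<in> slice l r {}" using cone[of u] by (simp add: slice_def)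
  with f u(2) show False by (simp add: vanishing_ideal_def)
qed

section \<open>The generic matrix modulo the equations\<close>

definition cone_equations :: "(nat \<Rightarrow> int) \<Rightarrow> (('n::finite \<times> 'n) option, 'k::comm_ring_1) mpoly set" where
  "cone_equations l = (\<lambda>k. charpoly_coeff k - Const (of_int (l k)) * Zvar ^ k) ` {1..CARD('n)}"

lemma mpoly_eqI:
  fixes f g :: "('v::finite, 'k::field_char_0) mpoly"
  assumes "\<And>a. meval a f = meval a g"
  shows "f = g"
proof (rule ccontr)
  assume "f \<noteq> g"
  then obtain a where "meval a (f - g) \<noteq> 0" using mpoly_nonzero_value[of "f - g"] by auto
  with assms show False by (simp add: meval_diff)
qed

text \<open>Both facts hold at every point by the results over a field, and a polynomial over
  \<open>K\<close> is determined by its values.\<close>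

lemma coeff_charpoly_generic:
  fixes C :: "(('n::finite \<times> 'n) option, 'k::field_char_0) mpoly poly"
  defines "C \<equiv> charpoly generic_matrix"
  shows "poly.coeff C CARD('n) = 1" "Polynomial.degree C \<le> CARD('n)"
proof -
  have m: "meval a (poly.coeff C i) = poly.coeff (charpoly (matrix_of a)) i" for a i
    unfolding C_def map_poly_meval_charpoly[symmetric] by (simp add: coeff_map_poly)
  show "poly.coeff C CARD('n) = 1"
    by (rule mpoly_eqI) (simp add: m coeff_charpoly_top)
  show "Polynomial.degree C \<le> CARD('n)"
  proof (rule degree_le, intro allI impI)
    fix i assume i: "CARD('n) < i"
    show "poly.coeff C i = 0"
    proof (rule mpoly_eqI)
      fix a :: "('n, 'k) point"
      have "Polynomial.degree (charpoly (matrix_of a)) < i" using degree_charpoly_le[of "matrix_of a"] i by simp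
      then show "meval a (poly.coeff C i) = meval a 0" by (simp add: m coeff_eq_0)
    qed
  qed
qed

section \<open>Degree in the diagonal entries\<close>

definition diag_degree :: "(('n::finite \<times> 'n) option \<Rightarrow>\<^sub>0 nat) \<Rightarrow> nat" where
  "diag_degree m = (\<Sum>i\<in>UNIV. Poly_Mapping.lookup m (Some (i, i)))"

text \<open>Two bounds are tracked because the reduction lowers the degree in the diagonal entries
  without raising the total degree: the first makes it terminate, the second makes monomials
  countable.\<close>

definition bounded_polys :: "nat \<Rightarrow> nat \<Rightarrow> (('n::finite \<times> 'n) option, 'k::comm_ring_1) mpoly set" where
  "bounded_polys p q = {f. \<forall>m\<in>Poly_Mapping.keys f. diag_degree m \<le> p \<and> monomial_degree m \<le> q}"

lemma monomial_degree_alt: "monomial_degree m = (\<Sum>v\<in>UNIV. Poly_Mapping.lookup m v)" for m :: "'v::finite \<Rightarrow>\<^sub>0 nat"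
  unfolding monomial_degree_def by (rule sum.mono_neutral_left) (auto simp: in_keys_iff)

lemma monomial_degree_add: "monomial_degree (m + m') = monomial_degree m + monomial_degree m'" for m :: "'v::finite \<Rightarrow>\<^sub>0 nat"
  by (simp add: monomial_degree_alt lookup_add sum.distrib)

lemma diag_degree_add: "diag_degree (m + m') = diag_degree m + diag_degree m'"
  by (simp add: diag_degree_def lookup_add sum.distrib)

lemma bounded_polys_mono: "f \<in> bounded_polys p q \<Longrightarrow> p \<le> p' \<Longrightarrow> q \<le> q' \<Longrightarrow> f \<in> bounded_polys p' q'"
  unfolding bounded_polys_def mem_Collect_eq by (meson order_trans)

lemma bounded_polys_add: "f \<in> bounded_polys p q \<Longrightarrow> g \<in> bounded_polys p q \<Longrightarrow> f + g \<in> bounded_polys p q"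
  using Poly_Mapping.keys_add[of f g] unfolding bounded_polys_def by blast

lemma bounded_polys_zero [simp]: "0 \<in> bounded_polys p q"
  by (simp add: bounded_polys_def)

lemma bounded_polys_uminus: "f \<in> bounded_polys p q \<Longrightarrow> - f \<in> bounded_polys p q"
  by (simp add: bounded_polys_def in_keys_iff)

lemma bounded_polys_diff: "f \<in> bounded_polys p q \<Longrightarrow> g \<in> bounded_polys p q \<Longrightarrow> f - g \<in> bounded_polys p q"
  using bounded_polys_add[of f p q "- g"] by (simp add: bounded_polys_uminus)

lemma bounded_polys_sum: "(\<And>i. i \<in> I \<Longrightarrow> f i \<in> bounded_polys p q) \<Longrightarrow> sum f I \<in> bounded_polys p q"
  by (induction I rule: infinite_finite_induct) (auto intro: bounded_polys_add)

lemma bounded_polys_mult: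
  assumes "f \<in> bounded_polys p q" "g \<in> bounded_polys p' q'"
  shows "f * g \<in> bounded_polys (p + p') (q + q')"
  unfolding bounded_polys_def
proof (intro CollectI ballI)
  fix m assume "m \<in> Poly_Mapping.keys (f * g)"
  then obtain a b where "m = a + b" "a \<in> Poly_Mapping.keys f" "b \<in> Poly_Mapping.keys g"
    using Poly_Mapping.keys_mult[of f g] by blast
  with assms show "diag_degree m \<le> p + p' \<and> monomial_degree m \<le> q + q'"
    by (auto simp: bounded_polys_def diag_degree_add monomial_degree_add intro: add_mono)
qed

lemma bounded_polys_single: "diag_degree m \<le> p \<Longrightarrow> monomial_degree m \<le> q \<Longrightarrow> Poly_Mapping.single m c \<in> bounded_polys p q"
  by (cases "c = 0") (auto simp: bounded_polys_def)

lemma bounded_polys_Const [simp]: "Const c \<in> bounded_polys p q"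
  unfolding Const_def by (rule bounded_polys_single) (simp_all add: diag_degree_def monomial_degree_def)

lemma bounded_polys_one [simp]: "1 \<in> bounded_polys p q"
  using bounded_polys_Const[of 1] by (simp add: Const_one)

lemma bounded_polys_prod:
  "(\<And>i. i \<in> I \<Longrightarrow> f i \<in> bounded_polys (p i) (q i)) \<Longrightarrow> prod f I \<in> bounded_polys (sum p I) (sum q I)"
  by (induction I rule: infinite_finite_induct) (auto intro: bounded_polys_mult)

lemma bounded_polys_power: "f \<in> bounded_polys p q \<Longrightarrow> f ^ k \<in> bounded_polys (k * p) (k * q)"
  by (induction k) (auto dest: bounded_polys_mult)

lemma monomial_degree_single: "monomial_degree (Poly_Mapping.single v k) = k" for v :: "'v::finite"
  by (simp add: monomial_degree_alt lookup_single when_def)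

lemma diag_degree_single:
  "diag_degree (Poly_Mapping.single v k) = (if \<exists>i. v = Some (i, i) then k else 0)"
proof (cases "\<exists>i. v = Some (i, i)")
  case True
  then obtain i where "v = Some (i, i)" by blast
  then have "diag_degree (Poly_Mapping.single v k) = (\<Sum>j\<in>UNIV. if j = i then k else 0)"
    unfolding diag_degree_def by (intro sum.cong) (auto simp: lookup_single when_def)
  with True show ?thesis by simp
qed (auto simp: diag_degree_def lookup_single when_def)

lemma bounded_polys_Var: "Var v \<in> bounded_polys (if \<exists>i. v = Some (i, i) then 1 else 0) 1"
  unfolding Var_def by (rule bounded_polys_single) (auto simp: monomial_degree_single diag_degree_single)

text \<open>Evaluating the characteristic polynomial at a diagonal entry kills that entry on the diagonal.\<close>

lemma charpoly_at_diagonal_bounded: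
  fixes i :: "'n::finite"
  shows "(poly (charpoly generic_matrix) (Var (Some (i, i))) :: (('n \<times> 'n) option, 'k::comm_ring_1) mpoly)
     \<in> bounded_polys (CARD('n) - 1) CARD('n)"
proof -
  let ?x = "Var (Some (i, i)) :: (('n \<times> 'n) option, 'k) mpoly"
  let ?B = "mat ?x - generic_matrix"
  let ?p = "\<lambda>j. if j = i then 0 else 1 :: nat"
  have e: "?B $ j $ k \<in> bounded_polys (?p j) 1" for j k
  proof -
    have off: "- Var (Some (j, k)) \<in> (bounded_polys 0 1 :: (('n \<times> 'n) option, 'k) mpoly set)" if "j \<noteq> k"
      using bounded_polys_Var[of "Some (j, k)"] that by (intro bounded_polys_uminus) auto
    have dg: "Var (Some (j, j)) \<in> (bounded_polys 1 1 :: (('n \<times> 'n) option, 'k) mpoly set)" for j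
      using bounded_polys_Var[of "Some (j, j)"] by auto
    show ?thesis
    proof (cases "j = k")
      case True
      then show ?thesis using dg[of i] dg[of j] by (auto simp: mat_def generic_matrix_def intro: bounded_polys_diff)
    next
      case False
      then show ?thesis using off bounded_polys_mono[of "- Var (Some (j, k))" 0 1 1 1]
        by (auto simp: mat_def generic_matrix_def)
    qed
  qed
  have s: "of_int z \<in> (bounded_polys 0 0 :: (('n \<times> 'n) option, 'k) mpoly set)" for z
    unfolding single_of_int[symmetric] Const_def[symmetric] by (rule bounded_polys_Const)
  have sp: "sum ?p UNIV = CARD('n) - 1"
    by (simp add: sum.If_cases Collect_neg_eq Compl_eq_Diff_UNIV card_Diff_singleton)
  have "of_int (sign \<sigma>) * (\<Prod>j\<in>UNIV. ?B $ j $ \<sigma> j) \<in> bounded_polys (0 + sum ?p UNIV) (0 + (\<Sum>j\<in>(UNIV :: 'n set). 1))" for \<sigma>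
    by (intro bounded_polys_mult s bounded_polys_prod e)
  then have "det ?B \<in> bounded_polys (CARD('n) - 1) CARD('n)"
    unfolding det_def sp by (intro bounded_polys_sum) simp
  then show ?thesis by (simp add: poly_charpoly)
qed

text \<open>Modulo the equations, the characteristic polynomial at a diagonal entry x is x^n plus
  the terms with \<open>l k\<close>, z^k and x^(n-k). As a determinant it has diagonal degree below
  n, so x^n can be exchanged for terms of smaller diagonal degree and total degree at most
  n.\<close>

lemma diagonal_power_reduction:
  fixes P :: "(('n::finite \<times> 'n) option, 'k::field_char_0) mpoly set"
  assumes P: "prime_set P" and E: "cone_equations l \<subseteq> P"
  obtains r where "r \<in> bounded_polys (CARD('n) - 1) CARD('n)" "Var (Some (i, i)) ^ CARD('n) - r \<in> P"
proof -
  interpret prime_set P by (rule P)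
  let ?n = "CARD('n)"
  let ?x = "Var (Some (i, i)) :: (('n \<times> 'n) option, 'k) mpoly"
  let ?C = "charpoly generic_matrix :: (('n \<times> 'n) option, 'k) mpoly poly"
  let ?S = "\<Sum>k\<in>{1..?n}. Const (of_int (l k)) * Zvar ^ k * ?x ^ (?n - k)"
  have "poly ?C ?x = (\<Sum>j\<le>?n. poly.coeff ?C j * ?x ^ j)"
    unfolding poly_altdef using coeff_charpoly_generic(2)[where 'n='n and 'k='k]
    by (intro sum.mono_neutral_left) (auto simp: coeff_eq_0 not_le)
  also have "\<dots> = ?x ^ ?n + (\<Sum>j<?n. poly.coeff ?C j * ?x ^ j)"
    using coeff_charpoly_generic(1)[where 'n='n and 'k='k] by (simp add: lessThan_Suc_atMost[symmetric])
  also have "(\<Sum>j<?n. poly.coeff ?C j * ?x ^ j) = (\<Sum>k\<in>{1..?n}. charpoly_coeff k * ?x ^ (?n - k))"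
    unfolding charpoly_coeff_def
    by (rule sum.reindex_bij_witness[of _ "\<lambda>k. ?n - k" "\<lambda>j. ?n - j"]) auto
  finally have C: "poly ?C ?x = ?x ^ ?n + (\<Sum>k\<in>{1..?n}. charpoly_coeff k * ?x ^ (?n - k))" .
  have "(\<Sum>k\<in>{1..?n}. ?x ^ (?n - k) * (charpoly_coeff k - Const (of_int (l k)) * Zvar ^ k)) \<in> P"
  proof (intro sum mult)
    fix k assume "k \<in> {1..?n}"
    then show "charpoly_coeff k - Const (of_int (l k)) * Zvar ^ k \<in> P"
      using E by (auto simp: cone_equations_def)
  qed
  also have "(\<Sum>k\<in>{1..?n}. ?x ^ (?n - k) * (charpoly_coeff k - Const (of_int (l k)) * Zvar ^ k))
     = - (?x ^ ?n - (poly ?C ?x - ?S))"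
    unfolding C by (simp add: right_diff_distrib sum_subtractf mult_ac)
  finally have "- (?x ^ ?n - (poly ?C ?x - ?S)) \<in> P" .
  then have "?x ^ ?n - (poly ?C ?x - ?S) \<in> P" by (drule_tac uminus) (simp only: minus_minus)
  moreover have "poly ?C ?x - ?S \<in> bounded_polys (?n - 1) ?n"
  proof (intro bounded_polys_diff charpoly_at_diagonal_bounded bounded_polys_sum)
    fix k assume k: "k \<in> {1..?n}"
    have "Var (Some (i, i)) \<in> (bounded_polys 1 1 :: (('n \<times> 'n) option, 'k) mpoly set)"
      using bounded_polys_Var[of "Some (i, i)"] by auto
    then have "?x ^ (?n - k) \<in> bounded_polys ((?n - k) * 1) ((?n - k) * 1)" by (rule bounded_polys_power)
    moreover have "Zvar ^ k \<in> (bounded_polys (k * 0) (k * 1) :: (('n \<times> 'n) option, 'k) mpoly set)"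
      using bounded_polys_Var[of None] by (intro bounded_polys_power) (simp add: Zvar_def)
    \<comment> \<open>Since \<open>k \<ge> 1\<close>, the diagonal degree n - k is below n; the
      factor z^k brings the total degree to n.\<close>
    ultimately have "Const (of_int (l k)) * Zvar ^ k * ?x ^ (?n - k) \<in> bounded_polys (0 + k * 0 + (?n - k) * 1) (0 + k * 1 + (?n - k) * 1)"
      by (intro bounded_polys_mult) auto
    then show "Const (of_int (l k)) * Zvar ^ k * ?x ^ (?n - k) \<in> bounded_polys (?n - 1) ?n"
      by (rule bounded_polys_mono) (use k in auto)
  qed
  ultimately show thesis using that by blast
qed

section \<open>Reduction to small diagonal exponents, and counting monomials\<close>

definition reduced_monomials :: "nat \<Rightarrow> (('n::finite \<times> 'n) option \<Rightarrow>\<^sub>0 nat) set" where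
  "reduced_monomials L = {m. \<forall>v. Poly_Mapping.lookup m v < (if \<exists>i. v = Some (i, i) then CARD('n) else Suc L)}"

lemma lookup_le_monomial_degree: "Poly_Mapping.lookup m v \<le> monomial_degree m" for m :: "'v::finite \<Rightarrow>\<^sub>0 nat"
  unfolding monomial_degree_alt by (rule member_le_sum) auto

lemma card_exponents:
  fixes b :: "'v::finite \<Rightarrow> nat"
  shows "card {m :: 'v \<Rightarrow>\<^sub>0 nat. \<forall>v. Poly_Mapping.lookup m v < b v} = (\<Prod>v\<in>UNIV. b v)"
    and "finite {m :: 'v \<Rightarrow>\<^sub>0 nat. \<forall>v. Poly_Mapping.lookup m v < b v}"
proof -
  let ?M = "{m :: 'v \<Rightarrow>\<^sub>0 nat. \<forall>v. Poly_Mapping.lookup m v < b v}"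
  have "bij_betw Poly_Mapping.lookup ?M (PiE UNIV (\<lambda>v. {..<b v}))"
    by (rule bij_betw_byWitness[where f'=Abs_poly_mapping]) (auto simp: lookup_inverse)
  then show "card ?M = (\<Prod>v\<in>UNIV. b v)" "finite ?M"
    by (auto simp: bij_betw_same_card card_PiE bij_betw_finite finite_PiE)
qed

text \<open>A monomial of total degree at most \<open>L\<close> that is not reduced contains the
  n-th power of a diagonal entry. Replacing this power lowers the diagonal degree and keeps the
  total degree within \<open>L\<close>, so induction on the diagonal degree applies.\<close>

lemma reduced_monomials_span:
  fixes P :: "(('n::finite \<times> 'n) option, 'k::field_char_0) mpoly set"
  assumes P: "prime_set P" and E: "cone_equations l \<subseteq> P" and f: "f \<in> bounded_polys p L"
  shows "\<exists>c. f - (\<Sum>m\<in>reduced_monomials L. Poly_Mapping.single m (c m)) \<in> P"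
  using f
proof (induction p arbitrary: f rule: less_induct)
  case (less p)
  interpret prime_set P by (rule P)
  let ?I = "reduced_monomials L :: (('n \<times> 'n) option \<Rightarrow>\<^sub>0 nat) set"
  have fin: "finite ?I" unfolding reduced_monomials_def by (rule card_exponents)
  define N where "N = {f. \<exists>c. f - (\<Sum>m\<in>?I. Poly_Mapping.single m (c m)) \<in> P}"
  have N_add: "f + g \<in> N" if "f \<in> N" "g \<in> N" for f g
  proof -
    obtain c d where "f - (\<Sum>m\<in>?I. Poly_Mapping.single m (c m)) \<in> P" "g - (\<Sum>m\<in>?I. Poly_Mapping.single m (d m)) \<in> P"
      using \<open>f \<in> N\<close> \<open>g \<in> N\<close> unfolding N_def by blast
    then have "(f - (\<Sum>m\<in>?I. Poly_Mapping.single m (c m))) + (g - (\<Sum>m\<in>?I. Poly_Mapping.single m (d m))) \<in> P"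
      by (rule add)
    then have "f + g - (\<Sum>m\<in>?I. Poly_Mapping.single m (c m + d m)) \<in> P"
      by (simp add: single_add sum.distrib algebra_simps)
    then show ?thesis unfolding N_def by (intro CollectI exI[of _ "\<lambda>m. c m + d m"])
  qed
  have N_P: "f \<in> N" if "f \<in> P" for f
    unfolding N_def using that by (intro CollectI exI[of _ "\<lambda>_. 0"]) simp
  have N_sum: "sum f S \<in> N" if "\<And>i. i \<in> S \<Longrightarrow> f i \<in> N" for f :: "'b \<Rightarrow> _" and S
    using that by (induction S rule: infinite_finite_induct) (auto intro: N_add N_P zero)
  have N_single: "Poly_Mapping.single m b \<in> N" if m: "diag_degree m \<le> p" "monomial_degree m \<le> L" for m b
  proof (cases "m \<in> ?I")
    case True
    have "(\<Sum>m'\<in>?I. Poly_Mapping.single m' (if m' = m then b else 0)) = Poly_Mapping.single m b"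
      using True fin by (subst sum.mono_neutral_right[of _ "{m}"]) auto
    then show ?thesis unfolding N_def by (intro CollectI exI[of _ "\<lambda>m'. if m' = m then b else 0"]) (simp add: zero)
  next
    case False
    then obtain v where v: "\<not> Poly_Mapping.lookup m v < (if \<exists>i. v = Some (i, i) then CARD('n) else Suc L)"
      by (auto simp: reduced_monomials_def)
    then have "\<exists>i. v = Some (i, i)"
      using lookup_le_monomial_degree[of m v] m(2) by (auto split: if_splits)
    then obtain i where i: "v = Some (i, i)" by blast
    then have n: "CARD('n) \<le> Poly_Mapping.lookup m v" using v by auto
    define m' where "m' = m - Poly_Mapping.single v CARD('n)"
    have mm: "m = m' + Poly_Mapping.single v CARD('n)"
      using n by (intro poly_mapping_eqI) (auto simp: m'_def lookup_add lookup_minus lookup_single when_def)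
    have dm: "diag_degree m = diag_degree m' + CARD('n)" "monomial_degree m = monomial_degree m' + CARD('n)"
      using i by (subst mm; simp add: diag_degree_add monomial_degree_add diag_degree_single monomial_degree_single)+
    obtain r where r: "r \<in> bounded_polys (CARD('n) - 1) CARD('n)" "Var (Some (i, i)) ^ CARD('n) - r \<in> P"
      using diagonal_power_reduction[OF P E] by blast
    have "Poly_Mapping.single m' b \<in> bounded_polys (diag_degree m') (monomial_degree m')"
      by (rule bounded_polys_single) auto
    then have b: "Poly_Mapping.single m' b * r \<in> bounded_polys (diag_degree m' + (CARD('n) - 1)) (monomial_degree m' + CARD('n))"
      using r(1) by (rule bounded_polys_mult)
    have "Poly_Mapping.single m' b * r \<in> N"
      unfolding N_def
    proof (intro CollectI less.IH)
      show "diag_degree m' + (CARD('n) - 1) < p" using dm m zero_less_card_finite[where 'a='n] by linarith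
      show "Poly_Mapping.single m' b * r \<in> bounded_polys (diag_degree m' + (CARD('n) - 1)) L"
        using b by (rule bounded_polys_mono) (use dm m in auto)
    qed
    moreover have "Poly_Mapping.single m' b * (Var (Some (i, i)) ^ CARD('n) - r) \<in> N" by (intro N_P mult r)
    ultimately have "Poly_Mapping.single m' b * r + Poly_Mapping.single m' b * (Var (Some (i, i)) ^ CARD('n) - r) \<in> N"
      by (rule N_add)
    also have "Poly_Mapping.single m' b * r + Poly_Mapping.single m' b * (Var (Some (i, i)) ^ CARD('n) - r) = Poly_Mapping.single m b"
      by (subst mm) (simp add: right_diff_distrib Var_power mult_single i)
    finally show ?thesis .
  qed
  have "(\<Sum>m\<in>Poly_Mapping.keys f. Poly_Mapping.single m (Poly_Mapping.lookup f m)) \<in> N"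
    using less.prems by (intro N_sum N_single) (auto simp: bounded_polys_def)
  then show ?case unfolding mpoly_as_sum[symmetric] N_def by blast
qed

text \<open>Counting monomials: those in \<open>n\<^sup>2 - n + 2\<close> independent variables would outgrow the reduced ones.\<close>

lemma card_independent_le:
  fixes P :: "(('n::finite \<times> 'n) option, 'k::field_char_0) mpoly set"
  assumes P: "prime_set P" and E: "cone_equations l \<subseteq> P" and T: "independent_mod P T"
  shows "card T \<le> CARD('n)\<^sup>2 - CARD('n) + 1"
proof (rule ccontr)
  define N where "N = CARD('n)\<^sup>2 - CARD('n) + 1"
  assume "\<not> card T \<le> CARD('n)\<^sup>2 - CARD('n) + 1"
  then obtain T' where T': "T' \<subseteq> T" "card T' = Suc N"
    using obtain_subset_with_card_n[of "Suc N" T] by (auto simp: N_def)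
  interpret prime_set P by (rule P)
  let ?n = "CARD('n)"
  \<comment> \<open>\<open>D\<close> exceeds \<open>n ^ n * (N + 2) ^ N\<close>. There are
    \<open>D ^ (N + 1)\<close> monomials in \<open>N + 1\<close> variables with exponents below
    \<open>D\<close>, all of total degree at most \<open>L\<close>. The reduced monomials number
    \<open>n ^ n * (L + 1) ^ N\<close>, which is less because
    \<open>L + 1 \<le> (N + 2) * D\<close>.\<close>
  define D where "D = ?n ^ ?n * (N + 2) ^ N + 1"
  define L where "L = Suc N * D"
  define J where "J = {m :: ('n \<times> 'n) option \<Rightarrow>\<^sub>0 nat. \<forall>v. Poly_Mapping.lookup m v < (if v \<in> T' then D else 1)}"
  let ?I = "reduced_monomials L :: (('n \<times> 'n) option \<Rightarrow>\<^sub>0 nat) set"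
  have finI: "finite ?I" unfolding reduced_monomials_def by (rule card_exponents)
  have finJ: "finite J" unfolding J_def by (rule card_exponents)
  have "card J = D ^ Suc N"
    unfolding J_def card_exponents by (simp add: prod.If_cases T'(2))
  let ?dg = "{v :: ('n \<times> 'n) option. \<exists>i. v = Some (i, i)}"
  have cdg: "card ?dg = ?n"
  proof -
    have "?dg = range (\<lambda>i. Some (i, i))" by auto
    then show ?thesis by (simp add: card_image inj_def)
  qed
  have "card (UNIV :: ('n \<times> 'n) option set) = Suc (?n * ?n)" by (simp add: card_UNIV_option card_prod)
  \<comment> \<open>The n^2 - n entries off the diagonal, and \<open>None\<close> for z.\<close>
  then have cndg: "card (- ?dg) = N"
    using cdg card_Diff_subset[of ?dg UNIV] le_square[of ?n]
    by (simp add: Compl_eq_Diff_UNIV N_def power2_eq_square Suc_diff_le)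
  have "card ?I = ?n ^ ?n * Suc L ^ N"
    unfolding reduced_monomials_def card_exponents by (subst prod.If_cases) (simp_all add: cdg cndg)
  also have "\<dots> \<le> ?n ^ ?n * ((N + 2) * D) ^ N"
    by (intro mult_left_mono power_mono) (auto simp: L_def D_def)
  also have "\<dots> = (?n ^ ?n * (N + 2) ^ N) * D ^ N" by (simp only: power_mult_distrib mult.assoc)
  also have "\<dots> < D * D ^ N" by (intro mult_strict_right_mono) (auto simp: D_def)
  also have "\<dots> = card J" using \<open>card J = D ^ Suc N\<close> by simp
  finally have IJ: "card ?I < card J" .
  have "\<forall>m. \<exists>c. m \<in> J \<longrightarrow> Poly_Mapping.single m 1 - (\<Sum>i\<in>?I. Poly_Mapping.single i (c i)) \<in> P"
  proof
    fix m :: "('n \<times> 'n) option \<Rightarrow>\<^sub>0 nat"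
    show "\<exists>c. m \<in> J \<longrightarrow> Poly_Mapping.single m 1 - (\<Sum>i\<in>?I. Poly_Mapping.single i (c i)) \<in> P"
    proof (cases "m \<in> J")
      case True
      have "monomial_degree m \<le> (\<Sum>v\<in>UNIV. if v \<in> T' then D else 0)"
        unfolding monomial_degree_alt using True by (intro sum_mono) (auto simp: J_def split: if_splits dest!: spec)
      also have "\<dots> = L" by (simp add: sum.If_cases L_def T'(2))
      finally have "Poly_Mapping.single m 1 \<in> (bounded_polys (diag_degree m) L :: (('n \<times> 'n) option, 'k) mpoly set)"
        by (intro bounded_polys_single) auto
      from reduced_monomials_span[OF P E this] show ?thesis by blast
    qed auto
  qed
  then obtain c where c: "\<forall>m. m \<in> J \<longrightarrow> Poly_Mapping.single m 1 - (\<Sum>i\<in>?I. Poly_Mapping.single i (c m i)) \<in> P"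
    unfolding choice_iff by (elim exE)
  have z: "prime_set {0 :: 'k}" by unfold_locales auto
  have "\<exists>b. (\<forall>m\<in>J. b m \<in> (UNIV :: 'k set)) \<and> (\<exists>m\<in>J. b m \<notin> {0}) \<and> (\<forall>i\<in>?I. (\<Sum>m\<in>J. b m * c m i) \<in> {0})"
    by (rule prime_set.linear_dependence[OF z]) (use finI finJ IJ in auto)
  then obtain b where b: "\<exists>m\<in>J. b m \<noteq> 0" "\<forall>i\<in>?I. (\<Sum>m\<in>J. b m * c m i) = 0" by auto
  define f where "f = (\<Sum>m\<in>J. Poly_Mapping.single m (b m))"
  have "(\<Sum>m\<in>J. Const (b m) * (Poly_Mapping.single m 1 - (\<Sum>i\<in>?I. Poly_Mapping.single i (c m i)))) \<in> P"
    using c by (intro sum mult) blast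
  also have "(\<Sum>m\<in>J. Const (b m) * (Poly_Mapping.single m 1 - (\<Sum>i\<in>?I. Poly_Mapping.single i (c m i))))
     = f - (\<Sum>m\<in>J. \<Sum>i\<in>?I. Poly_Mapping.single i (b m * c m i))"
    by (simp add: f_def Const_def right_diff_distrib sum_distrib_left sum_subtractf mult_single)
  also have "(\<Sum>m\<in>J. \<Sum>i\<in>?I. Poly_Mapping.single i (b m * c m i)) = (\<Sum>i\<in>?I. Poly_Mapping.single i (\<Sum>m\<in>J. b m * c m i))"
  proof -
    have "(\<Sum>m\<in>J. Poly_Mapping.single i (b m * c m i)) = Poly_Mapping.single i (\<Sum>m\<in>J. b m * c m i)" for i
      using finJ by induction (auto simp: single_add)
    then show ?thesis by (subst sum.swap) simp
  qed
  also have "\<dots> = 0" using b(2) by simp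
  finally have fP: "f \<in> P" by simp
  have lf: "Poly_Mapping.lookup f m = (if m \<in> J then b m else 0)" for m
    using finJ by (simp add: f_def lookup_sum lookup_single when_def)
  have "f \<in> polys_in T"
    unfolding polys_in_def
  proof (intro CollectI ballI subsetI)
    fix m v assume "m \<in> Poly_Mapping.keys f" "v \<in> Poly_Mapping.keys m"
    then have "m \<in> J" "Poly_Mapping.lookup m v \<noteq> 0" by (auto simp: in_keys_iff lf split: if_splits)
    then have "v \<in> T'" by (auto simp: J_def split: if_splits dest!: spec[of _ v])
    with T'(1) show "v \<in> T" by blast
  qed
  with T fP have "f = 0" by (simp add: independent_mod_def)
  obtain m where m: "m \<in> J" "b m \<noteq> 0" using b(1) by blast
  have "Poly_Mapping.lookup f m = 0" using \<open>f = 0\<close> by simp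
  with m lf[of m] show False by simp
qed

section \<open>Chains of homogeneous primes\<close>

text \<open>\<open>T\<close> stays independent modulo the smaller prime. Were it maximal there, an
  element of \<open>Q\<close> outside \<open>P\<close> would divide some \<open>b\<close> in
  \<open>polys_in T\<close> modulo \<open>P\<close> with \<open>b\<close> outside \<open>P\<close>;
  this nonzero \<open>b\<close> would lie in \<open>Q\<close>, against independence modulo
  \<open>Q\<close>.\<close>

lemma independent_mod_grows:
  fixes P :: "('v::finite, 'k::comm_ring_1) mpoly set"
  assumes P: "prime_set P" and Q: "prime_set Q" and "P \<subset> Q" and T: "independent_mod Q T"
  obtains T' where "independent_mod P T'" "card T' = Suc (card T)"
proof -
  interpret Q: prime_set Q by (rule Q)
  have TP: "independent_mod P T" using T \<open>P \<subset> Q\<close> unfolding independent_mod_def by blast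
  have "\<not> maximal_independent P T"
  proof
    assume "maximal_independent P T"
    then interpret maximal_independent P T .
    obtain f where f: "f \<in> Q" "f \<notin> P" using \<open>P \<subset> Q\<close> by blast
    obtain b h where b: "b \<in> polys_in T" "b \<notin> P" "b - f * h \<in> P" using divides_base[OF f(2)] by blast
    have "b - f * h \<in> Q" "f * h \<in> Q" using b(3) \<open>P \<subset> Q\<close> Q.mult_right[OF f(1)] by auto
    then have "b \<in> Q" using Q.diff_cong by blast
    with T b(1) have "b = 0" by (simp add: independent_mod_def)
    with b(2) zero show False by simp
  qed
  then obtain v where "v \<notin> T" "independent_mod P (insert v T)"
    using P TP by (auto simp: maximal_independent_def maximal_independent_axioms_def)
  with that show thesis by simp
qed

text \<open>Some variable lies outside \<open>Q\<close>, as otherwise \<open>Q\<close> would contain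
  the irrelevant ideal. A polynomial in this variable alone has homogeneous components that are
  constants times its powers, and no nonzero one of these is in \<open>Q\<close>.\<close>

lemma Proj_point_independent_var:
  fixes Q :: "('v::finite, 'k::field) mpoly set"
  assumes Q: "Q \<in> Proj_points"
  obtains v where "independent_mod Q {v}"
proof -
  interpret prime_set Q using Q by (simp add: Proj_points_def homogeneous_prime_iff)
  have hom: "homogeneous_component d f \<in> Q" if "f \<in> Q" for f d
    using Q that by (simp add: Proj_points_def homogeneous_prime_def)
  have "\<exists>v. Var v \<notin> Q"
  proof (rule ccontr)
    assume "\<not> ?thesis"
    then have V: "Var v \<in> Q" for v by blast
    have "f \<in> Q" if f: "f \<in> irrelevant_ideal" for f
    proof -
      have "Poly_Mapping.single m (Poly_Mapping.lookup f m) \<in> Q" if m: "m \<in> Poly_Mapping.keys f" for m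
      proof (cases "m = 0")
        case True
        have "{m \<in> Poly_Mapping.keys f. monomial_degree m = 0} = {0}"
          using m True by (auto simp: monomial_degree_def in_keys_iff intro!: poly_mapping_eqI)
        then have "homogeneous_component 0 f = Poly_Mapping.single 0 (Poly_Mapping.lookup f 0)"
          by (simp add: homogeneous_component_def)
        then have "Poly_Mapping.single 0 (Poly_Mapping.lookup f 0) = (0 :: ('v, 'k) mpoly)"
          using f by (simp add: irrelevant_ideal_def)
        then have "Poly_Mapping.lookup (Poly_Mapping.single 0 (Poly_Mapping.lookup f 0) :: ('v, 'k) mpoly) 0 = 0"
          by (simp only: lookup_zero)
        then have "Poly_Mapping.lookup f 0 = 0" by (simp only: lookup_single_eq)
        with True show ?thesis by (simp add: zero)
      next
        case False
        then obtain v where v: "Poly_Mapping.lookup m v \<noteq> 0" using poly_mapping_eqI[of m 0] by auto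
        define m' where "m' = m - Poly_Mapping.single v 1"
        have "m = Poly_Mapping.single v 1 + m'"
          using v by (intro poly_mapping_eqI) (auto simp: m'_def lookup_add lookup_minus lookup_single when_def)
        then have "Poly_Mapping.single m (Poly_Mapping.lookup f m) = Var v * Poly_Mapping.single m' (Poly_Mapping.lookup f m)"
          by (simp add: Var_def mult_single)
        with mult_right[OF V] show ?thesis by simp
      qed
      then have "(\<Sum>m\<in>Poly_Mapping.keys f. Poly_Mapping.single m (Poly_Mapping.lookup f m)) \<in> Q" by (rule sum)
      then show ?thesis unfolding mpoly_as_sum[symmetric] .
    qed
    with Q show False by (auto simp: Proj_points_def)
  qed
  then obtain v where v: "Var v \<notin> Q" by blast
  have "f = 0" if f: "f \<in> polys_in {v}" "f \<in> Q" for f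
  proof (rule ccontr)
    assume "f \<noteq> 0"
    then obtain m where m: "m \<in> Poly_Mapping.keys f" using keys_eq_empty[of f] by blast
    have kv: "m' = Poly_Mapping.single v (monomial_degree m')" if "m' \<in> Poly_Mapping.keys f" for m'
    proof -
      have k: "Poly_Mapping.keys m' \<subseteq> {v}" using f(1) that by (auto simp: polys_in_def)
      then have l0: "Poly_Mapping.lookup m' w = 0" if "w \<noteq> v" for w using that by (auto simp: in_keys_iff)
      have "monomial_degree m' = (\<Sum>w\<in>{v}. Poly_Mapping.lookup m' w)"
        unfolding monomial_degree_def using k by (intro sum.mono_neutral_left) (auto simp: in_keys_iff)
      then show ?thesis
        by (intro poly_mapping_eqI) (auto simp: lookup_single when_def l0)
    qed
    have "{m' \<in> Poly_Mapping.keys f. monomial_degree m' = monomial_degree m} = {m}"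
    proof (intro equalityI subsetI)
      fix m' assume "m' \<in> {m' \<in> Poly_Mapping.keys f. monomial_degree m' = monomial_degree m}"
      then have "m' = Poly_Mapping.single v (monomial_degree m)" using kv[of m'] by simp
      then show "m' \<in> {m}" using kv[OF m] by simp
    qed (use m in simp)
    then have "homogeneous_component (monomial_degree m) f = Poly_Mapping.single m (Poly_Mapping.lookup f m)"
      by (simp add: homogeneous_component_def)
    also have "\<dots> = Const (Poly_Mapping.lookup f m) * Var v ^ monomial_degree m"
      by (simp add: Var_power Const_def mult_single kv[OF m, symmetric])
    finally have "homogeneous_component (monomial_degree m) f = Const (Poly_Mapping.lookup f m) * Var v ^ monomial_degree m" .
    with hom[OF f(2), of "monomial_degree m"] have "Const (Poly_Mapping.lookup f m) * Var v ^ monomial_degree m \<in> Q" by simp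
    then have "Const (Poly_Mapping.lookup f m) \<in> Q" using prime power_notin[OF v] by blast
    then have "Const (inverse (Poly_Mapping.lookup f m)) * Const (Poly_Mapping.lookup f m) \<in> Q" by (rule mult)
    moreover have "Poly_Mapping.lookup f m \<noteq> 0" using m by (simp add: in_keys_iff)
    ultimately show False using one by (simp add: Const_mult[symmetric] Const_one)
  qed
  then show thesis using that[of v] by (simp add: independent_mod_def)
qed

text \<open>The largest prime of the chain leaves one variable independent and each step down adds
  another, so \<open>p 0\<close> has \<open>d + 1\<close> of them, against the bound n^2 - n +
  1.\<close>

lemma chain_length_le:
  fixes p :: "nat \<Rightarrow> (('n::finite \<times> 'n) option, 'k::field_char_0) mpoly set"
  assumes p: "\<And>i. i \<le> d \<Longrightarrow> p i \<in> Proj_zeros (cone_equations l)" and lt: "\<And>i. i < d \<Longrightarrow> p i \<subset> p (Suc i)"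
  shows "d \<le> CARD('n)\<^sup>2 - CARD('n)"
proof -
  have pr: "prime_set (p i)" if "i \<le> d" for i
    using p[OF that] by (simp add: Proj_zeros_def Proj_points_def homogeneous_prime_iff)
  have "\<exists>T. independent_mod (p (d - i)) T \<and> card T = Suc i" if "i \<le> d" for i
    using that
  proof (induction i)
    case 0
    have "p d \<in> Proj_points" using p[of d] by (simp add: Proj_zeros_def)
    then obtain v where "independent_mod (p d) {v}" by (rule Proj_point_independent_var)
    then show ?case by (intro exI[of _ "{v}"]) simp
  next
    case (Suc i)
    then obtain T where T: "independent_mod (p (d - i)) T" "card T = Suc i" by auto
    have "p (d - Suc i) \<subset> p (d - i)" using lt[of "d - Suc i"] Suc.prems by (simp add: Suc_diff_Suc)
    from independent_mod_grows[OF pr pr this T(1)] T(2) show ?case by auto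
  qed
  from this[of d] obtain T where T: "independent_mod (p 0) T" "card T = Suc d" by auto
  have E: "cone_equations l \<subseteq> p 0" using p[of 0] by (simp add: Proj_zeros_def)
  have "card T \<le> CARD('n)\<^sup>2 - CARD('n) + 1" by (rule card_independent_le[OF pr E T(1)]) simp
  with T(2) show ?thesis by simp
qed

section \<open>A chain of maximal length from linear slices\<close>

definition shift_point :: "('n::finite, 'k::field_char_0) point" where
  "shift_point v = (case v of Some (i, j) \<Rightarrow> if index_of j = Suc (index_of i) then 1 else 0 | None \<Rightarrow> 1)"

text \<open>\<open>shift_point\<close> need not lie in the cone itself. It prescribes the rows above
  the last at z = 1, and solving for the last row turns it into the companion matrix of the target
  polynomial.\<close>

lemma nondeg_shift_point: "nondeg (matrix_of shift_point :: 'k::field_char_0 ^ 'n::finite ^ 'n) \<noteq> 0"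
  by (rule nondeg_superdiagonal[of _ "\<lambda>_. 0"]) (auto simp: matrix_of_def shift_point_def)

definition slice_ideal :: "(nat \<Rightarrow> int) \<Rightarrow> ('n \<times> 'n) set \<Rightarrow> (('n::finite \<times> 'n) option, 'k::field_char_0) mpoly set" where
  "slice_ideal l S = vanishing_ideal (slice l (\<lambda>s. shift_point (Some s)) S)"

text \<open>The completed shift point lies in every such slice, which is therefore nonempty; as z =
  1 there, the variable z is outside the ideal, and so the irrelevant ideal is not contained in
  it.\<close>

lemma slice_ideal_in_Proj_zeros:
  assumes S: "\<And>s. s \<in> S \<Longrightarrow> fst s \<noteq> last_row"
  shows "(slice_ideal l S :: (('n::finite \<times> 'n) option, 'k::field_char_0) mpoly set) \<in> Proj_zeros (cone_equations l)"
proof -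
  let ?Y = "slice l (\<lambda>s. shift_point (Some s)) S :: ('n, 'k) point set"
  let ?d = "nondeg (matrix_of shift_point :: 'k ^ 'n ^ 'n)"
  let ?a = "complete_row l (1 / ?d) shift_point :: ('n, 'k) point"
  have a: "?a \<in> ?Y"
    by (rule complete_row_in_slice) (auto simp: nondeg_shift_point S shift_point_def)
  have aN: "?a None = 1" using nondeg_shift_point[where 'n='n and 'k='k] by (simp add: complete_row_def shift_point_def)
  have "prime_set (slice_ideal l S :: (('n \<times> 'n) option, 'k) mpoly set)"
    unfolding slice_ideal_def by (rule prime_vanishing_ideal_slice) (use a S in auto)
  moreover have "homogeneous_component d f \<in> slice_ideal l S" if "f \<in> slice_ideal l S" for f :: "(('n \<times> 'n) option, 'k) mpoly" and d
    unfolding slice_ideal_def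
  proof (rule homogeneous_component_vanishing)
    fix b :: "('n, 'k) point" and c :: 'k assume b: "b \<in> ?Y" and c: "c \<noteq> 0"
    have "matrix_of (\<lambda>v. c * b v) = (\<chi> i j. c * matrix_of b $ i $ j)" by (simp add: matrix_of_def vec_eq_iff)
    then have "nondeg (matrix_of (\<lambda>v. c * b v)) \<noteq> 0" using b nondeg_scale[OF _ c, of "matrix_of b"] by (simp add: slice_def)
    then show "(\<lambda>v. c * b v) \<in> ?Y" using b c by (auto simp: slice_def in_cone_scale)
  qed (use that in \<open>simp add: slice_ideal_def\<close>)
  moreover have "\<not> irrelevant_ideal \<subseteq> (slice_ideal l S :: (('n \<times> 'n) option, 'k) mpoly set)"
  proof
    assume *: "irrelevant_ideal \<subseteq> (slice_ideal l S :: (('n \<times> 'n) option, 'k) mpoly set)"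
    have "{m \<in> Poly_Mapping.keys (Var None :: (('n \<times> 'n) option, 'k) mpoly). monomial_degree m = 0} = {}"
      by (auto simp: Var_def monomial_degree_single)
    then have "(Var None :: (('n \<times> 'n) option, 'k) mpoly) \<in> irrelevant_ideal"
      unfolding irrelevant_ideal_def homogeneous_component_def by (simp only: sum.empty mem_Collect_eq)
    with * have "meval ?a (Var None) = 0" using a unfolding slice_ideal_def vanishing_ideal_def by blast
    with aN show False by simp
  qed
  moreover have "cone_equations l \<subseteq> (slice_ideal l S :: (('n \<times> 'n) option, 'k) mpoly set)"
    unfolding cone_equations_def slice_ideal_def vanishing_ideal_def slice_def using in_cone_iff by blast
  ultimately show ?thesis
    by (simp add: Proj_zeros_def Proj_points_def homogeneous_prime_iff)
qed

text \<open>The ideals are separated by the linear form that expresses the added condition: it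
  vanishes on the smaller slice by definition but not on the larger one.\<close>

lemma slice_ideal_psubset:
  assumes S: "\<And>s. s \<in> S \<Longrightarrow> fst s \<noteq> last_row" and s: "s \<notin> S" "fst s \<noteq> last_row"
  shows "(slice_ideal l S :: (('n::finite \<times> 'n) option, 'k::field_char_0) mpoly set) \<subset> slice_ideal l (insert s S)"
proof
  show "slice_ideal l S \<subseteq> (slice_ideal l (insert s S) :: (('n \<times> 'n) option, 'k) mpoly set)"
    by (auto simp: slice_ideal_def vanishing_ideal_def slice_def)
  let ?f = "Var (Some s) - Const (shift_point (Some s)) * Var None :: (('n \<times> 'n) option, 'k) mpoly"
  have "?f \<in> slice_ideal l (insert s S)"
    by (auto simp: slice_ideal_def vanishing_ideal_def slice_def meval_simps)
  moreover have "?f \<notin> slice_ideal l S"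
  proof
    assume f: "?f \<in> slice_ideal l S"
    \<comment> \<open>Moves only the coordinate \<open>s\<close>, so the conditions in
      \<open>S\<close> persist. A nonzero parameter that keeps nondegeneracy gives, after
      completion, a point where the linear form is nonzero.\<close>
    define h where "h \<tau> = (shift_point :: ('n, 'k) point)(Some s := shift_point (Some s) + \<tau>)" for \<tau>
    have hp: "polyfun (\<lambda>\<tau>. h \<tau> v)" for v
      by (cases "v = Some s") (auto simp: h_def intro: polyfun_add)
    have h0: "h 0 = shift_point" by (simp add: h_def)
    obtain u where u: "nondeg (matrix_of (h u)) \<noteq> 0" "u \<noteq> 0"
    proof (rule polyfun_common_nonzero)
      show "polyfun (\<lambda>\<tau>. nondeg (matrix_of (h \<tau>)))" by (rule polyfun_nondeg) (simp add: matrix_of_def hp)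
      show "polyfun (\<lambda>\<tau>. \<tau> :: 'k)" "(1 :: 'k) \<noteq> 0" by simp_all
      show "nondeg (matrix_of (h 0)) \<noteq> 0" unfolding h0 by (rule nondeg_shift_point)
    qed
    let ?a = "complete_row l (1 / nondeg (matrix_of (h u))) (h u)"
    have "?a \<in> slice l (\<lambda>s. shift_point (Some s)) S"
    proof (rule complete_row_in_slice)
      show "h u (Some s') = h u None * shift_point (Some s')" if "s' \<in> S" for s'
        using that s(1) by (auto simp: h_def shift_point_def)
    qed (use u S in auto)
    then have "meval ?a ?f = 0" using f unfolding slice_ideal_def vanishing_ideal_def by blast
    moreover have "?a (Some s) = h u (Some s)" "?a None = h u None"
      using s(2) u(1) by (auto simp: complete_row_def split: prod.split)
    moreover have "h u (Some s) = shift_point (Some s) + u" "h u None = 1"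
      by (simp_all add: h_def shift_point_def)
    ultimately show False using u(2) by (simp add: meval_simps)
  qed
  ultimately show "slice_ideal l S \<noteq> (slice_ideal l (insert s S) :: (('n \<times> 'n) option, 'k) mpoly set)" by blast
qed

theorem propositionA1:
  fixes l :: "nat \<Rightarrow> int"
  shows "let V = (charpoly_scheme l ::
             (('n::finite \<times> 'n) option, 'k::{alg_closed_field, field_char_0}) mpoly set topology)
         in irreducible_space V \<and> krull_dimension V = ereal (real (CARD('n)\<^sup>2 - CARD('n)))"
proof -
  let ?E = "cone_equations l :: (('n \<times> 'n) option, 'k) mpoly set"
  have V: "charpoly_scheme l = Proj_closed_subscheme ?E"
    by (simp add: charpoly_scheme_def cone_equations_def)
  \<comment> \<open>This ideal is the generic point of the scheme: for \<open>f\<close> outside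
    \<open>P\<close>, some zero of \<open>P\<close> with \<open>f\<close> nonzero would be a point
    of the cone, where \<open>f\<close> must vanish.\<close>
  have min: "slice_ideal l {} \<subseteq> P" if P: "P \<in> Proj_zeros ?E" for P
  proof
    fix f :: "(('n \<times> 'n) option, 'k) mpoly" assume f: "f \<in> slice_ideal l {}"
    have pr: "prime_set P" and EP: "?E \<subseteq> P"
      using P by (simp_all add: Proj_zeros_def Proj_points_def homogeneous_prime_iff)
    show "f \<in> P"
    proof (rule ccontr)
      assume "f \<notin> P"
      then obtain a where a: "\<And>g. g \<in> P \<Longrightarrow> meval a g = 0" "meval a f \<noteq> 0"
        using Nullstellensatz_prime[OF pr] by blast
      then have "in_cone l a" unfolding in_cone_iff using EP by (auto simp: cone_equations_def)
      with f a(2) show False unfolding slice_ideal_def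
        using vanishing_on_slice_imp_vanishing_on_cone by blast
    qed
  qed
  have irr: "irreducible_space (Proj_closed_subscheme ?E)"
    by (rule irreducible_Proj_closed_subscheme[OF slice_ideal_in_Proj_zeros min]) auto
  \<comment> \<open>The matrix positions outside the last row, enumerated by \<open>e\<close>;
    \<open>S i\<close> imposes the conditions at the first \<open>i\<close> of them.\<close>
  let ?R = "(- {last_row}) \<times> UNIV :: ('n \<times> 'n) set"
  have "card ?R = CARD('n)\<^sup>2 - CARD('n)"
    by (simp add: card_cartesian_product Compl_eq_Diff_UNIV card_Diff_singleton power2_eq_square diff_mult_distrib)
  then obtain e where e: "bij_betw e {0..<CARD('n)\<^sup>2 - CARD('n)} ?R"
    using ex_bij_betw_nat_finite[of ?R] by auto
  define S where "S i = e ` {0..<i}" for i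
  have eR: "fst (e j) \<noteq> last_row" if "j < CARD('n)\<^sup>2 - CARD('n)" for j
  proof -
    have "e j \<in> ?R" using bij_betwE[OF e] that by simp
    then show ?thesis by (auto simp: mem_Times_iff)
  qed
  have "krull_dimension (Proj_closed_subscheme ?E) = ereal (real (CARD('n)\<^sup>2 - CARD('n)))"
  proof (rule krull_dimension_Proj_closed_subscheme)
    show "slice_ideal l (S i) \<in> Proj_zeros ?E" if "i \<le> CARD('n)\<^sup>2 - CARD('n)" for i
      by (rule slice_ideal_in_Proj_zeros) (use that eR in \<open>auto simp: S_def\<close>)
    show "slice_ideal l (S i) \<subset> (slice_ideal l (S (Suc i)) :: (('n \<times> 'n) option, 'k) mpoly set)"
      if i: "i < CARD('n)\<^sup>2 - CARD('n)" for i
    proof -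
      have "S (Suc i) = insert (e i) (S i)" by (auto simp: S_def less_Suc_eq)
      moreover have "e i \<notin> S i"
      proof
        assume "e i \<in> S i"
        then obtain j where j: "j < i" "e i = e j" by (auto simp: S_def)
        have "i = j"
          by (rule inj_onD[OF bij_betw_imp_inj_on[OF e] j(2)]) (use i j(1) in auto)
        with j(1) show False by simp
      qed
      moreover have "fst s \<noteq> last_row" if "s \<in> S i" for s using that eR i by (auto simp: S_def)
      ultimately show ?thesis using slice_ideal_psubset[of "S i" "e i" l] eR[OF i] by simp
    qed
  qed (rule chain_length_le)
  with irr show ?thesis by (simp add: V Let_def)
qed

end
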